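(* Let $E: y^2 = 4x^3 - g_2 x - g_3$ be an elliptic curve over $\mathbb{C}$ with discriminant $\Delta(E) = g_2^3 - 27 g_3^2$ and period lattice $\Lambda(E) = \mathbb{Z}\omega_1 + \mathbb{Z}\omega_2$, and let $\tau = \omega_2/\omega_1$ lie in the upper half-plane. Let $\lambda = \lambda(\tau)$. Then for $\tau$ around $0$, $$\omega_1 = 2^{1/3}\, \frac{\pi i}{\tau}\, (\lambda(1-\lambda))^{1/6}\, \Delta(E)^{-1/12}\, {}_{2}F_{1}\Big(\tfrac12, \tfrac12; 1; 1-\lambda\Big).$$
   Context: $\lambda(\tau)$ is the modular lambda function on the upper half-plane, with $q$-expansion $\lambda(\tau) = 16q^{1/2} - 128 q + 704 q^{3/2} - \cdots$, $q = e^{2\pi i\tau}$; it satisfies $\lambda(\tau\pm1)=\lambda(\tau)/(\lambda(\tau)-1)$ and $\lambda(-1/\tau)=1-\lambda(\tau)$. "$\tau$ around $0$" means $\tau$ lies in the fundamental domain of $\Gamma(2)$ near the cusp $0$, where $\lambda(\tau)\to 1$ (so $|1-\lambda(\tau)|<1$). ${}_{2}F_{1}$ is the Gauss hypergeometric function. The fractional powers are taken with compatible branches (consistent with $\Delta(\tau)=\omega_1^{12}\Delta(E)$, where $\Delta(\tau)=(2\pi)^{12}\eta(\tau)^{24}$ and $\eta$ is the Dedekind eta function). *)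

theory Defs
  imports "HOL-Analysis.Analysis"
begin

definition upper_half_plane :: "complex set" where
  "upper_half_plane = {\<tau>. Im \<tau> > 0}"

section \<open>Elliptic curves in Weierstrass form and their period lattices\<close>

definition affine_curve :: "complex \<Rightarrow> complex \<Rightarrow> (complex \<times> complex) set" where
  "affine_curve g2 g3 = {(x, y). y ^ 2 = 4 * x ^ 3 - g2 * x - g3}"

definition curve_disc :: "complex \<Rightarrow> complex \<Rightarrow> complex" where
  "curve_disc g2 g3 = g2 ^ 3 - 27 * g3 ^ 2"

definition int_span :: "complex \<Rightarrow> complex \<Rightarrow> complex set" where
  "int_span \<omega>1 \<omega>2 = {of_int m * \<omega>1 + of_int n * \<omega>2 | m n. True}"

text \<open>
  Since \<open>x / 0 = 0\<close>, the condition on the imaginary part also excludes \<open>\<omega>1 = 0\<close>;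
  it says that \<open>\<omega>1\<close> and \<open>\<omega>2\<close> are linearly independent over the reals.
\<close>
definition is_lattice :: "complex set \<Rightarrow> bool" where
  "is_lattice \<Lambda> \<longleftrightarrow> (\<exists>\<omega>1 \<omega>2. Im (\<omega>2 / \<omega>1) \<noteq> 0 \<and> \<Lambda> = int_span \<omega>1 \<omega>2)"

definition weierstrass_p :: "complex set \<Rightarrow> complex \<Rightarrow> complex" where
  "weierstrass_p \<Lambda> z =
     1 / z ^ 2 + (\<Sum>\<^sub>\<infinity>\<omega>\<in>\<Lambda> - {0}. 1 / (z - \<omega>) ^ 2 - 1 / \<omega> ^ 2)"

text \<open>
  The period lattice of \<open>y\<^sup>2 = 4x\<^sup>3 - g2 x - g3\<close> is the lattice whose Weierstrass function
  uniformises the curve by \<open>z \<mapsto> (\<wp>(z), \<wp>'(z))\<close>, under which \<open>dx/y\<close> pulls back to \<open>dz\<close>.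
\<close>
definition is_period_lattice :: "complex \<Rightarrow> complex \<Rightarrow> complex set \<Rightarrow> bool" where
  "is_period_lattice g2 g3 \<Lambda> \<longleftrightarrow> is_lattice \<Lambda> \<and>
     (\<forall>z. z \<notin> \<Lambda> \<longrightarrow> (weierstrass_p \<Lambda> z, deriv (weierstrass_p \<Lambda>) z) \<in> affine_curve g2 g3)"

section \<open>Modular functions\<close>

text \<open>With \<open>q = exp (2\<pi>i\<tau>)\<close>, the fractional power \<open>q\<^bsup>1/24\<^esup>\<close> means \<open>exp (2\<pi>i\<tau>/24)\<close>.\<close>
definition dedekind_eta :: "complex \<Rightarrow> complex" where
  "dedekind_eta \<tau> = exp (2 * of_real pi * \<i> * \<tau> / 24) *
     (\<Prod>n. 1 - exp (2 * of_real pi * \<i> * \<tau>) ^ Suc n)"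

definition theta2 :: "complex \<Rightarrow> complex" where
  "theta2 \<tau> = (\<Sum>\<^sub>\<infinity>n\<in>(UNIV :: int set). exp (of_real pi * \<i> * (of_int n + 1 / 2) ^ 2 * \<tau>))"

definition theta3 :: "complex \<Rightarrow> complex" where
  "theta3 \<tau> = (\<Sum>\<^sub>\<infinity>n\<in>(UNIV :: int set). exp (of_real pi * \<i> * of_int n ^ 2 * \<tau>))"

definition modular_lambda :: "complex \<Rightarrow> complex" where
  "modular_lambda \<tau> = theta2 \<tau> ^ 4 / theta3 \<tau> ^ 4"

text \<open>
  The standard fundamental domain of \<open>\<Gamma>(2)\<close>, taken closed. Its cusps are \<open>\<infinity>\<close>, \<open>0\<close> and \<open>\<plusminus>1\<close>,
  where \<open>\<lambda>\<close> tends to \<open>0\<close>, \<open>1\<close> and \<open>\<infinity>\<close>, so \<open>\<bar>1 - \<lambda>\<bar> < 1\<close> selects the part around \<open>0\<close>.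
\<close>
definition Gamma2_domain :: "complex set" where
  "Gamma2_domain =
     {\<tau> \<in> upper_half_plane. \<bar>Re \<tau>\<bar> \<le> 1 \<and> norm (2 * \<tau> - 1) \<ge> 1 \<and> norm (2 * \<tau> + 1) \<ge> 1}"

text \<open>
  The holomorphic branch of \<open>(\<lambda>(1-\<lambda>))\<^bsup>1/6\<^esup>\<close> that is positive on the imaginary axis, where
  \<open>0 < \<lambda> < 1\<close>; equivalently, the one with leading term \<open>16\<^bsup>1/6\<^esup> q\<^bsup>1/12\<^esup>\<close>. It is unique on the
  upper half-plane, and in the interior of the fundamental domain it is the principal value.
  A fixed principal value would jump on the boundary, where \<open>\<lambda>(1-\<lambda>) < 0\<close>.
\<close>
definition is_lambda_root6 :: "(complex \<Rightarrow> complex) \<Rightarrow> bool" where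
  "is_lambda_root6 L \<longleftrightarrow> L holomorphic_on upper_half_plane \<and>
     (\<forall>\<tau>\<in>upper_half_plane. L \<tau> ^ 6 = modular_lambda \<tau> * (1 - modular_lambda \<tau>)) \<and>
     (\<forall>t::real. t > 0 \<longrightarrow> (\<exists>r::real. r > 0 \<and> L (\<i> * of_real t) = of_real r))"

text \<open>
  \<open>D\<close> is the value of \<open>\<Delta>(E)\<^bsup>1/12\<^esup>\<close> compatible with \<open>\<Delta>(\<tau>) = \<omega>1\<^bsup>12\<^esup> \<Delta>(E)\<close> when the twelfth root of
  \<open>\<Delta>(\<tau>) = (2\<pi>)\<^bsup>12\<^esup> \<eta>(\<tau>)\<^bsup>24\<^esup>\<close> is \<open>2\<pi> \<eta>(\<tau>)\<^sup>2\<close>.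
\<close>
definition is_disc_root12 ::
    "complex \<Rightarrow> complex \<Rightarrow> complex \<Rightarrow> complex \<Rightarrow> complex \<Rightarrow> bool" where
  "is_disc_root12 g2 g3 \<omega>1 \<tau> D \<longleftrightarrow>
     D ^ 12 = curve_disc g2 g3 \<and> \<omega>1 * D = 2 * of_real pi * dedekind_eta \<tau> ^ 2"

section \<open>The Gauss hypergeometric function\<close>

text \<open>The power series at \<open>0\<close>; only its values in the unit disc are meaningful.\<close>
definition hyp2F1 :: "complex \<Rightarrow> complex \<Rightarrow> complex \<Rightarrow> complex \<Rightarrow> complex" where
  "hyp2F1 a b c z = eval_fps (fps_hypergeo [a, b] [c] 1) z"

end

theory Submission
  imports Defs "HOL-Complex_Analysis.Complex_Analysis"
begin

text \<open>
  With \<open>L = 2^(2/3) \<eta>^2 / \<theta>3^2\<close> and \<open>D = 2\<pi> \<eta>^2 / \<omega>1\<close> the formula reduces to \<open>\<theta>3(\<sigma>)^2 = F(\<lambda>(\<sigma>))\<close> at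
  \<open>\<sigma> = -1/\<tau>\<close>, where \<open>F = 2F1(1/2, 1/2; 1; \<cdot>)\<close>, and \<open>D^12 = \<Delta>(E)\<close> to the product formula for the
  discriminant. Liouville's theorem identifies \<open>\<wp>\<close>, up to a constant, with a quotient of
  \<open>q\<close>-products; with the Jacobi triple product, the differences of its values at the half periods
  are \<open>\<pi>^2 \<theta>2^4\<close>, \<open>\<pi>^2 \<theta>3^4\<close> and \<open>\<pi>^2 \<theta>4^4\<close>. This gives the discriminant and, by rescaling the
  lattice, the behaviour of the theta constants under \<open>\<tau> \<mapsto> -1/\<tau>\<close>. Near \<open>\<i>\<infinity>\<close> the identity
  \<open>\<theta>3^2 = F(\<lambda>)\<close> follows by iterating Landen's transformation along \<open>\<sigma>, 2\<sigma>, 4\<sigma>, \<dots>\<close>; it extends to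
  all points of the fundamental domain with \<open>\<bar>\<lambda>\<bar> < 1\<close> by the minimum modulus principle for \<open>\<lambda>\<close>.
\<close>

text \<open>No branch has to be chosen: eta^2 occurs in both \<open>L\<close> and \<open>D\<close>
  and cancels, and theta_2 theta_3 theta_4 = 2 eta^3 turns lambda (1 - lambda) into 16 (eta /
  theta_3)^12, whose sixth root is visibly single-valued. Passing from tau to -1/tau moves the cusp
  0, where 1 - lambda is small, to the cusp at infinity, where the nome and lambda itself are small.
  The obstacle is the range of validity: the hypergeometric series means something only in the unit
  disc, and it is not clear beforehand that the part of the fundamental domain with |lambda| < 1 is
  connected, so the identity cannot simply be continued from a neighbourhood of infinity. What
  excludes a component on which it fails is that lambda has no zero: |lambda| could not attain a
  minimum there.\<close>

subsection \<open>Infinite q-products\<close>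

definition qpoch :: "complex \<Rightarrow> complex \<Rightarrow> complex" where
  "qpoch a q = (\<Prod>n. 1 - a * q ^ n)"

lemma convergent_prod_qpoch:
  fixes a q :: complex
  assumes "norm q < 1"
  shows "convergent_prod (\<lambda>n. 1 - a * q ^ n)"
proof -
  have "summable (\<lambda>n. norm ((1 - a * q ^ n) - 1))"
    using assms by (auto simp: norm_mult norm_power intro!: summable_mult summable_geometric)
  then show ?thesis
    using abs_convergent_prod_conv_summable abs_convergent_prod_imp_convergent_prod by blast
qed

lemma qpoch_LIMSEQ:
  assumes "norm q < 1"
  shows "(\<lambda>n. \<Prod>k<n. 1 - a * q ^ k) \<longlonglongrightarrow> qpoch a q"
  unfolding qpoch_def
  using convergent_prod_LIMSEQ[OF convergent_prod_qpoch[OF assms, of a]]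
  by (simp add: LIMSEQ_lessThan_iff_atMost)

lemma qpoch_nonzero:
  assumes "norm q < 1" "\<And>n. a * q ^ n \<noteq> 1"
  shows "qpoch a q \<noteq> 0"
  unfolding qpoch_def using assms
  by (intro prodinf_nonzero convergent_prod_qpoch) auto

lemma qpoch_nonzero':
  assumes "norm q < 1" "norm a < 1"
  shows "qpoch a q \<noteq> 0"
proof (rule qpoch_nonzero)
  fix n
  have "norm (a * q ^ n) \<le> norm a * 1"
    unfolding norm_mult norm_power
    using assms by (intro mult_left_mono power_le_one) auto
  then show "a * q ^ n \<noteq> 1"
    using assms by auto
qed (use assms in auto)

lemma qpoch_rec:
  assumes "norm q < 1"
  shows "qpoch a q = (1 - a) * qpoch (a * q) q"
proof (rule LIMSEQ_unique)
  show "(\<lambda>n. \<Prod>k<Suc n. 1 - a * q ^ k) \<longlonglongrightarrow> qpoch a q"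
    using qpoch_LIMSEQ[OF assms] by (rule LIMSEQ_Suc)
  have "(\<Prod>k<Suc n. 1 - a * q ^ k) = (1 - a) * (\<Prod>k<n. 1 - (a * q) * q ^ k)" for n
    by (subst prod.lessThan_Suc_shift) (simp add: mult_ac)
  then show "(\<lambda>n. \<Prod>k<Suc n. 1 - a * q ^ k) \<longlonglongrightarrow> (1 - a) * qpoch (a * q) q"
    using tendsto_mult_left[OF qpoch_LIMSEQ[OF assms, of "a * q"]] by simp
qed

lemma norm_square_less_1:
  fixes q :: complex
  assumes "norm q < 1"
  shows "norm (q ^ 2) < 1"
  using assms by (simp add: norm_power power_less_one_iff)

lemma qpoch_even_odd:
  assumes "norm q < 1"
  shows "qpoch a q = qpoch a (q ^ 2) * qpoch (a * q) (q ^ 2)"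
proof (rule LIMSEQ_unique)
  have "strict_mono (\<lambda>n::nat. 2 * n)"
    by (auto simp: strict_mono_def)
  from LIMSEQ_subseq_LIMSEQ[OF qpoch_LIMSEQ[OF assms] this]
  show "(\<lambda>n. \<Prod>k<2*n. 1 - a * q ^ k) \<longlonglongrightarrow> qpoch a q"
    by (simp add: o_def)
  have "(\<Prod>k<2*n. 1 - a * q ^ k) =
        (\<Prod>k<n. 1 - a * (q ^ 2) ^ k) * (\<Prod>k<n. 1 - (a * q) * (q ^ 2) ^ k)" for n
    by (induction n) (auto simp: power_mult[symmetric] mult_ac)
  then show "(\<lambda>n. \<Prod>k<2*n. 1 - a * q ^ k) \<longlonglongrightarrow> qpoch a (q ^ 2) * qpoch (a * q) (q ^ 2)"
    using tendsto_mult[OF qpoch_LIMSEQ[of "q^2" a] qpoch_LIMSEQ[of "q^2" "a*q"]]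
      norm_square_less_1[OF assms] by simp
qed

lemma qpoch_plus_minus:
  assumes "norm q < 1"
  shows "qpoch a q * qpoch (-a) q = qpoch (a ^ 2) (q ^ 2)"
proof (rule LIMSEQ_unique)
  show "(\<lambda>n. \<Prod>k<n. 1 - a ^ 2 * (q ^ 2) ^ k) \<longlonglongrightarrow> qpoch (a ^ 2) (q ^ 2)"
    using norm_square_less_1[OF assms] by (rule qpoch_LIMSEQ)
  have "(\<Prod>k<n. 1 - a * q ^ k) * (\<Prod>k<n. 1 - (-a) * q ^ k) = (\<Prod>k<n. 1 - a ^ 2 * (q ^ 2) ^ k)" for n
    by (simp add: prod.distrib[symmetric] algebra_simps power2_eq_square power_mult_distrib)
  then show "(\<lambda>n. \<Prod>k<n. 1 - a ^ 2 * (q ^ 2) ^ k) \<longlonglongrightarrow> qpoch a q * qpoch (-a) q"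
    using tendsto_mult[OF qpoch_LIMSEQ[OF assms, of a] qpoch_LIMSEQ[OF assms, of "-a"]] by simp
qed

text \<open>Euler's identity between partitions into distinct parts and into odd parts, with the
  product over 1 + q^n split by the parity of n. It follows on cancelling (q; q) from (q; q) (-q; q)
  = (q^2; q^2), because (q; q) = (q; q^2) (q^2; q^2).\<close>

lemma qpoch_euler:
  assumes "norm q < 1"
  shows "qpoch (-(q ^ 2)) (q ^ 2) * qpoch q (q ^ 2) * qpoch (-q) (q ^ 2) = 1"
proof -
  have "qpoch q q * (qpoch (-q) q * qpoch q (q ^ 2)) = qpoch q q"
    using qpoch_plus_minus[OF assms, of q] qpoch_even_odd[OF assms, of q]
    by (simp add: power2_eq_square mult_ac)
  moreover have "qpoch q q \<noteq> 0"
    using qpoch_nonzero'[OF assms assms] .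
  ultimately have "qpoch (-q) q * qpoch q (q ^ 2) = 1"
    by simp
  then show ?thesis
    using qpoch_even_odd[OF assms, of "-q"] by (simp add: power2_eq_square mult_ac)
qed

lemma holomorphic_on_qpoch [holomorphic_intros]:
  assumes A: "open A" and f: "f holomorphic_on A" and g: "g holomorphic_on A"
    and g1: "\<And>z. z \<in> A \<Longrightarrow> norm (g z) < 1"
  shows "(\<lambda>z. qpoch (f z) (g z)) holomorphic_on A"
proof (rule holomorphic_uniform_sequence[OF A])
  show "(\<lambda>z. \<Prod>k<n. 1 - f z * g z ^ k) holomorphic_on A" for n
    by (intro holomorphic_intros f g)
next
  fix x assume "x \<in> A"
  then obtain d where d: "d > 0" "cball x d \<subseteq> A"
    using A open_contains_cball by blast
  let ?K = "cball x d"
  have cf: "continuous_on ?K f" and cg: "continuous_on ?K g"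
    using f g d by (auto intro: continuous_on_subset holomorphic_on_imp_continuous_on)
  obtain M where M: "\<And>z. z \<in> ?K \<Longrightarrow> norm (f z) \<le> M"
    using compact_imp_bounded[OF compact_continuous_image[OF cf compact_cball]]
    unfolding bounded_iff by blast
  have "?K \<noteq> {}"
    using d by auto
  \<comment> \<open>The pointwise bound |g| < 1 alone gives no uniform convergence; on the compact
    ball the maximum of |g| is attained and hence below 1.\<close>
  from continuous_attains_sup[OF compact_cball this continuous_on_norm[OF cg]]
  obtain z0 where z0: "z0 \<in> ?K" "\<And>z. z \<in> ?K \<Longrightarrow> norm (g z) \<le> norm (g z0)"
    by auto
  define r where "r = norm (g z0)"
  have r: "r < 1" "r \<ge> 0"
    using g1[of z0] d z0(1) unfolding r_def by auto
  have "uniformly_convergent_on ?K (\<lambda>N z. \<Prod>n<N. 1 - f z * g z ^ n)"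
  proof (rule uniformly_convergent_on_prod')
    show "continuous_on ?K (\<lambda>z. 1 - f z * g z ^ n)" for n
      by (intro continuous_intros cf cg)
    show "uniformly_convergent_on ?K (\<lambda>N z. \<Sum>n<N. norm (1 - f z * g z ^ n - 1))"
    proof (rule Weierstrass_m_test')
      show "summable (\<lambda>n. M * r ^ n)"
        using r by (intro summable_mult summable_geometric) auto
      fix n z assume z: "z \<in> ?K"
      show "norm (norm (1 - f z * g z ^ n - 1)) \<le> M * r ^ n"
        using M[OF z] z0(2)[OF z] r(2) unfolding r_def[symmetric]
        by (auto simp: norm_mult norm_power intro!: mult_mono power_mono order_trans[OF norm_ge_zero M[OF z]])
    qed
  qed auto
  then obtain l where l: "uniform_limit ?K (\<lambda>N z. \<Prod>n<N. 1 - f z * g z ^ n) l sequentially"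
    by (auto simp: uniformly_convergent_on_def)
  have "l z = qpoch (f z) (g z)" if z: "z \<in> ?K" for z
  proof (rule LIMSEQ_unique)
    show "(\<lambda>N. \<Prod>n<N. 1 - f z * g z ^ n) \<longlonglongrightarrow> l z"
      using tendsto_uniform_limitI[OF l z] .
    show "(\<lambda>N. \<Prod>n<N. 1 - f z * g z ^ n) \<longlonglongrightarrow> qpoch (f z) (g z)"
      using g1 d z by (intro qpoch_LIMSEQ) auto
  qed
  then have "uniform_limit ?K (\<lambda>N z. \<Prod>n<N. 1 - f z * g z ^ n) (\<lambda>z. qpoch (f z) (g z)) sequentially"
    by (intro iffD1[OF uniform_limit_cong' l]) auto
  then show "\<exists>d>0. cball x d \<subseteq> A \<and>
        uniform_limit (cball x d) (\<lambda>N z. \<Prod>n<N. 1 - f z * g z ^ n) (\<lambda>z. qpoch (f z) (g z)) sequentially"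
    using d by blast
qed

lemma qpoch_0_left [simp]: "qpoch 0 q = 1"
  by (simp add: qpoch_def)

lemma qpoch_real_pos:
  assumes "0 \<le> q" "q < 1" "a < 1"
  shows "\<exists>r>0. qpoch (of_real a) (of_real q) = of_real r"
proof -
  have conv: "convergent_prod (\<lambda>n. 1 - a * q ^ n)"
  proof -
    have "summable (\<lambda>n. norm ((1 - a * q ^ n) - 1))"
      using assms by (auto simp: norm_mult norm_power abs_mult intro!: summable_mult summable_geometric)
    then show ?thesis
      using abs_convergent_prod_conv_summable abs_convergent_prod_imp_convergent_prod by blast
  qed
  have "1 - a * q ^ n > 0" for n
  proof (cases "a \<le> 0")
    case True
    then have "a * q ^ n \<le> 0"
      using assms by (intro mult_nonpos_nonneg) auto
    then show ?thesis by linarith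
  next
    case False
    then have "a * q ^ n \<le> a * 1"
      using assms by (intro mult_left_mono power_le_one) auto
    then show ?thesis using assms by linarith
  qed
  then have "prodinf (\<lambda>n. 1 - a * q ^ n) > 0"
    using conv by (intro less_0_prodinf) auto
  moreover have "(\<lambda>n. of_real (\<Prod>k<n. 1 - a * q ^ k)) \<longlonglongrightarrow> (of_real (prodinf (\<lambda>n. 1 - a * q ^ n)) :: complex)"
    using convergent_prod_LIMSEQ[OF conv]
    by (intro tendsto_of_real) (simp add: LIMSEQ_lessThan_iff_atMost)
  then have "qpoch (of_real a) (of_real q) = of_real (prodinf (\<lambda>n. 1 - a * q ^ n))"
    using qpoch_LIMSEQ[of "of_real q" "of_real a"] assms by (intro LIMSEQ_unique[OF qpoch_LIMSEQ]) auto
  ultimately show ?thesis by blast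
qed

subsection \<open>Summation over the integers\<close>

text \<open>Dominated convergence for sums (Tannery's theorem): the bound makes the finite partial
  sums converge uniformly in \<open>n\<close>, so the two limits may be exchanged. It carries the
  finite triple product to the infinite one.\<close>

lemma tannery_infsum:
  fixes f :: "nat \<Rightarrow> 'a \<Rightarrow> 'b :: banach"
  assumes bound: "\<And>n x. x \<in> X \<Longrightarrow> norm (f n x) \<le> M x"
    and summable: "M summable_on X"
    and lim: "\<And>x. x \<in> X \<Longrightarrow> (\<lambda>n. f n x) \<longlonglongrightarrow> g x"
  shows "g summable_on X" "(\<lambda>n. infsum (f n) X) \<longlonglongrightarrow> infsum g X"
proof -
  have "norm (g x) \<le> M x" if "x \<in> X" for x
    using bound[OF that] by (intro Lim_bounded[OF tendsto_norm[OF lim[OF that]]]) auto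
  then show g: "g summable_on X"
    by (intro abs_summable_summable[OF summable_on_comparison_test[OF summable]]) auto
  have unif: "uniform_limit UNIV (\<lambda>A n. \<Sum>x\<in>A. f n x) (\<lambda>n. infsum (f n) X) (finite_subsets_at_top X)"
    using bound summable by (intro Weierstrass_m_test_general) auto
  show "(\<lambda>n. infsum (f n) X) \<longlonglongrightarrow> infsum g X"
  proof (rule swap_uniform_limit'[OF _ _ unif])
    show "\<forall>\<^sub>F A in finite_subsets_at_top X. (\<lambda>n. \<Sum>x\<in>A. f n x) \<longlonglongrightarrow> (\<Sum>x\<in>A. g x)"
      by (rule eventually_finite_subsets_at_top_weakI) (intro tendsto_sum lim, auto)
    show "(sum g \<longlongrightarrow> infsum g X) (finite_subsets_at_top X)"
      using has_sum_infsum[OF g] by (simp add: has_sum_def)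
  qed auto
qed

lemma summable_on_int_abs:
  fixes h :: "nat \<Rightarrow> real"
  assumes "\<And>n. h n \<ge> 0" "summable h"
  shows "(\<lambda>j::int. h (nat \<bar>j\<bar>)) summable_on UNIV"
proof -
  have h: "h summable_on UNIV"
    using assms by (intro summable_on_UNIV_nonneg_real_iff[THEN iffD2]) auto
  have "(\<lambda>j::int. h (nat \<bar>j\<bar>)) summable_on (range int)"
    using h by (subst summable_on_reindex) (auto simp: o_def)
  moreover have "(\<lambda>j::int. h (nat \<bar>j\<bar>)) summable_on (range (\<lambda>n. - int n))"
    using h by (subst summable_on_reindex) (auto simp: o_def inj_def)
  ultimately have "(\<lambda>j::int. h (nat \<bar>j\<bar>)) summable_on (range int \<union> range (\<lambda>n. - int n))"
    by (rule summable_on_union)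
  also have "range int \<union> range (\<lambda>n. - int n) = UNIV"
  proof -
    have "x \<in> range int \<union> range (\<lambda>n. - int n)" for x
      by (cases x rule: int_cases2) auto
    then show ?thesis by blast
  qed
  finally show ?thesis .
qed

lemma summable_gaussian:
  fixes r s :: real
  assumes "0 \<le> r" "r < 1" "s \<ge> 0"
  shows "summable (\<lambda>n. r ^ (n ^ 2) * s ^ n)"
proof (rule summable_comparison_test_ev)
  \<comment> \<open>The term is (r^n s)^n, and its base drops below 1/2: the Gaussian factor beats
    every exponential.\<close>
  have "(\<lambda>n. r ^ n * s) \<longlonglongrightarrow> 0 * s"
    using assms by (intro tendsto_mult LIMSEQ_power_zero) auto
  then have "\<forall>\<^sub>F n in sequentially. r ^ n * s < 1 / 2"
    by (rule order_tendstoD(2)) auto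
  then show "\<forall>\<^sub>F n in sequentially. norm (r ^ (n ^ 2) * s ^ n) \<le> (1 / 2) ^ n"
  proof eventually_elim
    case (elim n)
    have "norm (r ^ (n ^ 2) * s ^ n) = (r ^ n * s) ^ n"
      using assms by (simp add: power2_eq_square power_mult power_mult_distrib)
    also have "\<dots> \<le> (1 / 2) ^ n"
      using elim assms by (intro power_mono) auto
    finally show ?case .
  qed
qed (auto intro: summable_geometric)

lemma abs_summable_theta:
  fixes q w :: complex
  assumes "norm q < 1" "w \<noteq> 0"
  shows "(\<lambda>j::int. norm (q powi (j ^ 2) * w powi j)) summable_on UNIV"
proof -
  \<comment> \<open>\<open>s\<close> dominates both |w| and 1/|w|, so one majorant serves positive
    and negative exponents.\<close>
  define s where "s = max (norm w) (inverse (norm w))"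
  have s: "s \<ge> 0"
    by (auto simp: s_def max_def)
  have "(\<lambda>j::int. norm q ^ ((nat \<bar>j\<bar>) ^ 2) * s ^ (nat \<bar>j\<bar>)) summable_on UNIV"
    using assms s by (intro summable_on_int_abs summable_gaussian) auto
  moreover have "norm (q powi (j ^ 2) * w powi j) \<le> norm q ^ ((nat \<bar>j\<bar>) ^ 2) * s ^ (nat \<bar>j\<bar>)" for j :: int
  proof -
    have "norm (q powi (j ^ 2)) = norm q ^ ((nat \<bar>j\<bar>) ^ 2)"
      by (simp add: norm_power power_int_def nat_power_eq[symmetric])
    moreover have "norm (w powi j) \<le> s ^ (nat \<bar>j\<bar>)"
      unfolding norm_power_int power_int_def s_def
      by (auto intro!: power_mono simp: norm_power norm_inverse simp flip: power_inverse)
    ultimately show ?thesis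
      by (simp add: norm_mult mult_left_mono)
  qed
  ultimately show ?thesis
    by (rule summable_on_comparison_test) auto
qed

subsection \<open>The Jacobi triple product\<close>

definition qfact :: "complex \<Rightarrow> nat \<Rightarrow> complex" where
  "qfact Q n = (\<Prod>k<n. 1 - Q * Q ^ k)"

text \<open>The Gaussian binomial coefficients. The quotient form makes their limits visible; the
  value 0 beyond the range lets sums be shifted by one index without boundary cases.\<close>

definition qbinomial :: "complex \<Rightarrow> nat \<Rightarrow> nat \<Rightarrow> complex" where
  "qbinomial Q N k = (if k \<le> N then qfact Q N / (qfact Q k * qfact Q (N - k)) else 0)"

lemma qfact_Suc: "qfact Q (Suc n) = qfact Q n * (1 - Q ^ Suc n)"
  by (simp add: qfact_def)

lemma qfact_nonzero:
  assumes "norm Q < 1"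
  shows "qfact Q n \<noteq> 0"
proof -
  have "Q ^ Suc k \<noteq> 1" for k
    using assms by (metis norm_one norm_power power_Suc_less_one norm_ge_zero
      less_irrefl power_0_Suc zero_neq_one le_less norm_zero norm_eq_zero)
  then show ?thesis
    by (auto simp: qfact_def)
qed

lemma qbinomial_0 [simp]: "norm Q < 1 \<Longrightarrow> qbinomial Q N 0 = 1"
  using qfact_nonzero[of Q N] by (simp add: qbinomial_def qfact_def)

lemma qbinomial_diag [simp]: "norm Q < 1 \<Longrightarrow> qbinomial Q N N = 1"
  using qfact_nonzero[of Q N] by (simp add: qbinomial_def qfact_def)

lemma qbinomial_eq_0 [simp]: "k > N \<Longrightarrow> qbinomial Q N k = 0"
  by (simp add: qbinomial_def)

text \<open>The two q-analogues of Pascal's rule. With A = 1 - Q^(k+1) and B = 1 - Q^(N-k) the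
  factor 1 - Q^(N+1) is A + (1 - A) B = (1 - B) A + B, and the two ways of writing it give the two
  rules.\<close>

lemma qbinomial_Suc_Suc:
  assumes "norm Q < 1"
  shows "qbinomial Q (Suc N) (Suc k) = qbinomial Q N k + Q ^ Suc k * qbinomial Q N (Suc k)"
    and "k \<le> N \<Longrightarrow> qbinomial Q (Suc N) (Suc k) = Q ^ (N - k) * qbinomial Q N k + qbinomial Q N (Suc k)"
proof -
  have nz: "qfact Q n \<noteq> 0" for n
    using qfact_nonzero[OF assms] .
  have nz': "1 - Q ^ Suc n \<noteq> 0" for n
    using nz[of "Suc n"] by (auto simp: qfact_Suc)
  have *: "qbinomial Q (Suc N) (Suc k) = qbinomial Q N k + Q ^ Suc k * qbinomial Q N (Suc k) \<and>
        qbinomial Q (Suc N) (Suc k) = Q ^ (N - k) * qbinomial Q N k + qbinomial Q N (Suc k)" if kN: "k < N"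
  proof -
    obtain d where d: "N = Suc (k + d)"
      using less_imp_Suc_add[OF kN] by auto
    have Nk: "N - k = Suc d" "N - Suc k = d"
      using d by auto
    define A B where "A = 1 - Q ^ Suc k" and "B = 1 - Q ^ Suc d"
    have QA: "Q ^ Suc k = 1 - A" and QB: "Q ^ Suc d = 1 - B"
      by (simp_all add: A_def B_def)
    have e: "1 - Q ^ Suc N = A + (1 - A) * B"
      unfolding QA[symmetric] QB[symmetric] by (simp add: A_def B_def d algebra_simps power_add)
    have AB: "A \<noteq> 0" "B \<noteq> 0"
      using nz' unfolding A_def B_def by auto
    define F where "F = qfact Q N"
    have L: "qbinomial Q (Suc N) (Suc k) = F * (1 - Q ^ Suc N) / (qfact Q k * A * (qfact Q d * B))"
      using kN unfolding qbinomial_def A_def B_def F_def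
      by (simp only: diff_Suc_Suc Nk qfact_Suc) simp
    have R1: "qbinomial Q N k = F / (qfact Q k * (qfact Q d * B))"
      using kN unfolding qbinomial_def B_def F_def
      by (simp only: Nk qfact_Suc) simp
    have R2: "qbinomial Q N (Suc k) = F / (qfact Q k * A * qfact Q d)"
      using kN unfolding qbinomial_def A_def F_def
      by (simp only: Nk qfact_Suc) simp
    show ?thesis
    proof
      show "qbinomial Q (Suc N) (Suc k) = qbinomial Q N k + Q ^ Suc k * qbinomial Q N (Suc k)"
        unfolding L R1 R2 e QA
        using AB nz[of k] nz[of d] by (simp add: divide_simps) (simp add: algebra_simps)
      show "qbinomial Q (Suc N) (Suc k) = Q ^ (N - k) * qbinomial Q N k + qbinomial Q N (Suc k)"
        unfolding L R1 R2 e Nk(1) QB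
        using AB nz[of k] nz[of d] by (simp add: divide_simps) (simp add: algebra_simps)
    qed
  qed
  show "qbinomial Q (Suc N) (Suc k) = qbinomial Q N k + Q ^ Suc k * qbinomial Q N (Suc k)"
    using * assms by (cases k N rule: linorder_cases) auto
  show "qbinomial Q (Suc N) (Suc k) = Q ^ (N - k) * qbinomial Q N k + qbinomial Q N (Suc k)" if "k \<le> N"
    using * that assms by (cases "k = N") auto
qed

text \<open>The finite form of the triple product. The factors w + q^(2k+1) are added first and the
  factors 1 + q^(2k+1) w afterwards, each kind by one of the two Pascal rules. Writing w + q^(2k+1)
  instead of 1 + q^(2k+1) / w keeps negative powers of w away.\<close>

lemma finite_triple_product:
  fixes q w :: complex
  assumes q: "norm q < 1" "q \<noteq> 0"
  shows "(\<Prod>k<m. 1 + q ^ (2*k+1) * w) * (\<Prod>k<n. w + q ^ (2*k+1)) =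
         (\<Sum>i\<le>m+n. qbinomial (q ^ 2) (m + n) i * q powi ((int i - int n) ^ 2) * w ^ i)"
proof -
  have Q: "norm (q ^ 2) < 1"
    using norm_square_less_1 q by blast
  let ?b = "qbinomial (q ^ 2)"
  define T where "T N n = (\<Sum>i\<le>N. ?b N i * q powi ((int i - int n) ^ 2) * w ^ i)" for N n
  have powi_mult: "q powi a * q powi b = q powi (a + b)" for a b :: int
    using q by (simp add: power_int_add)
  have pow: "(q ^ 2) ^ k = q powi (2 * int k)" for k
    by (simp add: power_int_def power_mult[symmetric] nat_mult_distrib)
  have pow1: "q ^ (2*k+1) = q powi (2 * int k + 1)" for k
    by (metis int_ops(2) of_nat_add of_nat_mult of_nat_numeral power_int_of_nat)
  have stepn: "T N n * (w + q ^ (2*n+1)) = T (Suc N) (Suc n)" if "n = N" for N n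
  proof -
    have "T (Suc N) (Suc n) = q powi ((0 - int (Suc n)) ^ 2) +
        (\<Sum>i\<le>N. ?b (Suc N) (Suc i) * q powi ((int (Suc i) - int (Suc n)) ^ 2) * w ^ Suc i)"
      unfolding T_def using Q by (subst sum.atMost_Suc_shift) simp
    also have "(\<Sum>i\<le>N. ?b (Suc N) (Suc i) * q powi ((int (Suc i) - int (Suc n)) ^ 2) * w ^ Suc i) =
        (\<Sum>i\<le>N. ?b N i * q powi ((int i - int n) ^ 2) * w ^ i * w) +
        (\<Sum>i\<le>N. ?b N (Suc i) * q powi ((int (Suc i) - int n) ^ 2) * w ^ Suc i * q ^ (2*n+1))"
      unfolding sum.distrib[symmetric]
    proof (rule sum.cong)
      fix i
      have "q powi ((int i - int n) ^ 2) * (q ^ 2) ^ Suc i = q powi ((int (Suc i) - int n) ^ 2) * q ^ (2*n+1)"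
        unfolding pow pow1 powi_mult
        by (intro arg_cong2[where f = power_int]) (auto simp: algebra_simps power2_eq_square)
      then show "?b (Suc N) (Suc i) * q powi ((int (Suc i) - int (Suc n)) ^ 2) * w ^ Suc i =
          ?b N i * q powi ((int i - int n) ^ 2) * w ^ i * w +
          ?b N (Suc i) * q powi ((int (Suc i) - int n) ^ 2) * w ^ Suc i * q ^ (2*n+1)"
        unfolding qbinomial_Suc_Suc(1)[OF Q] by (simp add: ring_distribs mult_ac)
    qed auto
    also have "q powi ((0 - int (Suc n)) ^ 2) +
        ((\<Sum>i\<le>N. ?b N i * q powi ((int i - int n) ^ 2) * w ^ i * w) +
        (\<Sum>i\<le>N. ?b N (Suc i) * q powi ((int (Suc i) - int n) ^ 2) * w ^ Suc i * q ^ (2*n+1))) =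
        T N n * w + (q powi ((0 - int n) ^ 2) * q ^ (2*n+1) +
        (\<Sum>i\<le>N. ?b N (Suc i) * q powi ((int (Suc i) - int n) ^ 2) * w ^ Suc i * q ^ (2*n+1)))"
    proof -
      have "q powi ((0 - int (Suc n)) ^ 2) = q powi ((0 - int n) ^ 2) * q ^ (2*n+1)"
        unfolding pow1 powi_mult
        by (intro arg_cong2[where f = power_int]) (auto simp: algebra_simps power2_eq_square)
      then show ?thesis
        by (simp add: T_def sum_distrib_right)
    qed
    also have "\<dots> = T N n * w + (\<Sum>i\<le>Suc N. ?b N i * q powi ((int i - int n) ^ 2) * w ^ i * q ^ (2*n+1))"
      using Q by (subst sum.atMost_Suc_shift) simp
    also have "\<dots> = T N n * w + T N n * q ^ (2*n+1)"
      by (simp add: T_def sum_distrib_right)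
    finally show ?thesis
      by (simp add: algebra_simps)
  qed
  have stepm: "T (m + n) n * (1 + q ^ (2*m+1) * w) = T (Suc (m + n)) n" for m n
  proof -
    let ?N = "m + n"
    have "T (Suc ?N) n = q powi ((0 - int n) ^ 2) +
        (\<Sum>i\<le>?N. ?b (Suc ?N) (Suc i) * q powi ((int (Suc i) - int n) ^ 2) * w ^ Suc i)"
      unfolding T_def using Q by (subst sum.atMost_Suc_shift) simp
    also have "(\<Sum>i\<le>?N. ?b (Suc ?N) (Suc i) * q powi ((int (Suc i) - int n) ^ 2) * w ^ Suc i) =
        (\<Sum>i\<le>?N. ?b ?N i * q powi ((int i - int n) ^ 2) * w ^ i * (q ^ (2*m+1) * w)) +
        (\<Sum>i\<le>?N. ?b ?N (Suc i) * q powi ((int (Suc i) - int n) ^ 2) * w ^ Suc i)"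
      unfolding sum.distrib[symmetric]
    proof (rule sum.cong)
      fix i assume "i \<in> {..?N}"
      then have i: "i \<le> ?N" by simp
      have "(q ^ 2) ^ (?N - i) * q powi ((int (Suc i) - int n) ^ 2) = q powi ((int i - int n) ^ 2) * q ^ (2*m+1)"
        unfolding pow pow1 powi_mult using i
        by (intro arg_cong2[where f = power_int]) (auto simp: algebra_simps power2_eq_square of_nat_diff)
      then show "?b (Suc ?N) (Suc i) * q powi ((int (Suc i) - int n) ^ 2) * w ^ Suc i =
          ?b ?N i * q powi ((int i - int n) ^ 2) * w ^ i * (q ^ (2*m+1) * w) +
          ?b ?N (Suc i) * q powi ((int (Suc i) - int n) ^ 2) * w ^ Suc i"
        unfolding qbinomial_Suc_Suc(2)[OF Q i] by (simp add: ring_distribs mult_ac)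
    qed auto
    also have "q powi ((0 - int n) ^ 2) +
        ((\<Sum>i\<le>?N. ?b ?N i * q powi ((int i - int n) ^ 2) * w ^ i * (q ^ (2*m+1) * w)) +
        (\<Sum>i\<le>?N. ?b ?N (Suc i) * q powi ((int (Suc i) - int n) ^ 2) * w ^ Suc i)) =
        T ?N n * (q ^ (2*m+1) * w) + (q powi ((0 - int n) ^ 2) +
        (\<Sum>i\<le>?N. ?b ?N (Suc i) * q powi ((int (Suc i) - int n) ^ 2) * w ^ Suc i))"
      by (simp add: T_def sum_distrib_right)
    also have "\<dots> = T ?N n * (q ^ (2*m+1) * w) + (\<Sum>i\<le>Suc ?N. ?b ?N i * q powi ((int i - int n) ^ 2) * w ^ i)"
      using Q by (subst sum.atMost_Suc_shift) simp
    also have "\<dots> = T ?N n * (q ^ (2*m+1) * w) + T ?N n"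
      by (simp add: T_def)
    finally show ?thesis
      by (simp add: algebra_simps)
  qed
  have n: "(\<Prod>k<n. w + q ^ (2*k+1)) = T n n" for n
  proof (induction n)
    case 0
    show ?case using Q by (simp add: T_def)
  next
    case (Suc n)
    then show ?case using stepn[of n n] by simp
  qed
  have "(\<Prod>k<m. 1 + q ^ (2*k+1) * w) * T n n = T (m + n) n"
  proof (induction m)
    case (Suc m)
    have "(\<Prod>k<Suc m. 1 + q ^ (2*k+1) * w) * T n n =
        ((\<Prod>k<m. 1 + q ^ (2*k+1) * w) * T n n) * (1 + q ^ (2*m+1) * w)"
      by (simp only: prod.lessThan_Suc mult_ac)
    then show ?case
      unfolding Suc stepm by simp
  qed simp
  then show ?thesis
    unfolding n by (simp add: T_def)
qed

text \<open>The finite identity with m = n, divided by w^n, in the limit: the Gaussian binomial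
  coefficients around the centre tend to 1 / (q^2; q^2) and stay bounded, so a multiple of the
  absolute theta series is a majorant.\<close>

theorem jacobi_triple_product:
  fixes q w :: complex
  assumes q: "norm q < 1" "q \<noteq> 0" and w: "w \<noteq> 0"
  shows "((\<lambda>j::int. q powi (j ^ 2) * w powi j) has_sum
           qpoch (q ^ 2) (q ^ 2) * qpoch (-(q * w)) (q ^ 2) * qpoch (-(q / w)) (q ^ 2)) UNIV"
proof -
  let ?Q = "q ^ 2"
  have Q: "norm ?Q < 1"
    using norm_square_less_1 q by blast
  define P where "P = qpoch ?Q ?Q"
  have P: "P \<noteq> 0"
    unfolding P_def using Q by (intro qpoch_nonzero')
  have limP: "qfact ?Q \<longlonglongrightarrow> P"
    unfolding qfact_def P_def using qpoch_LIMSEQ[OF Q] by simp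
  have limP': "(\<lambda>n. inverse (qfact ?Q n)) \<longlonglongrightarrow> inverse P"
    using limP P by (rule tendsto_inverse)
  \<comment> \<open>The limit of \<open>qfact\<close> is nonzero, so its reciprocals are bounded
    too; together this bounds the coefficients uniformly in \<open>n\<close> and
    \<open>j\<close>.\<close>
  obtain C where C: "\<And>n. norm (qfact ?Q n) \<le> C"
    using convergent_imp_Bseq[OF convergentI[OF limP]] by (auto simp: Bseq_def)
  obtain C' where C': "\<And>n. norm (inverse (qfact ?Q n)) \<le> C'"
    using convergent_imp_Bseq[OF convergentI[OF limP']] by (auto simp: Bseq_def)
  have CC: "C \<ge> 0" "C' \<ge> 0"
    using norm_ge_zero C[of 0] C'[of 0] order_trans by blast+
  \<comment> \<open>The index is recentred at \<open>n\<close>, and the coefficients are extended by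
    0, so that all finite sums run over the same set of integers.\<close>
  define c where "c n j = (if \<bar>j\<bar> \<le> int n then qbinomial ?Q (2 * n) (nat (int n + j)) else 0)" for n j
  have c_bound: "norm (c n j) \<le> C * (C' * C')" for n j
  proof (cases "\<bar>j\<bar> \<le> int n \<and> nat (int n + j) \<le> 2 * n")
    case True
    then have "norm (c n j) = norm (qfact ?Q (2*n)) * (norm (inverse (qfact ?Q (nat (int n + j)))) *
        norm (inverse (qfact ?Q (2 * n - nat (int n + j)))))"
      by (simp add: c_def qbinomial_def norm_mult norm_divide norm_inverse field_simps)
    also have "\<dots> \<le> C * (C' * C')"
      by (intro mult_mono C C') (auto simp: CC)
    finally show ?thesis .
  qed (auto simp: c_def CC)
  have c_lim: "(\<lambda>n. c n j) \<longlonglongrightarrow> inverse P" for j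
  proof -
    have l1: "filterlim (\<lambda>n. nat (int n + j)) sequentially sequentially" for j
      unfolding filterlim_at_top
    proof
      fix Z
      show "\<forall>\<^sub>F n in sequentially. Z \<le> nat (int n + j)"
        using eventually_ge_at_top[of "Z + nat \<bar>j\<bar>"] by eventually_elim auto
    qed
    have l2: "filterlim (\<lambda>n. 2 * n :: nat) sequentially sequentially"
      by (rule filterlim_at_top_mono[OF filterlim_ident]) auto
    have "(\<lambda>n. qfact ?Q (2*n) * (inverse (qfact ?Q (nat (int n + j))) * inverse (qfact ?Q (nat (int n + (-j))))))
       \<longlonglongrightarrow> P * (inverse P * inverse P)"
      by (intro tendsto_mult filterlim_compose[OF limP l2] filterlim_compose[OF limP' l1])
    moreover have "\<forall>\<^sub>F n in sequentially. qfact ?Q (2*n) * (inverse (qfact ?Q (nat (int n + j))) * inverse (qfact ?Q (nat (int n + (-j))))) = c n j"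
      using eventually_ge_at_top[of "nat \<bar>j\<bar>"]
    proof eventually_elim
      case (elim n)
      then have "nat (int n + j) \<le> 2 * n" "2 * n - nat (int n + j) = nat (int n + (-j))" "\<bar>j\<bar> \<le> int n"
        by auto
      then show ?case
        by (simp add: c_def qbinomial_def field_simps)
    qed
    ultimately have "(\<lambda>n. c n j) \<longlonglongrightarrow> P * (inverse P * inverse P)"
      by (rule Lim_transform_eventually)
    moreover have "P * (inverse P * inverse P) = inverse P"
      using P by simp
    ultimately show ?thesis
      by (simp only:)
  qed
  define t where "t j = q powi (j ^ 2) * w powi j" for j
  have t: "(\<lambda>j. norm (t j)) summable_on UNIV"
    unfolding t_def using abs_summable_theta q w by blast
  have M: "(\<lambda>j. C * (C' * C') * norm (t j)) summable_on UNIV"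
    using t by (rule summable_on_cmult_right)
  have lim: "(\<lambda>n. \<Sum>\<^sub>\<infinity>j. c n j * t j) \<longlonglongrightarrow> (\<Sum>\<^sub>\<infinity>j. inverse P * t j)"
  proof (rule tannery_infsum(2)[OF _ M])
    show "norm (c n j * t j) \<le> C * (C' * C') * norm (t j)" for n j
      unfolding norm_mult by (intro mult_right_mono c_bound) auto
    show "(\<lambda>n. c n j * t j) \<longlonglongrightarrow> inverse P * t j" for j
      by (intro tendsto_mult c_lim tendsto_const)
  qed
  have fin: "(\<Sum>\<^sub>\<infinity>j. c n j * t j) = (\<Prod>k<n. 1 - (-(q * w)) * ?Q ^ k) * (\<Prod>k<n. 1 - (-(q / w)) * ?Q ^ k)" for n
  proof -
    have "(\<Sum>\<^sub>\<infinity>j. c n j * t j) = (\<Sum>\<^sub>\<infinity>j\<in>{-int n..int n}. c n j * t j)"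
      by (rule infsum_cong_neutral) (auto simp: c_def)
    also have "\<dots> = (\<Sum>j\<in>{-int n..int n}. c n j * t j)"
      by simp
    also have "\<dots> = (\<Sum>i\<le>n+n. c n (int i - int n) * t (int i - int n))"
      by (rule sum.reindex_bij_witness[of _ "\<lambda>i. int i - int n" "\<lambda>j. nat (j + int n)"]) auto
    also have "\<dots> = (\<Sum>i\<le>n+n. qbinomial ?Q (n + n) i * q powi ((int i - int n) ^ 2) * w ^ i * (inverse w) ^ n)"
    proof (rule sum.cong)
      fix i assume "i \<in> {..n+n}"
      then have "c n (int i - int n) = qbinomial ?Q (n + n) i"
        by (auto simp: c_def mult_2)
      moreover have "w powi (int i - int n) = w ^ i * inverse w ^ n"
        using w by (simp add: power_int_diff field_simps)
      ultimately show "c n (int i - int n) * t (int i - int n) =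
        qbinomial ?Q (n + n) i * q powi ((int i - int n) ^ 2) * w ^ i * (inverse w) ^ n"
        by (simp add: t_def)
    qed auto
    also have "\<dots> = (\<Prod>k<n. 1 + q ^ (2*k+1) * w) * ((\<Prod>k<n. w + q ^ (2*k+1)) * (\<Prod>k<n. inverse w))"
      by (simp add: sum_distrib_right[symmetric] finite_triple_product[OF q, symmetric])
    also have "\<dots> = (\<Prod>k<n. 1 - (-(q * w)) * ?Q ^ k) * (\<Prod>k<n. 1 - (-(q / w)) * ?Q ^ k)"
      unfolding prod.distrib[symmetric] using w
      by (intro arg_cong2[where f = "(*)"] prod.cong) (auto simp: power_mult[symmetric] field_simps)
    finally show ?thesis .
  qed
  have "inverse P * (\<Sum>\<^sub>\<infinity>j. t j) = qpoch (-(q * w)) ?Q * qpoch (-(q / w)) ?Q"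
  proof (rule LIMSEQ_unique)
    show "(\<lambda>n. \<Sum>\<^sub>\<infinity>j. c n j * t j) \<longlonglongrightarrow> inverse P * (\<Sum>\<^sub>\<infinity>j. t j)"
      using lim by (simp add: infsum_cmult_right')
    show "(\<lambda>n. \<Sum>\<^sub>\<infinity>j. c n j * t j) \<longlonglongrightarrow> qpoch (-(q * w)) ?Q * qpoch (-(q / w)) ?Q"
      unfolding fin by (intro tendsto_mult qpoch_LIMSEQ Q)
  qed
  then have "(\<Sum>\<^sub>\<infinity>j. t j) = P * qpoch (-(q * w)) ?Q * qpoch (-(q / w)) ?Q"
    using P by (simp add: field_simps)
  then show ?thesis
    using has_sum_infsum[OF abs_summable_summable[OF t]] by (simp add: t_def P_def)
qed

section \<open>Double series and their splitting by parity\<close>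

lemma has_sum_mult_Times:
  fixes f :: "'a \<Rightarrow> 'c :: {banach, real_normed_field}" and g :: "'b \<Rightarrow> 'c"
  assumes f: "(f has_sum a) A" "(\<lambda>x. norm (f x)) summable_on A"
    and g: "(g has_sum b) B" "(\<lambda>x. norm (g x)) summable_on B"
  shows "((\<lambda>(x, y). f x * g y) has_sum (a * b)) (A \<times> B)"
proof (rule has_sum_SigmaI)
  show "((\<lambda>y. case (x, y) of (x, y) \<Rightarrow> f x * g y) has_sum f x * b) B" if "x \<in> A" for x
    using g(1) by (auto intro: has_sum_cmult_right)
  show "((\<lambda>x. f x * b) has_sum a * b) A"
    using f(1) by (rule has_sum_cmult_left)
  have "(\<lambda>x. norm (f x) * infsum (\<lambda>y. norm (g y)) B) summable_on A"
    using f(2) by (rule summable_on_cmult_left)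
  moreover have "(\<Sum>\<^sub>\<infinity>y\<in>B. norm (g y)) \<ge> 0"
    by (rule infsum_nonneg) auto
  ultimately have "(\<lambda>p. norm ((\<lambda>(x, y). f x * g y) p)) summable_on (A \<times> B)"
    using g(2) by (subst Infinite_Sum.abs_summable_on_Sigma_iff)
      (auto simp: norm_mult infsum_cmult_right' intro!: summable_on_cmult_right)
  then show "(\<lambda>(x, y). f x * g y) summable_on (A \<times> B)"
    by (rule abs_summable_summable)
qed

text \<open>Pairs with even and with odd sum are parametrised by (a + b, a - b) and (a + b + 1, a -
  b). In these coordinates a sum of two squares becomes twice such a sum, which is what produces
  theta constants at 2 tau.\<close>

lemma has_sum_parity_split:
  fixes f :: "int \<times> int \<Rightarrow> complex"
  assumes "((\<lambda>(a, b). f (a + b, a - b)) has_sum x) UNIV"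
    and "((\<lambda>(a, b). f (a + b + 1, a - b)) has_sum y) UNIV"
  shows "(f has_sum (x + y)) UNIV"
proof -
  let ?e = "\<lambda>(a, b). (a + b, a - b :: int)" and ?o = "\<lambda>(a, b). (a + b + 1, a - b :: int)"
  have "(f has_sum x) (range ?e)"
    using assms(1) by (subst has_sum_reindex) (auto simp: inj_on_def o_def case_prod_unfold)
  moreover have "(f has_sum y) (range ?o)"
    using assms(2) by (subst has_sum_reindex) (auto simp: inj_on_def o_def case_prod_unfold)
  moreover have "range ?e \<inter> range ?o = {}"
  proof -
    have "?e p \<noteq> ?o r" for p r
    proof
      assume "?e p = ?o r"
      then have "even (fst (?o r) + snd (?o r))"
        by (metis (no_types, lifting) add.commute case_prod_unfold diff_add_cancel dvd_triv_right even_add fst_conv group_cancel.add1 snd_conv dvd_diff_right_iff even_diff)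
      then show False
        by (auto simp: case_prod_unfold)
    qed
    then show ?thesis by blast
  qed
  ultimately have "(f has_sum (x + y)) (range ?e \<union> range ?o)"
    by (rule has_sum_Un_disjoint)
  also have "range ?e \<union> range ?o = UNIV"
  proof -
    have "(m, n) \<in> range ?e \<union> range ?o" for m n
    proof (cases "even (m + n)")
      case True
      then have "(m, n) = ?e ((m + n) div 2, (m - n) div 2)"
        by (auto elim!: evenE) presburger+
      then show ?thesis by blast
    next
      case False
      then have "(m, n) = ?o ((m + n - 1) div 2, (m - n - 1) div 2)"
        by simp presburger
      then show ?thesis by blast
    qed
    then show ?thesis by auto
  qed
  finally show ?thesis .
qed

subsection \<open>Theta constants\<close>

text \<open>This is \<open>exp (\<pi>\<i>\<tau>)\<close>; the \<open>q\<close> of \<open>dedekind_eta\<close> is its square.\<close>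

definition nome :: "complex \<Rightarrow> complex" where
  "nome \<tau> = exp (of_real pi * \<i> * \<tau>)"

lemma nome_nonzero [simp]: "nome \<tau> \<noteq> 0"
  by (simp add: nome_def)

lemma norm_nome: "norm (nome \<tau>) = exp (- pi * Im \<tau>)"
  by (simp add: nome_def norm_exp_eq_Re)

lemma norm_nome_less_1 [simp]: "Im \<tau> > 0 \<Longrightarrow> norm (nome \<tau>) < 1"
  by (simp add: norm_nome)

lemma norm_nome_square_less_1 [simp]: "Im \<tau> > 0 \<Longrightarrow> norm (nome \<tau> ^ 2) < 1"
  by (intro norm_square_less_1) simp

lemma nome_plus_1: "nome (\<tau> + 1) = - nome \<tau>"
  by (simp add: nome_def ring_distribs exp_add mult_ac)

lemma holomorphic_nome [holomorphic_intros]: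
  "f holomorphic_on A \<Longrightarrow> (\<lambda>z. nome (f z)) holomorphic_on A"
  unfolding nome_def by (intro holomorphic_intros)

lemma open_upper_half_plane: "open upper_half_plane"
  unfolding upper_half_plane_def by (rule open_halfspace_Im_gt)

lemma convex_upper_half_plane: "convex upper_half_plane"
  unfolding upper_half_plane_def by (rule convex_halfspace_Im_gt)

text \<open>Classically the alternating series over (-1)^n q^(n^2) in the nome q: shifting tau by 1
  changes the sign of the nome. As a shift it makes every statement on theta_3 one on
  theta_4.\<close>

definition theta4 :: "complex \<Rightarrow> complex" where
  "theta4 \<tau> = theta3 (\<tau> + 1)"

text \<open>The factor \<open>1 powi n\<close> brings the term into the shape of the triple product
  with w = 1.\<close>

lemma theta3_term: "exp (of_real pi * \<i> * of_int n ^ 2 * \<tau>) = nome \<tau> powi (n ^ 2) * 1 powi n"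
  by (simp add: nome_def exp_power_int mult_ac)

text \<open>From (n + 1/2)^2 = n^2 + n + 1/4: up to a factor this is the triple product series at w
  = q.\<close>

lemma theta2_term: "exp (of_real pi * \<i> * (of_int n + 1 / 2) ^ 2 * \<tau>) =
   exp (of_real pi * \<i> * \<tau> / 4) * (nome \<tau> powi (n ^ 2) * nome \<tau> powi n)"
  unfolding nome_def exp_power_int exp_add[symmetric]
  by (simp add: power2_eq_square algebra_simps add_divide_distrib)

lemma theta3_has_sum:
  assumes "Im \<tau> > 0"
  shows "((\<lambda>n. exp (of_real pi * \<i> * of_int n ^ 2 * \<tau>)) has_sum theta3 \<tau>) UNIV"
    and "(\<lambda>n. norm (exp (of_real pi * \<i> * of_int n ^ 2 * \<tau>))) summable_on UNIV"
proof -
  show *: "(\<lambda>n. norm (exp (of_real pi * \<i> * of_int n ^ 2 * \<tau>))) summable_on UNIV"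
    unfolding theta3_term using assms by (intro abs_summable_theta) auto
  show "((\<lambda>n. exp (of_real pi * \<i> * of_int n ^ 2 * \<tau>)) has_sum theta3 \<tau>) UNIV"
    unfolding theta3_def using abs_summable_summable[OF *] by (rule has_sum_infsum)
qed

lemma theta2_has_sum:
  assumes "Im \<tau> > 0"
  shows "((\<lambda>n. exp (of_real pi * \<i> * (of_int n + 1 / 2) ^ 2 * \<tau>)) has_sum theta2 \<tau>) UNIV"
    and "(\<lambda>n. norm (exp (of_real pi * \<i> * (of_int n + 1 / 2) ^ 2 * \<tau>))) summable_on UNIV"
proof -
  show *: "(\<lambda>n. norm (exp (of_real pi * \<i> * (of_int n + 1 / 2) ^ 2 * \<tau>))) summable_on UNIV"
    unfolding theta2_term norm_mult[of "exp _"]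
    using assms by (intro abs_summable_theta summable_on_cmult_right) auto
  show "((\<lambda>n. exp (of_real pi * \<i> * (of_int n + 1 / 2) ^ 2 * \<tau>)) has_sum theta2 \<tau>) UNIV"
    unfolding theta2_def using abs_summable_summable[OF *] by (rule has_sum_infsum)
qed

lemma theta3_product:
  assumes "Im \<tau> > 0"
  shows "theta3 \<tau> = qpoch (nome \<tau> ^ 2) (nome \<tau> ^ 2) * qpoch (- nome \<tau>) (nome \<tau> ^ 2) ^ 2"
proof (rule has_sum_unique[OF theta3_has_sum(1)[OF assms]])
  show "((\<lambda>n. exp (of_real pi * \<i> * of_int n ^ 2 * \<tau>)) has_sum
     qpoch (nome \<tau> ^ 2) (nome \<tau> ^ 2) * qpoch (- nome \<tau>) (nome \<tau> ^ 2) ^ 2) UNIV"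
    unfolding theta3_term
    using jacobi_triple_product[of "nome \<tau>" 1] assms by (simp add: power2_eq_square mult_ac)
qed

lemma theta4_product:
  assumes "Im \<tau> > 0"
  shows "theta4 \<tau> = qpoch (nome \<tau> ^ 2) (nome \<tau> ^ 2) * qpoch (nome \<tau>) (nome \<tau> ^ 2) ^ 2"
  unfolding theta4_def using theta3_product[of "\<tau> + 1"] assms by (simp add: nome_plus_1)

text \<open>At w = q the last product of the triple product is (-1; q^2), whose first factor is 2
  and whose remaining factors repeat (-q^2; q^2).\<close>

lemma theta2_product:
  assumes "Im \<tau> > 0"
  shows "theta2 \<tau> = 2 * exp (of_real pi * \<i> * \<tau> / 4) *
     qpoch (nome \<tau> ^ 2) (nome \<tau> ^ 2) * qpoch (- (nome \<tau> ^ 2)) (nome \<tau> ^ 2) ^ 2"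
proof -
  let ?q = "nome \<tau>"
  have "((\<lambda>n. exp (of_real pi * \<i> * \<tau> / 4) * (?q powi (n ^ 2) * ?q powi n)) has_sum
     exp (of_real pi * \<i> * \<tau> / 4) * (qpoch (?q ^ 2) (?q ^ 2) *
       qpoch (-(?q * ?q)) (?q ^ 2) * qpoch (-(?q / ?q)) (?q ^ 2))) UNIV"
    using assms by (intro has_sum_cmult_right jacobi_triple_product) auto
  from has_sum_unique[OF theta2_has_sum(1)[OF assms] this[folded theta2_term]]
  have "theta2 \<tau> = exp (of_real pi * \<i> * \<tau> / 4) * (qpoch (?q ^ 2) (?q ^ 2) *
       qpoch (-(?q * ?q)) (?q ^ 2) * qpoch (-1) (?q ^ 2))"
    by simp
  also have "qpoch (-1) (?q ^ 2) = 2 * qpoch (- (?q ^ 2)) (?q ^ 2)"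
    using qpoch_rec[of "?q ^ 2" "-1"] assms by simp
  finally show ?thesis
    by (simp add: power2_eq_square)
qed

lemma theta_nonzero:
  assumes "Im \<tau> > 0"
  shows "theta2 \<tau> \<noteq> 0" "theta3 \<tau> \<noteq> 0" "theta4 \<tau> \<noteq> 0"
  unfolding theta2_product[OF assms] theta3_product[OF assms] theta4_product[OF assms]
  using assms by (auto simp: qpoch_nonzero')

text \<open>The three q-products that are squared multiply to 1 by Euler's identity, and the cube of
  the exponential factor of eta is that of theta_2. This is the bridge from lambda and from the
  discriminant to eta.\<close>

lemma theta_product:
  assumes "Im \<tau> > 0"
  shows "theta2 \<tau> * theta3 \<tau> * theta4 \<tau> = 2 * dedekind_eta \<tau> ^ 3"
proof -
  define q where "q = nome \<tau>"
  define P where "P = qpoch (q ^ 2) (q ^ 2)"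
  define E where "E = qpoch (-(q ^ 2)) (q ^ 2) * qpoch q (q ^ 2) * qpoch (-q) (q ^ 2)"
  have E: "E = 1"
    unfolding E_def q_def using assms by (intro qpoch_euler) auto
  have "exp (2 * of_real pi * \<i> * \<tau>) = q ^ 2"
    by (simp add: q_def nome_def exp_of_nat_mult[symmetric] mult_ac exp_double)
  then have "dedekind_eta \<tau> = exp (2 * of_real pi * \<i> * \<tau> / 24) * P"
    by (simp add: dedekind_eta_def P_def qpoch_def)
  moreover have "exp (2 * of_real pi * \<i> * \<tau> / 24) ^ 3 = exp (of_real pi * \<i> * \<tau> / 4)"
    unfolding exp_of_nat_mult[symmetric] by (simp add: mult_ac)
  ultimately have eta: "dedekind_eta \<tau> ^ 3 = exp (of_real pi * \<i> * \<tau> / 4) * P ^ 3"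
    by (simp add: power_mult_distrib)
  have "theta2 \<tau> * theta3 \<tau> * theta4 \<tau> = 2 * exp (of_real pi * \<i> * \<tau> / 4) * P ^ 3 * E ^ 2"
    unfolding theta2_product[OF assms] theta3_product[OF assms] theta4_product[OF assms]
      q_def[symmetric] P_def[symmetric] E_def
    by (simp add: power2_eq_square power3_eq_cube)
  then show ?thesis
    by (simp add: E eta)
qed

section \<open>Translation of the theta constants by 1\<close>

lemma theta2_plus_1:
  assumes "Im \<tau> > 0"
  shows "theta2 (\<tau> + 1) = exp (of_real pi * \<i> / 4) * theta2 \<tau>"
proof -
  have "exp (of_real pi * \<i> * (\<tau> + 1) / 4) = exp (of_real pi * \<i> / 4) * exp (of_real pi * \<i> * \<tau> / 4)"
    by (simp add: exp_add[symmetric] ring_distribs add_divide_distrib add.commute)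
  then show ?thesis
    using theta2_product[of "\<tau> + 1"] theta2_product[of \<tau>] assms by (simp add: nome_plus_1)
qed

lemma theta2_plus_1_pow4:
  assumes "Im \<tau> > 0"
  shows "theta2 (\<tau> + 1) ^ 4 = - (theta2 \<tau> ^ 4)"
proof -
  have "exp (of_real pi * \<i> / 4) ^ 4 = exp (of_real pi * \<i>)"
    unfolding exp_of_nat_mult[symmetric] by simp
  then show ?thesis
    by (simp add: theta2_plus_1[OF assms] power_mult_distrib mult.commute)
qed

lemma theta4_plus_1: "Im \<tau> > 0 \<Longrightarrow> theta4 (\<tau> + 1) = theta3 \<tau>"
  using theta4_product[of "\<tau> + 1"] theta3_product[of "\<tau>"] by (simp add: nome_plus_1)

lemma theta3_plus_2: "Im \<tau> > 0 \<Longrightarrow> theta3 (\<tau> + 2) = theta3 \<tau>"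
  using theta4_plus_1[of "\<tau>"] by (simp add: theta4_def add.assoc)

text \<open>Even pairs: (a + b)^2 + (a - b)^2 = 2 (a^2 + b^2). Odd pairs: (a + b + 1)^2 + (a - b)^2
  = 2 ((a + 1/2)^2 + (b + 1/2)^2).\<close>

lemma theta3_duplication:
  assumes "Im \<tau> > 0"
  shows "theta3 \<tau> ^ 2 = theta3 (2 * \<tau>) ^ 2 + theta2 (2 * \<tau>) ^ 2"
proof -
  let ?t = "\<lambda>n \<tau>. exp (of_real pi * \<i> * of_int n ^ 2 * \<tau>)"
  let ?s = "\<lambda>n \<tau>. exp (of_real pi * \<i> * (of_int n + 1 / 2) ^ 2 * \<tau>)"
  have 2: "Im (2 * \<tau>) > 0" using assms by simp
  note t1 = theta3_has_sum[OF assms] and t3 = theta3_has_sum[OF 2] and t2 = theta2_has_sum[OF 2]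
  have "((\<lambda>(m, n). ?t m \<tau> * ?t n \<tau>) has_sum (theta3 (2 * \<tau>) * theta3 (2 * \<tau>) + theta2 (2 * \<tau>) * theta2 (2 * \<tau>))) UNIV"
  proof (rule has_sum_parity_split)
    have *: "?t a (2 * \<tau>) * ?t b (2 * \<tau>) = ?t (a + b) \<tau> * ?t (a - b) \<tau>" for a b
      unfolding exp_add[symmetric] by (rule arg_cong[where f = exp]) (simp add: algebra_simps power2_eq_square)
    show "((\<lambda>(a, b). case (a + b, a - b) of (m, n) \<Rightarrow> ?t m \<tau> * ?t n \<tau>) has_sum theta3 (2 * \<tau>) * theta3 (2 * \<tau>)) UNIV"
      using has_sum_mult_Times[OF t3 t3] by (simp only: * prod.case UNIV_Times_UNIV)
    have *: "?s a (2 * \<tau>) * ?s b (2 * \<tau>) = ?t (a + b + 1) \<tau> * ?t (a - b) \<tau>" for a b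
      unfolding exp_add[symmetric] by (rule arg_cong[where f = exp]) (simp add: algebra_simps power2_eq_square)
    show "((\<lambda>(a, b). case (a + b + 1, a - b) of (m, n) \<Rightarrow> ?t m \<tau> * ?t n \<tau>) has_sum theta2 (2 * \<tau>) * theta2 (2 * \<tau>)) UNIV"
      using has_sum_mult_Times[OF t2 t2] by (simp only: * prod.case UNIV_Times_UNIV)
  qed
  moreover have "((\<lambda>(m, n). ?t m \<tau> * ?t n \<tau>) has_sum (theta3 \<tau> * theta3 \<tau>)) UNIV"
    using has_sum_mult_Times[OF t1 t1] by simp
  ultimately show ?thesis
    by (simp add: has_sum_unique power2_eq_square)
qed

lemma theta2_duplication:
  assumes "Im \<tau> > 0"
  shows "theta2 \<tau> ^ 2 = 2 * theta2 (2 * \<tau>) * theta3 (2 * \<tau>)"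
proof -
  let ?t = "\<lambda>n \<tau>. exp (of_real pi * \<i> * of_int n ^ 2 * \<tau>)"
  let ?s = "\<lambda>n \<tau>. exp (of_real pi * \<i> * (of_int n + 1 / 2) ^ 2 * \<tau>)"
  have 2: "Im (2 * \<tau>) > 0" using assms by simp
  note t1 = theta2_has_sum[OF assms] and t3 = theta3_has_sum[OF 2] and t2 = theta2_has_sum[OF 2]
  \<comment> \<open>For pairs of odd sum the integral variable is a + 1 instead of b: (a + b +
    3/2)^2 + (a - b + 1/2)^2 = 2 ((a + 1)^2 + (b + 1/2)^2).\<close>
  have bij: "bij (\<lambda>a::int. a + 1)"
    by (rule bij_betwI[where g = "\<lambda>a. a - 1"]) auto
  have t3': "((\<lambda>n. ?t (n + 1) (2 * \<tau>)) has_sum theta3 (2 * \<tau>)) UNIV"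
     "(\<lambda>n. norm (?t (n + 1) (2 * \<tau>))) summable_on UNIV"
    using t3(1) has_sum_reindex_bij_betw[OF bij, of "\<lambda>n. ?t n (2 * \<tau>)"]
      t3(2) summable_on_reindex_bij_betw[OF bij, of "\<lambda>n. norm (?t n (2 * \<tau>))"] by auto
  have "((\<lambda>(m, n). ?s m \<tau> * ?s n \<tau>) has_sum (theta2 (2 * \<tau>) * theta3 (2 * \<tau>) + theta3 (2 * \<tau>) * theta2 (2 * \<tau>))) UNIV"
  proof (rule has_sum_parity_split)
    have *: "?s a (2 * \<tau>) * ?t b (2 * \<tau>) = ?s (a + b) \<tau> * ?s (a - b) \<tau>" for a b
      unfolding exp_add[symmetric] by (rule arg_cong[where f = exp]) (simp add: algebra_simps power2_eq_square)
    show "((\<lambda>(a, b). case (a + b, a - b) of (m, n) \<Rightarrow> ?s m \<tau> * ?s n \<tau>) has_sum theta2 (2 * \<tau>) * theta3 (2 * \<tau>)) UNIV"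
      using has_sum_mult_Times[OF t2 t3] by (simp only: * prod.case UNIV_Times_UNIV)
    have *: "?t (a + 1) (2 * \<tau>) * ?s b (2 * \<tau>) = ?s (a + b + 1) \<tau> * ?s (a - b) \<tau>" for a b
      unfolding exp_add[symmetric] by (rule arg_cong[where f = exp]) (simp add: algebra_simps power2_eq_square)
    show "((\<lambda>(a, b). case (a + b + 1, a - b) of (m, n) \<Rightarrow> ?s m \<tau> * ?s n \<tau>) has_sum theta3 (2 * \<tau>) * theta2 (2 * \<tau>)) UNIV"
      using has_sum_mult_Times[OF t3' t2] by (simp only: * prod.case UNIV_Times_UNIV)
  qed
  moreover have "((\<lambda>(m, n). ?s m \<tau> * ?s n \<tau>) has_sum (theta2 \<tau> * theta2 \<tau>)) UNIV"
    using has_sum_mult_Times[OF t1 t1] by simp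
  ultimately have "theta2 \<tau> * theta2 \<tau> = theta2 (2 * \<tau>) * theta3 (2 * \<tau>) + theta3 (2 * \<tau>) * theta2 (2 * \<tau>)"
    using has_sum_unique by blast
  then show ?thesis
    by (simp add: power2_eq_square)
qed

text \<open>The formula for theta_3 at tau + 1: doubling turns the shift into 2, which multiplies
  theta_2 by i and so changes the sign of its square.\<close>

lemma theta4_duplication:
  assumes "Im \<tau> > 0"
  shows "theta4 \<tau> ^ 2 = theta3 (2 * \<tau>) ^ 2 - theta2 (2 * \<tau>) ^ 2"
proof -
  have "theta2 (2 * \<tau> + 2) = exp (of_real pi * \<i> / 4) * (exp (of_real pi * \<i> / 4) * theta2 (2 * \<tau>))"
    using theta2_plus_1[of "2 * \<tau> + 1"] theta2_plus_1[of "2 * \<tau>"] assms by (simp add: add.assoc)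
  also have "\<dots> = exp (of_real pi * \<i> / 2) * theta2 (2 * \<tau>)"
    unfolding mult.assoc[symmetric] exp_add[symmetric] by (simp add: mult.commute)
  also have "exp (of_real pi * \<i> / 2) = \<i>"
    using cis_conv_exp[of "pi / 2"] by (simp add: mult.commute)
  finally have "theta2 (2 * \<tau> + 2) ^ 2 = - (theta2 (2 * \<tau>) ^ 2)"
    by (simp add: power_mult_distrib)
  then show ?thesis
    using theta3_duplication[of "\<tau> + 1"] theta3_plus_2[of "2 * \<tau>"] assms
    by (simp add: theta4_def ring_distribs)
qed

text \<open>By the duplication formulas this is (x + y)^2 = 4 x y + (x - y)^2 with x = theta_3(2
  tau)^2 and y = theta_2(2 tau)^2.\<close>

lemma jacobi_quartic:
  assumes "Im \<tau> > 0"
  shows "theta3 \<tau> ^ 4 = theta2 \<tau> ^ 4 + theta4 \<tau> ^ 4"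
proof -
  have "x ^ 4 = (x ^ 2) ^ 2" for x :: complex
    by simp
  then show ?thesis
    unfolding theta3_duplication[OF assms] theta4_duplication[OF assms] theta2_duplication[OF assms]
    by (simp only: theta3_duplication[OF assms] theta4_duplication[OF assms] theta2_duplication[OF assms])
      (simp add: algebra_simps power2_eq_square)
qed

lemma holomorphic_on_theta [holomorphic_intros]:
  shows "theta2 holomorphic_on upper_half_plane" "theta3 holomorphic_on upper_half_plane"
    "theta4 holomorphic_on upper_half_plane"
proof -
  have "(\<lambda>\<tau>. 2 * exp (of_real pi * \<i> * \<tau> / 4) *
     qpoch (nome \<tau> ^ 2) (nome \<tau> ^ 2) * qpoch (- (nome \<tau> ^ 2)) (nome \<tau> ^ 2) ^ 2) holomorphic_on upper_half_plane"
    by (intro holomorphic_intros open_upper_half_plane) (auto simp: upper_half_plane_def)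
  then show "theta2 holomorphic_on upper_half_plane"
    by (rule holomorphic_transform) (auto simp: upper_half_plane_def theta2_product)
  have "(\<lambda>\<tau>. qpoch (nome \<tau> ^ 2) (nome \<tau> ^ 2) * qpoch (- nome \<tau>) (nome \<tau> ^ 2) ^ 2) holomorphic_on upper_half_plane"
    by (intro holomorphic_intros open_upper_half_plane) (auto simp: upper_half_plane_def)
  then show "theta3 holomorphic_on upper_half_plane"
    by (rule holomorphic_transform) (auto simp: upper_half_plane_def theta3_product)
  have "(\<lambda>\<tau>. qpoch (nome \<tau> ^ 2) (nome \<tau> ^ 2) * qpoch (nome \<tau>) (nome \<tau> ^ 2) ^ 2) holomorphic_on upper_half_plane"
    by (intro holomorphic_intros open_upper_half_plane) (auto simp: upper_half_plane_def)
  then show "theta4 holomorphic_on upper_half_plane"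
    by (rule holomorphic_transform) (auto simp: upper_half_plane_def theta4_product)
qed

lemma holomorphic_on_dedekind_eta [holomorphic_intros]: "dedekind_eta holomorphic_on upper_half_plane"
proof -
  have "(\<lambda>\<tau>. exp (2 * of_real pi * \<i> * \<tau> / 24) * qpoch (nome \<tau> ^ 2) (nome \<tau> ^ 2)) holomorphic_on upper_half_plane"
    by (intro holomorphic_intros open_upper_half_plane) (auto simp: upper_half_plane_def)
  moreover have "exp (2 * of_real pi * \<i> * \<tau>) = nome \<tau> ^ 2" for \<tau>
    by (simp add: nome_def exp_of_nat_mult[symmetric] mult_ac exp_double)
  ultimately show ?thesis
    by (auto intro: holomorphic_transform simp: dedekind_eta_def qpoch_def)
qed

subsection \<open>A quadratic transformation\<close>

definition hyp_coeff :: "nat \<Rightarrow> complex" where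
  "hyp_coeff n = pochhammer (1 / 2) n ^ 2 / fact n ^ 2"

definition hyp_fps :: "complex fps" where
  "hyp_fps = Abs_fps hyp_coeff"

lemma hyp_fps_nth [simp]: "fps_nth hyp_fps n = hyp_coeff n"
  by (simp add: hyp_fps_def)

lemma hyp_coeff_0 [simp]: "hyp_coeff 0 = 1"
  by (simp add: hyp_coeff_def)

lemma hyp_coeff_Suc:
  "of_nat (Suc n) ^ 2 * hyp_coeff (Suc n) = (of_nat n + 1 / 2) ^ 2 * hyp_coeff n"
proof -
  have "(of_nat (Suc n) :: complex) \<noteq> 0"
    by (rule of_nat_neq_0)
  moreover have "fact (Suc n) = (of_nat (Suc n) * fact n :: complex)"
    by (rule fact_Suc)
  ultimately show ?thesis
    unfolding hyp_coeff_def pochhammer_Suc by (simp add: power_mult_distrib add.commute)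
qed

lemma norm_hyp_coeff_le_1: "norm (hyp_coeff n) \<le> 1"
proof (induction n)
  case (Suc n)
  have "norm (of_nat (Suc n) ^ 2 * hyp_coeff (Suc n)) = norm ((of_nat n + 1 / 2) ^ 2 * hyp_coeff n)"
    by (simp only: hyp_coeff_Suc)
  moreover have "norm (of_nat n + 1 / 2 :: complex) = real n + 1 / 2"
    using norm_of_real[of "real n + 1 / 2", where ?'a = complex] by simp
  ultimately have "real (Suc n) ^ 2 * norm (hyp_coeff (Suc n)) = (real n + 1 / 2) ^ 2 * norm (hyp_coeff n)"
    by (simp only: norm_mult norm_power norm_of_nat)
  also have "\<dots> \<le> real (Suc n) ^ 2 * 1"
    using Suc by (intro mult_mono power_mono) auto
  finally show ?case
    by (subst (asm) mult_le_cancel_left_pos) auto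
qed simp

lemma fps_conv_radius_hyp_fps: "fps_conv_radius hyp_fps \<ge> 1"
  unfolding fps_conv_radius_def
proof (rule conv_radius_geI_ex')
  fix r :: real assume r: "0 < r" "ereal r < 1"
  have "summable (\<lambda>n. hyp_coeff n * of_real r ^ n)"
  proof (rule summable_comparison_test)
    have "norm (hyp_coeff n * of_real r ^ n) \<le> 1 * r ^ n" for n
      unfolding norm_mult norm_power using r norm_hyp_coeff_le_1[of n]
      by (intro mult_mono) auto
    then show "\<exists>N. \<forall>n\<ge>N. norm (hyp_coeff n * of_real r ^ n) \<le> r ^ n"
      by auto
    show "summable (\<lambda>n. r ^ n)"
      using r by (intro summable_geometric) auto
  qed
  then show "summable (\<lambda>n. fps_nth hyp_fps n * of_real r ^ n)"
    by simp
qed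

text \<open>The negative binomial series: that multiplication by 1 + X leads from the series for k +
  1 to the one for k is Pascal's rule.\<close>

lemma inverse_one_plus_X_power_nth:
  "(inverse (1 + fps_X) :: complex fps) ^ Suc k $ n = (-1) ^ n * of_nat ((n + k) choose k)"
proof -
  define D :: "nat \<Rightarrow> complex fps" where "D k = Abs_fps (\<lambda>n. (-1) ^ n * of_nat ((n + k) choose k))" for k
  have nz: "(1 + fps_X :: complex fps) $ 0 \<noteq> 0"
    by simp
  have step: "inverse (1 + fps_X) * D k = D (Suc k)" for k
  proof -
    have "(1 + fps_X) * D (Suc k) = D k"
    proof (rule fps_ext)
      fix n
      show "((1 + fps_X) * D (Suc k)) $ n = D k $ n"
        by (cases n) (simp_all add: D_def ring_distribs)
    qed
    then have "inverse (1 + fps_X) * ((1 + fps_X) * D (Suc k)) = inverse (1 + fps_X) * D k"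
      by simp
    then show ?thesis
      using inverse_mult_eq_1[OF nz] by (simp add: mult.assoc[symmetric])
  qed
  have "D 0 = inverse (1 + fps_X)"
  proof -
    have "(1 + fps_X) * D 0 = 1"
    proof (rule fps_ext)
      fix n
      show "((1 + fps_X) * D 0) $ n = (1 :: complex fps) $ n"
        by (cases n) (simp_all add: D_def ring_distribs)
    qed
    then have "inverse (1 + fps_X) * ((1 + fps_X) * D 0) = inverse (1 + fps_X)"
      by simp
    then show ?thesis
      using inverse_mult_eq_1[OF nz] by (simp add: mult.assoc[symmetric])
  qed
  then have "inverse (1 + fps_X) ^ Suc k = D k"
    by (induction k) (simp_all add: step)
  then show ?thesis
    by (simp add: D_def)
qed

definition inv_fact :: "int \<Rightarrow> complex" where
  "inv_fact n = (if n < 0 then 0 else inverse (fact (nat n)))"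

lemma inv_fact_minus_1: "inv_fact (n - 1) = of_int n * inv_fact n"
proof (cases "n \<ge> 1")
  case True
  then obtain k where k: "n - 1 = int k"
    using nonneg_int_cases[of "n - 1"] by auto
  then have n: "n = int (Suc k)"
    by simp
  have "(of_nat (Suc k) :: complex) \<noteq> 0"
    by (rule of_nat_neq_0)
  then show ?thesis
    unfolding k unfolding n by (simp add: inv_fact_def del: of_nat_Suc)
qed (auto simp: inv_fact_def)

text \<open>
  The coefficients of the quadratic transformation satisfy a two-term recurrence in \<open>N\<close>,
  certified by a Wilf--Zeilberger pair. The reciprocal factorial \<open>inv_fact\<close> vanishes at
  negative integers, so that the certificate holds without case distinctions.
\<close>

lemma landen_coeff_sum:
  "(\<Sum>m\<le>N. (-1) ^ (N + m) * of_nat ((N + m) choose (2 * m)) * 4 ^ m * hyp_coeff m) =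
     (if even N then hyp_coeff (N div 2) else 0)"
proof -
  define b where "b m = hyp_coeff m * 4 ^ m / fact (2 * m)" for m
  define t where "t N m = (-1) ^ (N + m) * fact (N + m) * inv_fact (int N - int m) * b m" for N m
  \<comment> \<open>The certificate is a rational multiple of the summand; the shift by 2 in
    \<open>inv_fact\<close> matches the step from \<open>N\<close> to \<open>N + 2\<close>, and the
    factor m^3 makes it vanish at m = 0.\<close>
  define G where "G N m = - 2 * (2 * of_nat N + 3) * of_nat m ^ 3 * (-1) ^ (N + m) * fact (N + m) *
      inv_fact (int N - int m + 2) * b m" for N m
  have b_Suc: "2 * of_nat (Suc m) ^ 3 * b (Suc m) = (2 * of_nat m + 1) * b m" for m
  proof -
    have nz: "(2 * of_nat m + 1 :: complex) \<noteq> 0"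
      using of_nat_neq_0[of "2 * m", where ?'a = complex] by (simp add: add.commute)
    have nz': "(of_nat m + 1 :: complex) \<noteq> 0"
      using of_nat_neq_0[of m, where ?'a = complex] by (simp add: add.commute)
    have "of_nat (Suc m) ^ 2 * b (Suc m) = (of_nat (Suc m) ^ 2 * hyp_coeff (Suc m)) * 4 ^ Suc m / fact (2 * Suc m)"
      by (simp add: b_def)
    also have "\<dots> = (of_nat m + 1 / 2) ^ 2 * 4 * b m / ((2 * of_nat m + 2) * (2 * of_nat m + 1))"
      unfolding hyp_coeff_Suc by (simp add: b_def field_simps)
    also have "\<dots> = (2 * of_nat m + 1) * b m / (2 * of_nat m + 2)"
      using nz by (simp add: divide_simps power2_eq_square) (simp add: algebra_simps)
    finally have *: "of_nat (Suc m) ^ 2 * b (Suc m) = (2 * of_nat m + 1) * b m / (2 * of_nat m + 2)" .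
    have "2 * of_nat (Suc m) ^ 3 * b (Suc m) = (2 * of_nat m + 2) * (of_nat (Suc m) ^ 2 * b (Suc m))"
      by (simp add: power3_eq_cube power2_eq_square algebra_simps)
    also have "\<dots> = (2 * of_nat m + 1) * b m"
    proof -
      have "(2 * of_nat m + 2 :: complex) \<noteq> 0"
        using of_nat_neq_0[of "2 * m + 1", where ?'a = complex] by (simp add: add.commute)
      then show ?thesis
        unfolding * by simp
    qed
    finally show ?thesis .
  qed
  have certificate: "of_nat (N + 2) ^ 2 * t (N + 2) m - of_nat (N + 1) ^ 2 * t N m = G N (Suc m) - G N m" for N m
  proof -
    define d where "d = int N - int m + 2"
    define R where "R = inv_fact d"
    have d: "of_int d = (of_nat N - of_nat m + 2 :: complex)"
      by (simp add: d_def)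
    have r1: "inv_fact (d - 1) = of_int d * R"
      using inv_fact_minus_1[of d] by (simp add: R_def)
    have r2: "inv_fact (d - 2) = (of_int d - 1) * (of_int d * R)"
      using inv_fact_minus_1[of "d - 1"] r1 by simp
    define s where "s = (-1 :: complex) ^ (N + m)"
    define f where "f = (fact (N + m) :: complex)"
    define n x where "n = (of_nat N :: complex)" and "x = (of_nat m :: complex)"
    define c where "c = s * f * R * b m"
    have "fact (N + 2 + m) = ((n + x + 2) * (n + x + 1) * f :: complex)"
      by (simp add: f_def n_def x_def algebra_simps numeral_2_eq_2)
    moreover have "(-1 :: complex) ^ (N + 2 + m) = s"
      by (simp add: s_def)
    moreover have "int (N + 2) - int m = d"
      by (simp add: d_def)
    ultimately have t2: "t (N + 2) m = c * ((n + x + 2) * (n + x + 1))"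
      by (simp only: t_def R_def[symmetric] c_def mult_ac)
    have "int N - int m = d - 2" "of_int d - 1 = (n - x + 1 :: complex)" "of_int d = (n - x + 2 :: complex)"
      by (simp_all add: d_def n_def x_def)
    then have t0: "t N m = c * ((n - x + 1) * (n - x + 2))"
      by (simp only: t_def r2 s_def[symmetric] f_def[symmetric] c_def mult_ac)
    have "fact (N + Suc m) = ((n + x + 1) * f :: complex)"
      by (simp add: f_def n_def x_def algebra_simps)
    moreover have "(-1 :: complex) ^ (N + Suc m) = - s"
      by (simp add: s_def)
    moreover have "int N - int (Suc m) + 2 = d - 1"
      by (simp add: d_def)
    ultimately have "G N (Suc m) = - 2 * (2 * n + 3) * of_nat (Suc m) ^ 3 * (- s) * ((n + x + 1) * f) *
        ((n - x + 2) * R) * b (Suc m)"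
      using \<open>of_int d = n - x + 2\<close> by (simp only: G_def r1 n_def[symmetric])
    also have "\<dots> = s * f * R * (2 * of_nat (Suc m) ^ 3 * b (Suc m)) * ((2 * n + 3) * ((n + x + 1) * (n - x + 2)))"
      by (simp only: minus_mult_minus mult_minus_left mult_minus_right minus_minus mult_ac)
    also have "\<dots> = c * ((2 * n + 3) * ((n + x + 1) * (n - x + 2) * (2 * x + 1)))"
      unfolding b_Suc by (simp only: c_def x_def mult_ac)
    finally have G1: "G N (Suc m) = c * ((2 * n + 3) * ((n + x + 1) * (n - x + 2) * (2 * x + 1)))" .
    have G0: "G N m = - (c * (2 * (2 * n + 3) * x ^ 3))"
      by (simp only: G_def s_def f_def R_def d_def c_def n_def x_def mult_minus_left mult_minus_right mult_ac)
    have poly: "(n + 2) ^ 2 * ((n + x + 2) * (n + x + 1)) - (n + 1) ^ 2 * ((n - x + 1) * (n - x + 2)) =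
        (2 * n + 3) * ((n + x + 1) * (n - x + 2) * (2 * x + 1)) + 2 * (2 * n + 3) * x ^ 3"
      by (simp add: power2_eq_square power3_eq_cube algebra_simps)
    have "of_nat (N + 2) = n + 2" "of_nat (N + 1) = n + 1"
      by (simp_all add: n_def)
    then have "of_nat (N + 2) ^ 2 * t (N + 2) m - of_nat (N + 1) ^ 2 * t N m =
        c * ((n + 2) ^ 2 * ((n + x + 2) * (n + x + 1)) - (n + 1) ^ 2 * ((n - x + 1) * (n - x + 2)))"
      by (simp only: t2 t0 right_diff_distrib mult.left_commute)
    also have "\<dots> = G N (Suc m) - G N m"
      unfolding poly G1 G0 by (simp only: distrib_left diff_minus_eq_add)
    finally show ?thesis .
  qed
  define S where "S N = (\<Sum>m\<le>N. t N m)" for N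
  \<comment> \<open>Terms beyond the range vanish through \<open>inv_fact\<close>, so the sums for
    \<open>N\<close> and \<open>N + 2\<close> can share one range of summation.\<close>
  have S_ext: "(\<Sum>m<K. t N m) = S N" if "K > N" for N K
    unfolding S_def using that
    by (intro sum.mono_neutral_right) (auto simp: t_def inv_fact_def)
  have S_rec: "of_nat (N + 2) ^ 2 * S (N + 2) = of_nat (N + 1) ^ 2 * S N" for N
  proof -
    have "of_nat (N + 2) ^ 2 * S (N + 2) - of_nat (N + 1) ^ 2 * S N =
      (\<Sum>m<N+3. of_nat (N + 2) ^ 2 * t (N + 2) m - of_nat (N + 1) ^ 2 * t N m)"
      using S_ext[of "N + 2" "N + 3"] S_ext[of N "N + 3"]
      by (simp only: sum_subtractf sum_distrib_left[symmetric])
    also have "\<dots> = G N (N + 3) - G N 0"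
      unfolding certificate by (rule sum_lessThan_telescope)
    \<comment> \<open>At \<open>N + 3\<close> the argument of \<open>inv_fact\<close> is -1.\<close>
    also have "\<dots> = 0"
      by (simp add: G_def inv_fact_def)
    finally show ?thesis by simp
  qed
  \<comment> \<open>In steps of two the recurrence is that of \<open>hyp_coeff\<close>, since (2n +
    1)^2 / (2n + 2)^2 = (n + 1/2)^2 / (n + 1)^2; the odd sums stay at their initial value 0.\<close>
  have S_even: "S (2 * n) = hyp_coeff n" for n
  proof (induction n)
    case 0
    show ?case
      by (simp add: S_def t_def b_def inv_fact_def)
  next
    case (Suc n)
    have "of_nat (2 * n + 2) ^ 2 * S (2 * n + 2) = of_nat (2 * n + 1) ^ 2 * S (2 * n)"
      by (rule S_rec)
    also have "\<dots> = 4 * ((of_nat n + 1 / 2) ^ 2 * hyp_coeff n)"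
      unfolding Suc by (simp add: power2_eq_square field_simps)
    also have "\<dots> = of_nat (2 * n + 2) ^ 2 * hyp_coeff (Suc n)"
      unfolding hyp_coeff_Suc[symmetric] by (simp add: power2_eq_square field_simps)
    finally show ?case
      by (simp del: of_nat_add of_nat_Suc of_nat_mult)
  qed
  have S_odd: "S (2 * n + 1) = 0" for n
  proof (induction n)
    case 0
    have "hyp_coeff 1 = 1 / 4"
      using hyp_coeff_Suc[of 0] by (simp add: power2_eq_square)
    then show ?case
      by (simp add: S_def t_def b_def inv_fact_def fact_numeral)
  next
    case (Suc n)
    have "of_nat (2 * n + 1 + 2) ^ 2 * S (2 * n + 1 + 2) = 0"
      unfolding S_rec Suc by simp
    then show ?case
      by (simp del: of_nat_add of_nat_Suc of_nat_mult)
  qed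
  have "(\<Sum>m\<le>N. (-1) ^ (N + m) * of_nat ((N + m) choose (2 * m)) * 4 ^ m * hyp_coeff m) = S N"
    unfolding S_def
  proof (rule sum.cong)
    fix m assume "m \<in> {..N}"
    then have m: "m \<le> N" by simp
    then have "of_nat ((N + m) choose (2 * m)) = (fact (N + m) / (fact (2 * m) * fact (N - m)) :: complex)"
      by (subst binomial_fact) auto
    then show "(-1) ^ (N + m) * of_nat ((N + m) choose (2 * m)) * 4 ^ m * hyp_coeff m = t N m"
      using m by (simp add: t_def b_def inv_fact_def nat_diff_distrib field_simps)
  qed auto
  also have "S N = (if even N then hyp_coeff (N div 2) else 0)"
    using S_even S_odd by (auto elim!: evenE oddE)
  finally show ?thesis .
qed

text \<open>Landen's transformation for formal series. The m-th power of 4 X / (1 + X)^2 times 1 /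
  (1 + X) is 4^m X^m (1 + X)^(-2m - 1), whose coefficients are the binomial terms in
  \<open>landen_coeff_sum\<close>; that sum vanishes in odd degree.\<close>

lemma landen_fps:
  "(hyp_fps oo (4 * fps_X * inverse (1 + fps_X) ^ 2)) * inverse (1 + fps_X) = hyp_fps oo fps_X ^ 2"
proof (rule fps_ext)
  fix N
  define B where "B = (4 * fps_X * inverse (1 + fps_X) ^ 2 :: complex fps)"
  define C where "C = (inverse (1 + fps_X) :: complex fps)"
  have B: "B ^ i = fps_X ^ i * (fps_const (4 ^ i) * C ^ (2 * i))" for i
  proof -
    have "B = fps_X * (fps_const 4 * C ^ 2)"
      by (simp add: B_def C_def numeral_fps_const mult_ac)
    then show ?thesis
      by (simp add: power_mult_distrib power_mult fps_const_power)
  qed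
  have B0: "fps_nth (B ^ i) j = 0" if "j < i" for i j
    using that by (simp add: B fps_X_power_mult_nth)
  have BC: "fps_nth (B ^ i * C) N = 4 ^ i * (-1) ^ (N + i) * of_nat ((N + i) choose (2 * i))" if "i \<le> N" for i
  proof -
    have "B ^ i * C = fps_X ^ i * (fps_const (4 ^ i) * C ^ Suc (2 * i))"
      by (simp add: B mult_ac)
    moreover have "(-1 :: complex) ^ (N - i) = (-1) ^ (N + i)"
      using that by (auto simp: minus_one_power_iff)
    moreover have "N - i + 2 * i = N + i"
      using that by simp
    ultimately show ?thesis
      using that unfolding C_def
      by (simp only: fps_X_power_mult_nth fps_mult_left_const_nth inverse_one_plus_X_power_nth) simp
  qed
  have "((hyp_fps oo B) * C) $ N = (\<Sum>j\<le>N. (\<Sum>i\<le>N. hyp_coeff i * (fps_nth (B ^ i) j)) * fps_nth C (N - j))"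
    unfolding fps_mult_nth fps_compose_nth atLeast0AtMost hyp_fps_nth
  proof (rule sum.cong[OF refl])
    fix j assume "j \<in> {..N}"
    then have "(\<Sum>i\<le>j. hyp_coeff i * fps_nth (B ^ i) j) = (\<Sum>i\<le>N. hyp_coeff i * fps_nth (B ^ i) j)"
      by (intro sum.mono_neutral_left) (auto simp: B0)
    then show "(\<Sum>i\<le>j. hyp_coeff i * fps_nth (B ^ i) j) * fps_nth C (N - j) =
        (\<Sum>i\<le>N. hyp_coeff i * fps_nth (B ^ i) j) * fps_nth C (N - j)"
      by (simp only:)
  qed
  also have "\<dots> = (\<Sum>i\<le>N. hyp_coeff i * fps_nth (B ^ i * C) N)"
    unfolding fps_mult_nth sum_distrib_right sum_distrib_left atLeast0AtMost
    by (subst sum.swap) (simp only: mult.assoc)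
  also have "\<dots> = (\<Sum>m\<le>N. (-1) ^ (N + m) * of_nat ((N + m) choose (2 * m)) * 4 ^ m * hyp_coeff m)"
  proof (rule sum.cong[OF refl])
    fix m assume "m \<in> {..N}"
    then have "hyp_coeff m * fps_nth (B ^ m * C) N =
        hyp_coeff m * (4 ^ m * (-1) ^ (N + m) * of_nat ((N + m) choose (2 * m)))"
      using BC[of m] by simp
    then show "hyp_coeff m * fps_nth (B ^ m * C) N =
        (-1) ^ (N + m) * of_nat ((N + m) choose (2 * m)) * 4 ^ m * hyp_coeff m"
      by (simp only: mult_ac)
  qed
  also have "\<dots> = (if even N then hyp_coeff (N div 2) else 0)"
    by (rule landen_coeff_sum)
  also have "\<dots> = (hyp_fps oo fps_X ^ 2) $ N"
  proof -
    have "(hyp_fps oo fps_X ^ 2) $ N = (\<Sum>i\<le>N. if N = 2 * i then hyp_coeff i else 0)"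
      unfolding fps_compose_nth atLeast0AtMost power_mult[symmetric]
      by (intro sum.cong refl) (simp)
    also have "\<dots> = (\<Sum>i\<le>N. if i = N div 2 then (if even N then hyp_coeff i else 0) else 0)"
      by (intro sum.cong refl) (auto)
    also have "\<dots> = (if even N then hyp_coeff (N div 2) else 0)"
      by (subst sum.delta) (auto)
    finally show ?thesis by simp
  qed
  finally show "((hyp_fps oo (4 * fps_X * inverse (1 + fps_X) ^ 2)) * inverse (1 + fps_X)) $ N =
      (hyp_fps oo fps_X ^ 2) $ N"
    unfolding B_def C_def .
qed

section \<open>The hypergeometric function as an analytic function\<close>

abbreviation (input) hyp2F1_half :: "complex \<Rightarrow> complex" where
  "hyp2F1_half \<equiv> hyp2F1 (1 / 2) (1 / 2) 1"

lemma hyp2F1_half_eq: "hyp2F1_half = eval_fps hyp_fps"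
proof -
  have "fps_hypergeo [1 / 2, 1 / 2] [1] 1 = hyp_fps"
    by (rule fps_ext) (simp add: hyp_coeff_def power2_eq_square pochhammer_fact[symmetric])
  then show ?thesis
    by (simp add: hyp2F1_def[abs_def])
qed

lemma hyp2F1_half_0 [simp]: "hyp2F1_half 0 = 1"
  by (simp add: hyp2F1_half_eq eval_fps_at_0)

lemma holomorphic_on_hyp2F1_half: "hyp2F1_half holomorphic_on ball 0 1"
  unfolding hyp2F1_half_eq
proof (rule holomorphic_on_eval_fps)
  show "ball (0 :: complex) 1 \<subseteq> eball 0 (fps_conv_radius hyp_fps)"
  proof
    fix z :: complex assume "z \<in> ball 0 1"
    then have "ereal (norm z) < 1"
      by simp
    then have "ereal (norm z) < fps_conv_radius hyp_fps"
      using fps_conv_radius_hyp_fps by (rule order_less_le_trans)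
    then show "z \<in> eball 0 (fps_conv_radius hyp_fps)"
      by (simp add: in_eball_iff)
  qed
qed

text \<open>The neighbourhood of 0 is left unspecified because the modulus to which this is applied
  tends to 0 at infinity in the upper half-plane; no domain for 4 k / (1 + k)^2 has to be worked
  out.\<close>

lemma hyp2F1_half_landen:
  "\<forall>\<^sub>F k in nhds 0. hyp2F1_half (4 * k / (1 + k) ^ 2) = (1 + k) * hyp2F1_half (k ^ 2)"
proof -
  have expansion: "hyp2F1_half has_fps_expansion hyp_fps"
  proof -
    have "fps_conv_radius hyp_fps > 0"
      using fps_conv_radius_hyp_fps by (rule order_less_le_trans[rotated]) simp
    then show ?thesis
      unfolding hyp2F1_half_eq by (rule eval_fps_has_fps_expansion)
  qed
  have "(\<lambda>k. hyp2F1_half (4 * k * inverse (1 + k) ^ 2) * inverse (1 + k)) has_fps_expansion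
     ((hyp_fps oo (4 * fps_X * inverse (1 + fps_X) ^ 2)) * inverse (1 + fps_X))"
    by (intro fps_expansion_intros has_fps_expansion_compose[OF expansion, unfolded o_def]) auto
  moreover have "(\<lambda>k. hyp2F1_half (k ^ 2)) has_fps_expansion (hyp_fps oo fps_X ^ 2)"
    by (intro fps_expansion_intros has_fps_expansion_compose[OF expansion, unfolded o_def]) auto
  ultimately have "(\<lambda>k. hyp2F1_half (4 * k * inverse (1 + k) ^ 2) * inverse (1 + k) - hyp2F1_half (k ^ 2)) has_fps_expansion
      ((hyp_fps oo (4 * fps_X * inverse (1 + fps_X) ^ 2)) * inverse (1 + fps_X) - (hyp_fps oo fps_X ^ 2))"
    by (rule has_fps_expansion_diff)
  then have "\<forall>\<^sub>F k in nhds 0. hyp2F1_half (4 * k * inverse (1 + k) ^ 2) * inverse (1 + k) - hyp2F1_half (k ^ 2) = 0"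
    unfolding landen_fps diff_self by (simp add: has_fps_expansion_0_iff)
  moreover have "\<forall>\<^sub>F k in nhds (0 :: complex). k \<noteq> -1"
    by (rule t1_space_nhds) simp
  ultimately show ?thesis
  proof eventually_elim
    case (elim k)
    then have "1 + k \<noteq> 0"
      by (simp add: add_eq_0_iff)
    with elim show ?case
      by (simp add: field_simps)
  qed
qed

subsection \<open>Sums over lattices\<close>

lemma int_span_0 [simp]: "0 \<in> int_span w1 w2"
  unfolding int_span_def by (auto intro!: exI[of _ 0])

lemma int_span_gens [simp]: "w1 \<in> int_span w1 w2" "w2 \<in> int_span w1 w2"
proof -
  have "w1 = of_int 1 * w1 + of_int 0 * w2" "w2 = of_int 0 * w1 + of_int 1 * w2"
    by simp_all
  then show "w1 \<in> int_span w1 w2" "w2 \<in> int_span w1 w2"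
    unfolding int_span_def by blast+
qed

lemma int_span_uminus: "x \<in> int_span w1 w2 \<Longrightarrow> - x \<in> int_span w1 w2"
  unfolding int_span_def
proof clarify
  fix m n
  have "- (of_int m * w1 + of_int n * w2) = of_int (-m) * w1 + of_int (-n) * w2"
    by simp
  then show "\<exists>m' n'. - (of_int m * w1 + of_int n * w2) = of_int m' * w1 + of_int n' * w2 \<and> True"
    by blast
qed

lemma int_span_add: "x \<in> int_span w1 w2 \<Longrightarrow> y \<in> int_span w1 w2 \<Longrightarrow> x + y \<in> int_span w1 w2"
  unfolding int_span_def
proof clarify
  fix m n m' n'
  have "of_int m * w1 + of_int n * w2 + (of_int m' * w1 + of_int n' * w2) =
      of_int (m + m') * w1 + of_int (n + n') * w2"
    by (simp add: algebra_simps)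
  then show "\<exists>i j. of_int m * w1 + of_int n * w2 + (of_int m' * w1 + of_int n' * w2) = of_int i * w1 + of_int j * w2 \<and> True"
    by blast
qed

lemma int_span_uminus_iff [simp]: "- x \<in> int_span w1 w2 \<longleftrightarrow> x \<in> int_span w1 w2"
  using int_span_uminus[of x] int_span_uminus[of "-x"] by auto

lemma int_span_diff: "x \<in> int_span w1 w2 \<Longrightarrow> y \<in> int_span w1 w2 \<Longrightarrow> x - y \<in> int_span w1 w2"
  using int_span_add[of x w1 w2 "-y"] by simp

lemma int_span_add_iff: "w \<in> int_span w1 w2 \<Longrightarrow> x + w \<in> int_span w1 w2 \<longleftrightarrow> x \<in> int_span w1 w2"
  using int_span_add[of x w1 w2 w] int_span_diff[of "x + w" w1 w2 w] by auto

text \<open>Differentiating the symmetry at its fixed point h gives f'(h) = -f'(h). It serves for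
  even functions at 0 and for the Weierstrass function at half periods.\<close>

lemma deriv_zero_of_reflection:
  fixes f :: "complex \<Rightarrow> complex"
  assumes f: "f field_differentiable (at h)" and S: "open S" "h \<in> S"
    and sym: "\<And>z. z \<in> S \<Longrightarrow> f (2 * h - z) = f z"
  shows "deriv f h = 0"
proof -
  have D: "(f has_field_derivative deriv f h) (at h)"
    using f DERIV_deriv_iff_field_differentiable by blast
  have "((\<lambda>z. f (2 * h - z)) has_field_derivative deriv f h * (-1)) (at h)"
    by (rule DERIV_chain2[where f = f and g = "\<lambda>z. 2 * h - z"])
       (use D in \<open>auto intro!: derivative_eq_intros\<close>)
  then have "((\<lambda>z. f (2 * h - z)) has_field_derivative - deriv f h) (at h)"
    by simp
  then have "(f has_field_derivative - deriv f h) (at h)"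
    by (rule has_field_derivative_transform_within_open[OF _ S sym])
  from DERIV_unique[OF this D] show ?thesis
    by (simp add: equation_minus_iff)
qed

text \<open>z^2 h extends to 0 with value 0, and being even it also has derivative 0 there. So this
  zero is at least double, and dividing by z twice leaves a holomorphic function.\<close>

lemma even_removable_singularity:
  fixes h :: "complex \<Rightarrow> complex"
  assumes r: "r > 0" and h: "h holomorphic_on ball 0 r - {0}"
    and even: "\<And>z. h (- z) = h z" and lim: "((\<lambda>z. z ^ 2 * h z) \<longlongrightarrow> 0) (at 0)"
  obtains g where "g holomorphic_on ball 0 r" "\<And>z. z \<in> ball 0 r - {0} \<Longrightarrow> g z = h z"
proof -
  define k where "k z = (if z = 0 then 0 else z ^ 2 * h z)" for z
  have k: "k holomorphic_on ball 0 r"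
  proof (rule no_isolated_singularity'[where K = "{0}"])
    have "((\<lambda>z. z ^ 2 * h z) \<longlongrightarrow> k 0) (at 0 within ball 0 r)"
      using lim unfolding k_def by (auto intro: tendsto_within_subset)
    then have "(k \<longlongrightarrow> k 0) (at 0 within ball 0 r)"
      by (rule Lim_transform_eventually) (auto simp: eventually_at_filter k_def)
    then show "\<And>z. z \<in> {0} \<Longrightarrow> (k \<longlongrightarrow> k z) (at z within ball 0 r)"
      by auto
    have "(\<lambda>z. z ^ 2 * h z) holomorphic_on ball 0 r - {0}"
      by (intro holomorphic_intros h)
    then show "k holomorphic_on ball 0 r - {0}"
      by (rule holomorphic_transform) (auto simp: k_def)
  qed auto
  have "deriv k 0 = 0"
  proof (rule deriv_zero_of_reflection[of _ _ "ball 0 r"])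
    show "k field_differentiable at 0"
      using k r by (auto intro: holomorphic_on_imp_differentiable_at)
  qed (use r in \<open>auto simp: k_def even\<close>)
  define k1 where "k1 z = z * h z" for z
  have k1: "k1 holomorphic_on ball 0 r"
    by (rule pole_theorem_open_0[OF k, of 0])
       (auto simp: k_def k1_def \<open>deriv k 0 = 0\<close> power2_eq_square)
  define g where "g z = (if z = 0 then deriv k1 0 else h z)" for z
  have "g holomorphic_on ball 0 r"
    by (rule pole_theorem_open_0[OF k1, of 0]) (auto simp: k1_def g_def)
  then show ?thesis
    by (rule that) (auto simp: g_def)
qed

text \<open>For w = m + n tau, Im w = n Im tau bounds n in terms of |w|, and then m = w - n tau is
  bounded too; \<open>K\<close> collects the two constants.\<close>

lemma lattice_coeff_bound:
  assumes "Im \<tau> > 0"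
  obtains K where "K > 0" "\<And>m n. \<bar>of_int m\<bar> + \<bar>of_int n\<bar> \<le> K * norm (of_int m + of_int n * \<tau>)"
proof -
  define K where "K = 1 + (1 + norm \<tau>) / Im \<tau>"
  have "\<bar>of_int m\<bar> + \<bar>of_int n\<bar> \<le> K * norm (of_int m + of_int n * \<tau>)" for m n :: int
  proof -
    let ?w = "of_int m + of_int n * \<tau>"
    have "\<bar>of_int n\<bar> * Im \<tau> = \<bar>Im ?w\<bar>"
      using assms by (simp add: abs_mult)
    also have "\<dots> \<le> norm ?w"
      by (rule abs_Im_le_cmod)
    finally have n: "\<bar>of_int n\<bar> \<le> norm ?w / Im \<tau>"
      using assms by (simp add: field_simps)
    have "\<bar>of_int m :: real\<bar> = norm (?w - of_int n * \<tau>)"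
      by simp
    also have "\<dots> \<le> norm ?w + \<bar>of_int n\<bar> * norm \<tau>"
      by (metis norm_triangle_ineq4 norm_mult norm_of_int)
    also have "\<bar>of_int n\<bar> * norm \<tau> \<le> norm ?w / Im \<tau> * norm \<tau>"
      using n by (rule mult_right_mono) simp
    finally have "\<bar>of_int m\<bar> + \<bar>of_int n\<bar> \<le> norm ?w + norm ?w / Im \<tau> * norm \<tau> + norm ?w / Im \<tau>"
      using n by linarith
    also have "\<dots> = K * norm ?w"
      by (simp add: K_def algebra_simps add_divide_distrib)
    finally show ?thesis .
  qed
  moreover have "K > 0"
    unfolding K_def using assms by (intro add_pos_nonneg divide_nonneg_pos) auto
  ultimately show ?thesis
    using that by blast
qed

lemma lattice_norm_bound:
  assumes "Im \<tau> > 0"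
  obtains c where "c > 0" "\<And>w. w \<in> int_span 1 \<tau> - {0} \<Longrightarrow> norm w \<ge> c"
proof -
  obtain K where K: "K > 0" "\<And>m n. \<bar>of_int m\<bar> + \<bar>of_int n\<bar> \<le> K * norm (of_int m + of_int n * \<tau>)"
    using lattice_coeff_bound[OF assms] by blast
  have "norm w \<ge> 1 / K" if wL: "w \<in> int_span 1 \<tau> - {0}" for w
  proof -
    obtain m n where w: "w = of_int m + of_int n * \<tau>"
      using wL by (auto simp: int_span_def)
    then have "m \<noteq> 0 \<or> n \<noteq> 0"
      using wL by auto
    then have "1 \<le> \<bar>of_int m\<bar> + \<bar>of_int n :: real\<bar>"
      by linarith
    also have "\<dots> \<le> K * norm w"
      using K(2) w by simp
    finally show ?thesis
      using K(1) by (simp add: field_simps)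
  qed
  then show ?thesis
    using that[of "1 / K"] K(1) by simp
qed

lemma closed_lattice:
  assumes "Im \<tau> > 0"
  shows "closed (int_span 1 \<tau>)"
proof -
  obtain c where c: "c > 0" "\<And>w. w \<in> int_span 1 \<tau> - {0} \<Longrightarrow> norm w \<ge> c"
    using lattice_norm_bound[OF assms] by blast
  show ?thesis
  proof (rule discrete_imp_closed[OF c(1)], intro ballI impI)
    fix x y assume xy: "x \<in> int_span 1 \<tau>" "y \<in> int_span 1 \<tau>" "dist y x < c"
    show "y = x"
    proof (rule ccontr)
      assume "y \<noteq> x"
      then have "y - x \<in> int_span 1 \<tau> - {0}"
        using xy int_span_diff by auto
      from c(2)[OF this] xy(3) show False
        by (simp add: dist_norm)
    qed
  qed
qed

text \<open>Both coefficients of w are at most K |w|, so (K |w|)^3 dominates |m|^(3/2) |n|^(3/2).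
  This splits the double sum into two single sums with exponent 3/2 > 1.\<close>

lemma summable_lattice_cubes:
  assumes "Im \<tau> > 0"
  shows "(\<lambda>w. 1 / norm w ^ 3) summable_on (int_span 1 \<tau> - {0})"
proof -
  obtain K where K: "K > 0" "\<And>m n. \<bar>of_int m\<bar> + \<bar>of_int n\<bar> \<le> K * norm (of_int m + of_int n * \<tau>)"
    using lattice_coeff_bound[OF assms] by metis
  \<comment> \<open>The maximum with 1 gives a zero coefficient the weight 1; the power alone would
    be 0 there, and the product no majorant.\<close>
  define h :: "nat \<Rightarrow> real" where "h n = (max 1 (real n)) powr (- 3 / 2)" for n
  have "summable h"
  proof (subst summable_cong)
    show "\<forall>\<^sub>F n in sequentially. h n = real n powr (- 3 / 2)"
      using eventually_ge_at_top[of 1] by eventually_elim (auto simp: h_def max_def)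
    show "summable (\<lambda>n. real n powr (- 3 / 2))"
      by (subst summable_real_powr_iff) auto
  qed
  moreover have "h n \<ge> 0" for n
    by (simp add: h_def)
  ultimately have h: "(\<lambda>j::int. h (nat \<bar>j\<bar>)) summable_on UNIV"
    by (intro summable_on_int_abs)
  then have h': "((\<lambda>j::int. h (nat \<bar>j\<bar>)) has_sum infsum (\<lambda>j. h (nat \<bar>j\<bar>)) UNIV) UNIV"
      "(\<lambda>j::int. norm (h (nat \<bar>j\<bar>))) summable_on UNIV"
    by (auto simp: h_def)
  have "(\<lambda>(m::int, n::int). h (nat \<bar>m\<bar>) * h (nat \<bar>n\<bar>)) summable_on UNIV"
    using has_sum_mult_Times[OF h' h'] unfolding UNIV_Times_UNIV by (rule has_sum_imp_summable)
  then have "(\<lambda>p::int\<times>int. K ^ 3 * (case p of (m, n) \<Rightarrow> h (nat \<bar>m\<bar>) * h (nat \<bar>n\<bar>))) summable_on UNIV"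
    by (rule summable_on_cmult_right)
  then have s: "(\<lambda>p::int\<times>int. K ^ 3 * (case p of (m, n) \<Rightarrow> h (nat \<bar>m\<bar>) * h (nat \<bar>n\<bar>))) summable_on (UNIV - {(0,0)})"
    by (rule summable_on_subset) auto
  define \<phi> where "\<phi> p = of_int (fst p) + of_int (snd p) * \<tau>" for p :: "int \<times> int"
  have "(\<lambda>p. 1 / norm (\<phi> p) ^ 3) summable_on (UNIV - {(0,0)})"
  proof (rule summable_on_comparison_test[OF s])
    fix p :: "int \<times> int" assume "p \<in> UNIV - {(0,0)}"
    then obtain m n where p: "p = (m, n)" "m \<noteq> 0 \<or> n \<noteq> 0"
      by (cases p) auto
    define u where "u = max 1 \<bar>real_of_int m\<bar>"
    define v where "v = max 1 \<bar>real_of_int n\<bar>"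
    define x where "x = norm (\<phi> p)"
    have uv: "u \<ge> 1" "v \<ge> 1"
      by (auto simp: u_def v_def)
    have "u \<le> K * x" "v \<le> K * x"
      using K(2)[of m n] p(2) unfolding u_def v_def x_def p(1) \<phi>_def by auto
    then have "(u powr (1/2) * v powr (1/2)) ^ 3 \<le> ((K * x) powr (1/2) * (K * x) powr (1/2)) ^ 3"
      using uv by (intro power_mono mult_mono powr_mono2) auto
    also have "(K * x) powr (1/2) * (K * x) powr (1/2) = K * x"
      using \<open>u \<le> K * x\<close> uv by (simp add: powr_add[symmetric])
    also have "(u powr (1/2) * v powr (1/2)) ^ 3 = u powr (3/2) * v powr (3/2)"
      using uv by (simp add: power_mult_distrib powr_power)
    finally have le: "u powr (3/2) * v powr (3/2) \<le> K ^ 3 * x ^ 3"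
      by (simp add: power_mult_distrib)
    have "x > 0"
      using \<open>u \<le> K * x\<close> uv K(1) by (smt (verit) mult_nonneg_nonpos)
    have "1 / x ^ 3 \<le> K ^ 3 * (1 / (u powr (3/2) * v powr (3/2)))"
      using le \<open>x > 0\<close> uv by (simp add: field_simps)
    also have "1 / (u powr (3/2) * v powr (3/2)) = h (nat \<bar>m\<bar>) * h (nat \<bar>n\<bar>)"
      by (simp add: h_def u_def v_def powr_minus field_simps)
    finally show "1 / norm (\<phi> p) ^ 3 \<le> K ^ 3 * (case p of (m, n) \<Rightarrow> h (nat \<bar>m\<bar>) * h (nat \<bar>n\<bar>))"
      by (simp add: p x_def)
  qed auto
  moreover have "inj_on \<phi> (UNIV - {(0,0)})"
  proof (rule inj_onI)
    fix p r :: "int \<times> int" assume eq: "\<phi> p = \<phi> r"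
    have "of_int (fst p - fst r) + of_int (snd p - snd r) * \<tau> = 0"
      using eq by (simp add: \<phi>_def algebra_simps)
    then have "\<bar>real_of_int (fst p - fst r)\<bar> + \<bar>real_of_int (snd p - snd r)\<bar> \<le> 0"
      using K(2)[of "fst p - fst r" "snd p - snd r"] by (metis mult_zero_right norm_zero)
    then show "p = r"
      by (auto simp: prod_eq_iff)
  qed
  ultimately have "(\<lambda>w. 1 / norm w ^ 3) summable_on (\<phi> ` (UNIV - {(0,0)}))"
    by (subst summable_on_reindex) (auto simp: o_def)
  also have "\<phi> ` (UNIV - {(0,0)}) = int_span 1 \<tau> - {0}"
  proof -
    have nz: "\<phi> p \<noteq> 0" if "p \<noteq> (0, 0)" for p
    proof
      assume "\<phi> p = 0"
      with K(2)[of "fst p" "snd p"] have "\<bar>real_of_int (fst p)\<bar> + \<bar>real_of_int (snd p)\<bar> \<le> 0"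
        by (simp add: \<phi>_def)
      then show False
        using that by (auto simp: prod_eq_iff)
    qed
    have mem: "\<phi> p \<in> int_span 1 \<tau>" for p
      unfolding int_span_def mem_Collect_eq \<phi>_def by (intro exI[of _ "fst p"] exI[of _ "snd p"]) simp
    show ?thesis
    proof (intro equalityI image_subsetI)
      fix p :: "int \<times> int" assume "p \<in> UNIV - {(0,0)}"
      then show "\<phi> p \<in> int_span 1 \<tau> - {0}"
        using nz[of p] mem[of p] by simp
    next
      show "int_span 1 \<tau> - {0} \<subseteq> \<phi> ` (UNIV - {(0,0)})"
      proof
        fix w assume w: "w \<in> int_span 1 \<tau> - {0}"
        then obtain m n where mn: "w = of_int m * 1 + of_int n * \<tau>"
          by (auto simp: int_span_def)
        show "w \<in> \<phi> ` (UNIV - {(0,0)})"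
          by (rule image_eqI[of _ _ "(m, n)"]) (use w mn in \<open>auto simp: \<phi>_def\<close>)
      qed
    qed
  qed
  finally show ?thesis .
qed

text \<open>Each term is z (2 w - z) / ((z - w)^2 w^2), hence of order |w|^(-3) uniformly on
  \<open>B\<close>. The set \<open>B\<close> and the distance constant are left free, for a small
  ball off the lattice and for one around 0, where the principal part has been removed.\<close>

lemma lattice_sum_holomorphic:
  fixes M :: "complex set"
  assumes summable: "(\<lambda>w. 1 / norm w ^ 3) summable_on M"
    and c: "c > 0" "\<And>w. w \<in> M \<Longrightarrow> norm w \<ge> c"
    and B: "open B" "\<And>z. z \<in> B \<Longrightarrow> norm z \<le> R"
    and \<delta>: "\<delta> > 0" "\<And>z w. z \<in> B \<Longrightarrow> w \<in> M \<Longrightarrow> norm (z - w) \<ge> \<delta> * norm w"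
  shows "z \<in> B \<Longrightarrow> (\<lambda>w. 1 / (z - w) ^ 2 - 1 / w ^ 2) summable_on M"
    and "(\<lambda>z. \<Sum>\<^sub>\<infinity>w\<in>M. 1 / (z - w) ^ 2 - 1 / w ^ 2) holomorphic_on B"
proof -
  define C where "C = R * (2 + R / c) / \<delta> ^ 2"
  have bound: "norm (1 / (z - w) ^ 2 - 1 / w ^ 2) \<le> C * (1 / norm w ^ 3)" if z: "z \<in> B" and w: "w \<in> M" for z w
  proof -
    have R: "R \<ge> 0"
      using B(2)[OF z] norm_ge_zero order_trans by blast
    have w0: "norm w > 0"
      using c(1) c(2)[OF w] by linarith
    then have zw: "norm (z - w) > 0"
      using \<delta>(1) \<delta>(2)[OF z w] by (smt (verit) mult_pos_pos)
    have "1 / (z - w) ^ 2 - 1 / w ^ 2 = z * (2 * w - z) / ((z - w) ^ 2 * w ^ 2)"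
      using w0 zw by (simp add: divide_simps) (simp add: power2_eq_square algebra_simps)
    also have "norm \<dots> = norm z * norm (2 * w - z) / (norm (z - w) ^ 2 * norm w ^ 2)"
      by (simp add: norm_mult norm_divide norm_power)
    also have "\<dots> \<le> R * (norm w * (2 + R / c)) / ((\<delta> * norm w) ^ 2 * norm w ^ 2)"
    proof (intro frac_le mult_mono)
      have "norm (2 * w - z) \<le> 2 * norm w + norm z"
        using norm_triangle_ineq4[of "2 * w" z] by (simp add: norm_mult)
      also have "norm z \<le> R"
        by (rule B(2)[OF z])
      also have "R \<le> norm w * (R / c)"
        using mult_right_mono[OF c(2)[OF w], of "R / c"] c(1) R by simp
      finally show "norm (2 * w - z) \<le> norm w * (2 + R / c)"
        by (simp add: algebra_simps)
      show "(\<delta> * norm w) ^ 2 \<le> norm (z - w) ^ 2"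
        using \<delta> z w by (intro power_mono) auto
    qed (use B(2)[OF z] R \<delta> w0 c(1) in auto)
    also have "\<dots> = C * (1 / norm w ^ 3)"
      using w0 \<delta>(1) by (simp add: C_def power2_eq_square power3_eq_cube field_simps)
    finally show ?thesis .
  qed
  have s: "(\<lambda>w. C * (1 / norm w ^ 3)) summable_on M"
    using summable by (rule summable_on_cmult_right)
  show "(\<lambda>w. 1 / (z - w) ^ 2 - 1 / w ^ 2) summable_on M" if "z \<in> B"
    using bound[OF that] by (intro abs_summable_summable[OF summable_on_comparison_test[OF s]]) auto
  have unif: "uniform_limit B (\<lambda>X z. \<Sum>w\<in>X. 1 / (z - w) ^ 2 - 1 / w ^ 2)
      (\<lambda>z. \<Sum>\<^sub>\<infinity>w\<in>M. 1 / (z - w) ^ 2 - 1 / w ^ 2) (finite_subsets_at_top M)"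
    using bound s by (intro Weierstrass_m_test_general) auto
  show "(\<lambda>z. \<Sum>\<^sub>\<infinity>w\<in>M. 1 / (z - w) ^ 2 - 1 / w ^ 2) holomorphic_on B"
  proof (subst holomorphic_on_open[OF B(1)], clarify)
    fix z assume "z \<in> B"
    then obtain r where r: "r > 0" "cball z r \<subseteq> B"
      using B(1) open_contains_cball by blast
    have "(\<lambda>z. \<Sum>\<^sub>\<infinity>w\<in>M. 1 / (z - w) ^ 2 - 1 / w ^ 2) holomorphic_on ball z r"
    proof (rule holomorphic_uniform_limit)
      show "\<forall>\<^sub>F X in finite_subsets_at_top M. continuous_on (cball z r) (\<lambda>z. \<Sum>w\<in>X. 1 / (z - w) ^ 2 - 1 / w ^ 2) \<and>
         (\<lambda>z. \<Sum>w\<in>X. 1 / (z - w) ^ 2 - 1 / w ^ 2) holomorphic_on ball z r"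
      proof (rule eventually_finite_subsets_at_top_weakI)
        fix X assume X: "finite X" "X \<subseteq> M"
        have "z' - w \<noteq> 0" if "z' \<in> cball z r" "w \<in> X" for z' w
        proof -
          have "norm w > 0"
            using c(1) c(2)[of w] that X by force
          then show ?thesis
            using \<delta>(1) \<delta>(2)[of z' w] that X r by (smt (verit) mult_pos_pos norm_zero subset_iff)
        qed
        then have "(\<lambda>z. \<Sum>w\<in>X. 1 / (z - w) ^ 2 - 1 / w ^ 2) holomorphic_on cball z r"
          by (intro holomorphic_intros) auto
        then show "continuous_on (cball z r) (\<lambda>z. \<Sum>w\<in>X. 1 / (z - w) ^ 2 - 1 / w ^ 2) \<and>
         (\<lambda>z. \<Sum>w\<in>X. 1 / (z - w) ^ 2 - 1 / w ^ 2) holomorphic_on ball z r"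
          by (auto intro: holomorphic_on_imp_continuous_on holomorphic_on_subset)
      qed
      show "uniform_limit (cball z r) (\<lambda>X z. \<Sum>w\<in>X. 1 / (z - w) ^ 2 - 1 / w ^ 2)
        (\<lambda>z. \<Sum>\<^sub>\<infinity>w\<in>M. 1 / (z - w) ^ 2 - 1 / w ^ 2) (finite_subsets_at_top M)"
        using unif r(2) by (rule uniform_limit_on_subset)
    qed auto
    then show "\<exists>f'. ((\<lambda>z. \<Sum>\<^sub>\<infinity>w\<in>M. 1 / (z - w) ^ 2 - 1 / w ^ 2) has_field_derivative f') (at z)"
      using r(1) holomorphic_on_imp_differentiable_at[of _ "ball z r" z]
      by (auto simp: field_differentiable_def)
  qed
qed

subsection \<open>The Weierstrass function\<close>

lemma weierstrass_p_near:
  assumes \<tau>: "Im \<tau> > 0" and z: "z \<notin> int_span 1 \<tau>"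
  shows "(\<lambda>w. 1 / (z - w) ^ 2 - 1 / w ^ 2) summable_on int_span 1 \<tau> - {0}"
    and "weierstrass_p (int_span 1 \<tau>) field_differentiable at z"
proof -
  let ?L = "int_span 1 \<tau>"
  obtain c where c: "c > 0" "\<And>w. w \<in> ?L - {0} \<Longrightarrow> norm w \<ge> c"
    using lattice_norm_bound[OF \<tau>] by blast
  have "open (- ?L)"
    using closed_lattice[OF \<tau>] by (simp add: open_closed)
  then obtain r where r: "r > 0" "ball z r \<subseteq> - ?L"
    using z open_contains_ball by (metis ComplI)
  define \<rho> where "\<rho> = r / 2"
  define R where "R = norm z + \<rho>"
  \<comment> \<open>For |w| >= 2 R the triangle inequality gives |z' - w| >= |w| / 2; the remaining
    w have |w| < 2 R and stay at distance at least \<rho> from z'.\<close>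
  define \<delta> where "\<delta> = min (1 / 2) (\<rho> / (2 * R))"
  have pos: "\<rho> > 0" "R > 0" "\<delta> > 0"
    using r(1) by (auto simp: \<rho>_def R_def \<delta>_def intro!: add_nonneg_pos divide_pos_pos mult_pos_pos)
  have B: "norm z' \<le> R" if "z' \<in> ball z \<rho>" for z'
    using that norm_triangle_ineq2[of z' z] by (simp add: R_def dist_norm norm_minus_commute)
  have \<delta>: "norm (z' - w) \<ge> \<delta> * norm w" if z': "z' \<in> ball z \<rho>" and w: "w \<in> ?L - {0}" for z' w
  proof (cases "norm w \<ge> 2 * R")
    case True
    have "norm w - norm z' \<le> norm (z' - w)"
      by (metis norm_minus_commute norm_triangle_ineq2)
    then have "norm (z' - w) \<ge> 1 / 2 * norm w"
      using B[OF z'] True by linarith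
    moreover have "\<delta> * norm w \<le> 1 / 2 * norm w"
      by (intro mult_right_mono) (auto simp: \<delta>_def)
    ultimately show ?thesis by linarith
  next
    case False
    have "dist z w \<ge> r"
      using w r(2) by (meson ComplD DiffD1 mem_ball not_le subsetD)
    moreover have "dist z w \<le> dist z z' + dist z' w"
      by (rule dist_triangle)
    ultimately have "norm (z' - w) \<ge> \<rho>"
      using z' unfolding \<rho>_def by (simp add: dist_norm)
    moreover have "\<delta> * norm w \<le> \<rho> / (2 * R) * (2 * R)"
      using False pos by (intro mult_mono) (auto simp: \<delta>_def)
    ultimately show ?thesis
      using pos by simp
  qed
  note * = lattice_sum_holomorphic[OF summable_lattice_cubes[OF \<tau>] c open_ball B pos(3) \<delta>]
  show "(\<lambda>w. 1 / (z - w) ^ 2 - 1 / w ^ 2) summable_on ?L - {0}"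
    by (rule *(1)) (use pos in auto)
  have "0 \<notin> ball z \<rho>"
    using r unfolding \<rho>_def
    by (metis ComplD dist_commute int_span_0 mem_ball r(2) subsetD field_sum_of_halves less_add_same_cancel1 half_gt_zero order_less_trans)
  then have "weierstrass_p ?L holomorphic_on ball z \<rho>"
    unfolding weierstrass_p_def by (intro holomorphic_intros *(2)) auto
  then show "weierstrass_p ?L field_differentiable at z"
    using pos by (auto intro: holomorphic_on_imp_differentiable_at)
qed

lemma weierstrass_p_pole:
  assumes \<tau>: "Im \<tau> > 0"
  shows "((\<lambda>z. z ^ 2 * weierstrass_p (int_span 1 \<tau>) z) \<longlongrightarrow> 1) (at 0)"
proof -
  let ?L = "int_span 1 \<tau>"
  obtain c where c: "c > 0" "\<And>w. w \<in> ?L - {0} \<Longrightarrow> norm w \<ge> c"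
    using lattice_norm_bound[OF \<tau>] by blast
  define g where "g z = (\<Sum>\<^sub>\<infinity>w\<in>?L - {0}. 1 / (z - w) ^ 2 - 1 / w ^ 2)" for z
  have \<delta>: "norm (z - w) \<ge> 1 / 2 * norm w" if "z \<in> ball 0 (c / 2)" "w \<in> ?L - {0}" for z w
    using c(2)[OF that(2)] that(1) norm_triangle_ineq2[of w z] by (simp add: norm_minus_commute)
  have "g holomorphic_on ball 0 (c / 2)"
    unfolding g_def
    by (rule lattice_sum_holomorphic(2)[OF summable_lattice_cubes[OF \<tau>] c open_ball _ _ \<delta>, where R = "c / 2"]) auto
  then have "continuous_on (ball 0 (c / 2)) g"
    by (rule holomorphic_on_imp_continuous_on)
  then have "isCont g 0"
    using c(1) by (simp add: continuous_on_eq_continuous_at)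
  then have "(g \<longlongrightarrow> g 0) (at 0)"
    by (simp add: isCont_def)
  then have "((\<lambda>z. 1 + z ^ 2 * g z) \<longlongrightarrow> 1 + 0 ^ 2 * g 0) (at 0)"
    by (intro tendsto_intros)
  then have "((\<lambda>z. 1 + z ^ 2 * g z) \<longlongrightarrow> 1) (at 0)"
    by simp
  then show ?thesis
    by (rule Lim_transform_eventually)
      (auto simp: eventually_at_filter weierstrass_p_def g_def field_simps)
qed

lemma weierstrass_p_even: "weierstrass_p (int_span w1 w2) (- z) = weierstrass_p (int_span w1 w2) z"
proof -
  have "(\<Sum>\<^sub>\<infinity>w\<in>int_span w1 w2 - {0}. 1 / (- z - w) ^ 2 - 1 / w ^ 2) =
        (\<Sum>\<^sub>\<infinity>w\<in>int_span w1 w2 - {0}. 1 / (z - w) ^ 2 - 1 / w ^ 2)"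
    by (rule infsum_reindex_bij_witness[of _ uminus uminus]) (auto simp: power2_eq_square algebra_simps)
  then show ?thesis
    by (simp add: weierstrass_p_def)
qed

text \<open>Because \<open>1 / 0 = 0\<close>, the term of \<open>w = 0\<close> in this sum is the principal part \<open>1 / z\<^sup>2\<close>.\<close>

lemma weierstrass_p_has_sum:
  assumes \<tau>: "Im \<tau> > 0" and z: "z \<notin> int_span 1 \<tau>"
  shows "((\<lambda>w. 1 / (z - w) ^ 2 - 1 / w ^ 2) has_sum weierstrass_p (int_span 1 \<tau>) z) (int_span 1 \<tau>)"
proof -
  let ?L = "int_span 1 \<tau>"
  have "((\<lambda>w. 1 / (z - w) ^ 2 - 1 / w ^ 2) has_sum
     (1 / (z - 0) ^ 2 - 1 / 0 ^ 2) + (\<Sum>\<^sub>\<infinity>w\<in>?L - {0}. 1 / (z - w) ^ 2 - 1 / w ^ 2)) (insert 0 (?L - {0}))"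
    by (intro has_sum_insert has_sum_infsum weierstrass_p_near(1) assms) auto
  moreover have "insert 0 (?L - {0}) = ?L"
    by auto
  ultimately show ?thesis
    by (simp add: weierstrass_p_def)
qed

text \<open>
  The difference \<open>wp (z + w0) - wp z\<close> is a lattice sum independent of \<open>z\<close>, and the
  substitution \<open>w \<mapsto> -w - w0\<close> changes its sign.
\<close>

lemma weierstrass_p_periodic:
  assumes \<tau>: "Im \<tau> > 0" and z: "z \<notin> int_span 1 \<tau>" and w0: "w0 \<in> int_span 1 \<tau>"
  shows "weierstrass_p (int_span 1 \<tau>) (z + w0) = weierstrass_p (int_span 1 \<tau>) z"
proof -
  let ?L = "int_span 1 \<tau>" and ?p = "weierstrass_p (int_span 1 \<tau>)"
  have z0: "z + w0 \<notin> ?L"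
    using z w0 by (simp add: int_span_add_iff)
  have 1: "((\<lambda>w. 1 / (z - w) ^ 2 - 1 / (w + w0) ^ 2) has_sum ?p (z + w0)) ?L"
    by (rule iffD1[OF has_sum_reindex_bij_witness[of _ "\<lambda>w. w + w0" "\<lambda>w. w - w0"] weierstrass_p_has_sum[OF \<tau> z0]])
       (auto simp: int_span_add_iff w0 int_span_diff algebra_simps)
  have 2: "((\<lambda>w. 1 / w ^ 2 - 1 / (w + w0) ^ 2) has_sum (?p (z + w0) - ?p z)) ?L"
    proof -
    have "((\<lambda>w. - (1 / (z - w) ^ 2 - 1 / w ^ 2)) has_sum (- ?p z)) ?L"
      using weierstrass_p_has_sum[OF \<tau> z] by (simp only: has_sum_uminus minus_minus)
    from has_sum_add[OF 1 this] show ?thesis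
      by simp
  qed
  have "((\<lambda>w. - (1 / w ^ 2 - 1 / (w + w0) ^ 2)) has_sum (?p (z + w0) - ?p z)) ?L"
    by (rule iffD1[OF has_sum_reindex_bij_witness[of _ "\<lambda>w. - w - w0" "\<lambda>w. - w - w0"] 2])
       (auto simp: int_span_diff w0 power2_eq_square algebra_simps)
  moreover have "((\<lambda>w. - (1 / w ^ 2 - 1 / (w + w0) ^ 2)) has_sum - (?p (z + w0) - ?p z)) ?L"
    using 2 by (simp only: has_sum_uminus minus_minus)
  ultimately have "?p (z + w0) - ?p z = - (?p (z + w0) - ?p z)"
    by (rule has_sum_unique)
  then show ?thesis
    by (simp add: equation_minus_iff)
qed

text \<open>Homogeneity of degree -2. It reduces the period lattice to Z + Z tau and compares this
  lattice with the one for -1/tau.\<close>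

lemma weierstrass_p_scale:
  assumes "c \<noteq> 0"
  shows "weierstrass_p (int_span (c * w1) (c * w2)) (c * z) = weierstrass_p (int_span w1 w2) z / c ^ 2"
proof -
  have mem: "c * w \<in> int_span (c * w1) (c * w2) \<longleftrightarrow> w \<in> int_span w1 w2" for w
  proof -
    have "c * w = of_int m * (c * w1) + of_int n * (c * w2) \<longleftrightarrow> w = of_int m * w1 + of_int n * w2" for m n
    proof -
      have "of_int m * (c * w1) + of_int n * (c * w2) = c * (of_int m * w1 + of_int n * w2)"
        by (simp add: algebra_simps)
      then show ?thesis
        using assms by simp
    qed
    then show ?thesis
      by (simp add: int_span_def)
  qed
  have "(\<Sum>\<^sub>\<infinity>w\<in>int_span (c * w1) (c * w2) - {0}. 1 / (c * z - w) ^ 2 - 1 / w ^ 2) =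
        (\<Sum>\<^sub>\<infinity>w\<in>int_span w1 w2 - {0}. (1 / (z - w) ^ 2 - 1 / w ^ 2) * (1 / c ^ 2))"
  proof (rule infsum_reindex_bij_witness[of _ "\<lambda>w. c * w" "\<lambda>w. w / c"])
    fix w assume "w \<in> int_span (c * w1) (c * w2) - {0}"
    then show "w / c \<in> int_span w1 w2 - {0}"
      using assms mem[of "w / c"] by simp
    have "c * z - w = c * (z - w / c)" "w = c * (w / c)"
      using assms by (simp_all add: algebra_simps)
    then show "(1 / (z - w / c) ^ 2 - 1 / (w / c) ^ 2) * (1 / c ^ 2) = 1 / (c * z - w) ^ 2 - 1 / w ^ 2"
      using assms by (simp add: power_mult_distrib power_divide diff_divide_distrib mult.commute)
  next
    fix w assume "w \<in> int_span w1 w2 - {0}"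
    then show "c * w \<in> int_span (c * w1) (c * w2) - {0}"
      using assms mem[of w] by simp
  qed (use assms in auto)
  also have "\<dots> = (\<Sum>\<^sub>\<infinity>w\<in>int_span w1 w2 - {0}. 1 / (z - w) ^ 2 - 1 / w ^ 2) * (1 / c ^ 2)"
    by (rule infsum_cmult_left')
  finally show ?thesis
    by (simp add: weierstrass_p_def power_mult_distrib add_divide_distrib mult.commute)
qed

subsection \<open>The Weierstrass function as a product\<close>

definition exp2pi :: "complex \<Rightarrow> complex" where
  "exp2pi z = exp (2 * of_real pi * \<i> * z)"

lemma exp2pi_simps [simp]: "exp2pi 0 = 1" "exp2pi z \<noteq> 0" "exp2pi (1 / 2) = -1"
proof -
  show "exp2pi (1 / 2) = -1"
    by (simp add: exp2pi_def)
qed (simp_all add: exp2pi_def)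

lemma exp2pi_add: "exp2pi (a + b) = exp2pi a * exp2pi b"
  by (simp add: exp2pi_def ring_distribs exp_add)

lemma exp2pi_minus: "exp2pi (- a) = inverse (exp2pi a)"
  by (simp add: exp2pi_def exp_minus)

lemma exp2pi_of_int [simp]: "exp2pi (of_int n) = 1"
  unfolding exp2pi_def using exp_eq_1 [of "2 * of_real pi * \<i> * of_int n"] by auto

lemma exp2pi_1 [simp]: "exp2pi 1 = 1"
  using exp2pi_of_int[of 1] by (simp del: exp2pi_of_int)

lemma exp2pi_eq_1_iff: "exp2pi z = 1 \<longleftrightarrow> (\<exists>n. z = of_int n)"
proof
  assume "exp2pi z = 1"
  then obtain n where n: "Im (2 * of_real pi * \<i> * z) = of_int (2 * n) * pi" "Re (2 * of_real pi * \<i> * z) = 0"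
    unfolding exp2pi_def exp_eq_1 by auto
  then have "Re z = of_int n" "Im z = 0"
    by auto
  then have "z = of_int n"
    by (simp add: complex_eq_iff)
  then show "\<exists>n. z = of_int n" ..
qed auto

lemma exp2pi_tau: "exp2pi \<tau> = nome \<tau> ^ 2"
  by (simp add: exp2pi_def nome_def exp_of_nat_mult[symmetric] mult_ac exp_double)

lemma holomorphic_on_exp2pi [holomorphic_intros]:
  "f holomorphic_on A \<Longrightarrow> (\<lambda>z. exp2pi (f z)) holomorphic_on A"
  unfolding exp2pi_def by (intro holomorphic_intros)

text \<open>The Weierstrass sigma function up to an exponential factor.\<close>

definition qsigma :: "complex \<Rightarrow> complex \<Rightarrow> complex" where
  "qsigma \<tau> z = qpoch (exp2pi z) (nome \<tau> ^ 2) * qpoch (nome \<tau> ^ 2 / exp2pi z) (nome \<tau> ^ 2)"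

lemma holomorphic_on_qsigma [holomorphic_intros]:
  assumes "Im \<tau> > 0" "f holomorphic_on A" "open A"
  shows "(\<lambda>z. qsigma \<tau> (f z)) holomorphic_on A"
  unfolding qsigma_def using assms by (intro holomorphic_intros) auto

lemma qsigma_plus_1: "qsigma \<tau> (z + 1) = qsigma \<tau> z"
  by (simp add: qsigma_def exp2pi_add)

text \<open>With x = exp2pi z, the shift replaces the factor 1 - x by 1 - 1/x = -(1 - x) / x and
  leaves the other factors alone.\<close>

lemma qsigma_plus_tau:
  assumes "Im \<tau> > 0"
  shows "qsigma \<tau> (z + \<tau>) = - qsigma \<tau> z / exp2pi z"
proof -
  define Q where "Q = nome \<tau> ^ 2"
  define x where "x = exp2pi z"
  have Q: "norm Q < 1" "Q \<noteq> 0" "x \<noteq> 0"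
    using assms by (auto simp: Q_def x_def)
  have t: "exp2pi \<tau> = Q"
    by (simp add: exp2pi_tau Q_def)
  have "qsigma \<tau> (z + \<tau>) = qpoch (x * Q) Q * qpoch (1 / x) Q"
    using Q by (simp add: qsigma_def exp2pi_add t Q_def[symmetric] x_def[symmetric])
  also have "qpoch (1 / x) Q = (1 - 1 / x) * qpoch (Q / x) Q"
    using qpoch_rec[OF Q(1), of "1 / x"] by simp
  also have "qpoch (x * Q) Q * ((1 - 1 / x) * qpoch (Q / x) Q) =
     - ((1 - x) * qpoch (x * Q) Q * qpoch (Q / x) Q) / x"
    using Q by (simp add: field_simps)
  also have "(1 - x) * qpoch (x * Q) Q = qpoch x Q"
    using qpoch_rec[OF Q(1), of x] by simp
  finally show ?thesis
    by (simp add: qsigma_def Q_def x_def)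
qed

lemma qsigma_uminus:
  assumes "Im \<tau> > 0"
  shows "qsigma \<tau> (- z) = - qsigma \<tau> z / exp2pi z"
proof -
  define Q where "Q = nome \<tau> ^ 2"
  define x where "x = exp2pi z"
  have Q: "norm Q < 1" "x \<noteq> 0"
    using assms by (auto simp: Q_def x_def)
  have "qsigma \<tau> (- z) = qpoch (1 / x) Q * qpoch (x * Q) Q"
    by (simp add: qsigma_def exp2pi_minus Q_def[symmetric] x_def[symmetric] field_simps)
  also have "qpoch (1 / x) Q = (1 - 1 / x) * qpoch (Q / x) Q"
    using qpoch_rec[OF Q(1), of "1 / x"] by simp
  also have "(1 - 1 / x) * qpoch (Q / x) Q * qpoch (x * Q) Q =
     - ((1 - x) * qpoch (x * Q) Q * qpoch (Q / x) Q) / x"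
    using Q by (simp add: field_simps)
  also have "(1 - x) * qpoch (x * Q) Q = qpoch x Q"
    using qpoch_rec[OF Q(1), of x] by simp
  finally show ?thesis
    by (simp add: qsigma_def Q_def x_def)
qed

text \<open>A factor vanishes only if exp2pi z is an integral power of exp2pi tau, that is, only at
  a lattice point.\<close>

lemma qsigma_nonzero:
  assumes "Im \<tau> > 0" "z \<notin> int_span 1 \<tau>"
  shows "qsigma \<tau> z \<noteq> 0"
proof -
  have Q: "norm (nome \<tau> ^ 2) < 1"
    using assms by simp
  have pow: "(nome \<tau> ^ 2) ^ n = exp2pi (of_nat n * \<tau>)" for n
    unfolding exp2pi_tau[symmetric] by (simp add: exp2pi_def exp_of_nat_mult[symmetric] mult_ac)
  have "qpoch (exp2pi z) (nome \<tau> ^ 2) \<noteq> 0"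
  proof (rule qpoch_nonzero[OF Q])
    fix n
    show "exp2pi z * (nome \<tau> ^ 2) ^ n \<noteq> 1"
    proof
      assume "exp2pi z * (nome \<tau> ^ 2) ^ n = 1"
      then obtain m where "z + of_nat n * \<tau> = of_int m"
        unfolding pow exp2pi_add[symmetric] exp2pi_eq_1_iff by blast
      then have "z = of_int m * 1 + of_int (- int n) * \<tau>"
        by (simp add: algebra_simps)
      then show False
        using assms(2) unfolding int_span_def by blast
    qed
  qed
  moreover have "qpoch (nome \<tau> ^ 2 / exp2pi z) (nome \<tau> ^ 2) \<noteq> 0"
  proof (rule qpoch_nonzero[OF Q])
    fix n
    show "nome \<tau> ^ 2 / exp2pi z * (nome \<tau> ^ 2) ^ n \<noteq> 1"
    proof
      assume "nome \<tau> ^ 2 / exp2pi z * (nome \<tau> ^ 2) ^ n = 1"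
      then have "exp2pi (- z) * (nome \<tau> ^ 2) ^ Suc n = 1"
        by (simp add: exp2pi_minus field_simps)
      then obtain m where "- z + of_nat (Suc n) * \<tau> = of_int m"
        unfolding pow exp2pi_add[symmetric] exp2pi_eq_1_iff by blast
      then have "z = of_int (- m) * 1 + of_int (int (Suc n)) * \<tau>"
        by (simp add: algebra_simps)
      then show False
        using assms(2) unfolding int_span_def by blast
    qed
  qed
  ultimately show ?thesis
    by (simp add: qsigma_def)
qed

lemma qsigma_0 [simp]: "Im \<tau> > 0 \<Longrightarrow> qsigma \<tau> 0 = 0"
  using qpoch_rec[of "nome \<tau> ^ 2" 1] by (simp add: qsigma_def)

text \<open>The constant is chosen to make the principal part at \<open>0\<close> equal to \<open>1 / z\<^sup>2\<close>.\<close>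

definition wp_quotient :: "complex \<Rightarrow> complex \<Rightarrow> complex" where
  "wp_quotient \<tau> z = - (of_real pi ^ 2 *
     (qpoch (nome \<tau> ^ 2) (nome \<tau> ^ 2) / qpoch (- (nome \<tau> ^ 2)) (nome \<tau> ^ 2)) ^ 4 *
     (qsigma \<tau> (z + 1 / 2) / qsigma \<tau> z) ^ 2)"

text \<open>Changing the sign of z divides both this function and, up to sign, \<open>qsigma\<close>
  by exp2pi z, so the square of their quotient is even.\<close>

lemma qsigma_half_shift_uminus:
  assumes "Im \<tau> > 0"
  shows "qsigma \<tau> (- z + 1 / 2) = qsigma \<tau> (z + 1 / 2) / exp2pi z"
proof -
  have "- z + 1 / 2 = - (z + 1 / 2) + 1"
    by simp
  then have "qsigma \<tau> (- z + 1 / 2) = qsigma \<tau> (- (z + 1 / 2))"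
    by (metis qsigma_plus_1)
  also have "\<dots> = qsigma \<tau> (z + 1 / 2) / exp2pi z"
    unfolding qsigma_uminus[OF assms] by (simp add: exp2pi_add)
  finally show ?thesis .
qed

lemma wp_quotient_uminus:
  assumes "Im \<tau> > 0"
  shows "wp_quotient \<tau> (- z) = wp_quotient \<tau> z"
  unfolding wp_quotient_def qsigma_half_shift_uminus[OF assms] qsigma_uminus[OF assms]
  by simp

lemma wp_quotient_plus_1: "wp_quotient \<tau> (z + 1) = wp_quotient \<tau> z"
proof -
  have "qsigma \<tau> (z + 1 + 1 / 2) = qsigma \<tau> (z + 1 / 2)"
    using qsigma_plus_1[of \<tau> "z + 1 / 2"] by (simp add: add_ac)
  then show ?thesis
    by (simp add: wp_quotient_def qsigma_plus_1)
qed

lemma wp_quotient_plus_tau: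
  assumes "Im \<tau> > 0"
  shows "wp_quotient \<tau> (z + \<tau>) = wp_quotient \<tau> z"
proof -
  have "qsigma \<tau> (z + \<tau> + 1 / 2) = qsigma \<tau> (z + 1 / 2) / exp2pi z"
    using qsigma_plus_tau[OF assms, of "z + 1 / 2"] by (simp add: exp2pi_add add_ac)
  then show ?thesis
    unfolding wp_quotient_def qsigma_plus_tau[OF assms] by simp
qed

lemma periodic_int_multiple:
  fixes f :: "complex \<Rightarrow> 'a"
  assumes "\<And>z. f (z + w) = f z"
  shows "f (z + of_int n * w) = f z"
proof (induction n rule: int_induct[where k = 0])
  case (step1 i)
  then show ?case
    using assms[of "z + of_int i * w"] by (simp add: ring_distribs add_ac)
next
  case (step2 i)
  then show ?case
    using assms[of "z + of_int (i - 1) * w"] by (simp add: ring_distribs add_ac)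
qed simp

lemma wp_quotient_periodic:
  assumes "Im \<tau> > 0" "w \<in> int_span 1 \<tau>"
  shows "wp_quotient \<tau> (z + w) = wp_quotient \<tau> z"
proof -
  obtain m n where w: "w = of_int m * 1 + of_int n * \<tau>"
    using assms(2) by (auto simp: int_span_def)
  have "wp_quotient \<tau> (z + w) = wp_quotient \<tau> (z + of_int m * 1 + of_int n * \<tau>)"
    by (simp add: w add_ac)
  also have "\<dots> = wp_quotient \<tau> (z + of_int m * 1)"
    by (rule periodic_int_multiple[where f = "wp_quotient \<tau>", OF wp_quotient_plus_tau[OF assms(1)]])
  also have "\<dots> = wp_quotient \<tau> z"
    by (rule periodic_int_multiple[where f = "wp_quotient \<tau>", OF wp_quotient_plus_1])
  finally show ?thesis .
qed

lemma wp_quotient_holomorphic: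
  assumes "Im \<tau> > 0"
  shows "wp_quotient \<tau> holomorphic_on - int_span 1 \<tau>"
proof -
  have "open (- int_span 1 \<tau>)"
    using closed_lattice[OF assms] by (simp add: open_closed)
  then show ?thesis
    unfolding wp_quotient_def
    by (intro holomorphic_intros assms) (auto simp: qsigma_nonzero[OF assms])
qed

text \<open>At 0, \<open>qsigma\<close> has a simple zero with slope -2 pi i P^2, and its half shift
  has the value 2 P'^2, where P = (Q; Q) and P' = (-Q; Q). The squared quotient of these numbers is
  -P'^4 / (pi^2 P^4), which the constant in \<open>wp_quotient\<close> cancels.\<close>

lemma wp_quotient_pole:
  assumes \<tau>: "Im \<tau> > 0"
  shows "((\<lambda>z. z ^ 2 * wp_quotient \<tau> z) \<longlongrightarrow> 1) (at 0)"
proof -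
  define Q where "Q = nome \<tau> ^ 2"
  have Q: "norm Q < 1"
    using \<tau> by (simp add: Q_def)
  define P where "P = qpoch Q Q"
  define P' where "P' = qpoch (- Q) Q"
  have nz: "P \<noteq> 0" "P' \<noteq> 0"
    using qpoch_nonzero'[OF Q Q] qpoch_nonzero'[OF Q, of "-Q"] Q by (simp_all add: P_def P'_def)
  define V where "V z = qpoch (exp2pi z * Q) Q * qpoch (Q / exp2pi z) Q" for z
  have V: "qsigma \<tau> z = (1 - exp2pi z) * V z" for z
    using qpoch_rec[OF Q, of "exp2pi z"] by (simp add: qsigma_def V_def Q_def)
  have lim_V: "V \<midarrow>0\<rightarrow> P ^ 2"
  proof -
    have "V holomorphic_on UNIV"
      unfolding V_def using Q by (intro holomorphic_intros) auto
    then have "isCont V 0"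
      by (auto intro!: field_differentiable_imp_continuous_at holomorphic_on_imp_differentiable_at[of _ UNIV])
    then have "V \<midarrow>0\<rightarrow> V 0"
      by (simp add: isCont_def)
    then show ?thesis
      by (simp add: V_def P_def power2_eq_square)
  qed
  have lim_U: "(\<lambda>z. qsigma \<tau> (z + 1 / 2)) \<midarrow>0\<rightarrow> 2 * P' ^ 2"
  proof -
    have "(\<lambda>z. qsigma \<tau> (z + 1 / 2)) holomorphic_on UNIV"
      using \<tau> by (intro holomorphic_intros) auto
    then have "isCont (\<lambda>z. qsigma \<tau> (z + 1 / 2)) 0"
      by (auto intro!: field_differentiable_imp_continuous_at holomorphic_on_imp_differentiable_at[of _ UNIV])
    then have "(\<lambda>z. qsigma \<tau> (z + 1 / 2)) \<midarrow>0\<rightarrow> qsigma \<tau> (0 + 1 / 2)"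
      by (simp add: isCont_def)
    moreover have "qsigma \<tau> (0 + 1 / 2) = 2 * P' ^ 2"
      using qpoch_rec[OF Q, of "-1"] by (simp add: qsigma_def P'_def flip: Q_def) (simp add: power2_eq_square)
    ultimately show ?thesis by simp
  qed
  have lim_exp2pi: "(\<lambda>z. (1 - exp2pi z) / z) \<midarrow>0\<rightarrow> - (2 * of_real pi * \<i>)"
  proof -
    have "((\<lambda>z. 1 - exp2pi z) has_field_derivative - (2 * of_real pi * \<i>)) (at 0)"
      unfolding exp2pi_def by (auto intro!: derivative_eq_intros)
    then show ?thesis
      by (simp add: has_field_derivative_iff)
  qed
  have "(\<lambda>z. - (of_real pi ^ 2 * (P / P') ^ 4 * (qsigma \<tau> (z + 1 / 2) / ((1 - exp2pi z) / z * V z)) ^ 2))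
      \<midarrow>0\<rightarrow> - (of_real pi ^ 2 * (P / P') ^ 4 * (2 * P' ^ 2 / (- (2 * of_real pi * \<i>) * P ^ 2)) ^ 2)"
    using nz by (intro tendsto_intros lim_U lim_exp2pi lim_V) auto
  also have "- (of_real pi ^ 2 * (P / P') ^ 4 * (2 * P' ^ 2 / (- (2 * of_real pi * \<i>) * P ^ 2)) ^ 2) = (1 :: complex)"
    using nz by (simp add: power_divide power_mult_distrib field_simps)
  finally show ?thesis
  proof (rule Lim_transform_eventually)
    show "\<forall>\<^sub>F z in at 0. - (of_real pi ^ 2 * (P / P') ^ 4 * (qsigma \<tau> (z + 1 / 2) / ((1 - exp2pi z) / z * V z)) ^ 2) =
        z ^ 2 * wp_quotient \<tau> z"
      unfolding eventually_at_filter
      by (intro always_eventually) (auto simp: wp_quotient_def V P_def P'_def Q_def power_mult_distrib power_divide)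
  qed
qed

text \<open>At 1/2 the numerator is \<open>qsigma\<close> at a lattice point. At the other two half
  periods exp2pi is q or -q, so the two products in \<open>qsigma\<close> coincide, and Euler's
  identity A B C = 1 turns a quotient such as P C / (A B) into P C^2, the product for
  theta_3.\<close>

lemma wp_quotient_half_periods:
  assumes \<tau>: "Im \<tau> > 0"
  shows "wp_quotient \<tau> (1 / 2) = 0"
    and "wp_quotient \<tau> (\<tau> / 2) = - (of_real pi ^ 2 * theta3 \<tau> ^ 4)"
    and "wp_quotient \<tau> ((1 + \<tau>) / 2) = - (of_real pi ^ 2 * theta4 \<tau> ^ 4)"
proof -
  define q where "q = nome \<tau>"
  define P where "P = qpoch (q ^ 2) (q ^ 2)"
  define A B C where "A = qpoch (-(q ^ 2)) (q ^ 2)" and "B = qpoch q (q ^ 2)" and "C = qpoch (-q) (q ^ 2)"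
  have ABC: "A * B * C = 1"
    unfolding A_def B_def C_def q_def using \<tau> by (intro qpoch_euler) auto
  then have nz: "A \<noteq> 0" "B \<noteq> 0" "C \<noteq> 0"
    by auto
  have "q \<noteq> 0"
    by (simp add: q_def)
  have exp2pi_half: "exp2pi (\<tau> / 2) = q"
    by (simp add: exp2pi_def q_def nome_def mult_ac)
  show "wp_quotient \<tau> (1 / 2) = 0"
    using qsigma_plus_1[of \<tau> 0] \<tau> by (simp add: wp_quotient_def)
  have s1: "qsigma \<tau> (\<tau> / 2) = B ^ 2"
    using \<open>q \<noteq> 0\<close> by (simp add: qsigma_def exp2pi_half q_def[symmetric] B_def power2_eq_square)
  have s2: "qsigma \<tau> (\<tau> / 2 + 1 / 2) = C ^ 2"
    using \<open>q \<noteq> 0\<close> by (simp add: qsigma_def exp2pi_add exp2pi_half q_def[symmetric] C_def power2_eq_square)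
  have s3: "qsigma \<tau> (\<tau> / 2 + 1 / 2 + 1 / 2) = B ^ 2"
    using qsigma_plus_1[of \<tau> "\<tau> / 2"] s1 by (simp add: add.assoc)
  have AB: "1 / (A * B) = C" and AC: "1 / (A * C) = B"
    using ABC nz by (simp_all add: field_simps)
  have "P / A * (C / B) = P * (1 / (A * B)) * C" "P / A * (B / C) = P * (1 / (A * C)) * B"
    by simp_all
  then have "P / A * (C / B) = P * C ^ 2" "P / A * (B / C) = P * B ^ 2"
    unfolding AB AC by (simp_all add: power2_eq_square)
  then have *: "(P / A) ^ 4 * (C / B) ^ 4 = (P * C ^ 2) ^ 4" "(P / A) ^ 4 * (B / C) ^ 4 = (P * B ^ 2) ^ 4"
    by (simp_all only: power_mult_distrib[symmetric])
  have **: "(x ^ 2 / y ^ 2) ^ 2 = (x / y) ^ 4" for x y :: complex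
    by (simp add: power_divide)
  show "wp_quotient \<tau> (\<tau> / 2) = - (of_real pi ^ 2 * theta3 \<tau> ^ 4)"
    unfolding wp_quotient_def s1 s2 ** theta3_product[OF \<tau>] q_def[symmetric] A_def[symmetric] P_def[symmetric]
      C_def[symmetric] mult.assoc * ..
  have "(1 + \<tau>) / 2 = \<tau> / 2 + 1 / 2"
    by (simp add: field_simps)
  then show "wp_quotient \<tau> ((1 + \<tau>) / 2) = - (of_real pi ^ 2 * theta4 \<tau> ^ 4)"
    unfolding wp_quotient_def s2 s3 ** theta4_product[OF \<tau>] q_def[symmetric] A_def[symmetric] P_def[symmetric]
      B_def[symmetric] mult.assoc by (simp only: s2 s3 ** * mult.assoc)
qed

text \<open>
  Both functions are even with principal part \<open>1 / z\<^sup>2\<close>, so their difference extends to an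
  entire doubly periodic function.
\<close>

lemma weierstrass_p_eq_quotient:
  assumes \<tau>: "Im \<tau> > 0"
  obtains C where "\<And>z. z \<notin> int_span 1 \<tau> \<Longrightarrow> weierstrass_p (int_span 1 \<tau>) z = wp_quotient \<tau> z + C"
proof -
  let ?L = "int_span 1 \<tau>"
  define h where "h z = weierstrass_p ?L z - wp_quotient \<tau> z" for z
  have openL: "open (- ?L)"
    using closed_lattice[OF \<tau>] by (simp add: open_closed)
  have "weierstrass_p ?L holomorphic_on - ?L"
    using weierstrass_p_near(2)[OF \<tau>] openL
    by (auto simp: holomorphic_on_def intro: field_differentiable_at_within)
  then have h: "h holomorphic_on - ?L"
    unfolding h_def by (intro holomorphic_intros wp_quotient_holomorphic[OF \<tau>])
  obtain r where r: "r > 0" "\<And>w. w \<in> ?L - {0} \<Longrightarrow> norm w \<ge> r"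
    using lattice_norm_bound[OF \<tau>] by blast
  have ball: "ball 0 r - {0} \<subseteq> - ?L"
    using r(2) by force
  have "((\<lambda>z. z ^ 2 * weierstrass_p ?L z - z ^ 2 * wp_quotient \<tau> z) \<longlongrightarrow> 1 - 1) (at 0)"
    by (intro tendsto_diff weierstrass_p_pole wp_quotient_pole \<tau>)
  then have lim: "((\<lambda>z. z ^ 2 * h z) \<longlongrightarrow> 0) (at 0)"
    by (simp add: h_def right_diff_distrib)
  have even: "h (- z) = h z" for z
    by (simp add: h_def weierstrass_p_even wp_quotient_uminus[OF \<tau>])
  obtain g where g: "g holomorphic_on ball 0 r" "\<And>z. z \<in> ball 0 r - {0} \<Longrightarrow> g z = h z"
    using even_removable_singularity[OF r(1) holomorphic_on_subset[OF h ball] even lim] by blast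
  \<comment> \<open>Periodicity forces one common value, \<open>g 0\<close>, at all lattice
    points.\<close>
  define H where "H z = (if z \<in> ?L then g 0 else h z)" for z
  have per: "H (z + w) = H z" if "w \<in> ?L" for z w
    using that by (auto simp: H_def h_def int_span_add_iff weierstrass_p_periodic[OF \<tau>] wp_quotient_periodic[OF \<tau>])
  have "H holomorphic_on UNIV"
    unfolding holomorphic_on_def
  proof (intro ballI)
    fix z :: complex
    show "H field_differentiable at z"
    proof (cases "z \<in> ?L")
      case False
      have "H holomorphic_on - ?L"
        using h by (rule holomorphic_transform) (auto simp: H_def)
      then show ?thesis
        using openL False by (auto intro: holomorphic_on_imp_differentiable_at)
    next
      case True
      have "(\<lambda>x. g (x - z)) holomorphic_on ball z r"
        by (rule holomorphic_on_compose_gen[OF _ g(1), unfolded o_def])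
           (auto intro!: holomorphic_intros simp: dist_norm norm_minus_commute)
      moreover have "g (x - z) = H x" if x: "x \<in> ball z r" for x
      proof -
        have "H x = H (x - z)"
          using per[OF True, of "x - z"] by simp
        moreover have "x - z \<in> ball 0 r"
          using x by (simp add: dist_norm norm_minus_commute)
        ultimately show ?thesis
          using g(2)[of "x - z"] ball by (cases "x = z") (auto simp: H_def)
      qed
      ultimately have "H holomorphic_on ball z r"
        by (rule holomorphic_transform)
      then show ?thesis
        using r(1) by (auto intro: holomorphic_on_imp_differentiable_at)
    qed
  qed
  moreover have "bounded (range H)"
  proof -
    \<comment> \<open>The closed period parallelogram; \<open>H\<close> takes all its values
      there.\<close>
    define K where "K = (\<lambda>(a, b). of_real a + of_real b * \<tau>) ` ({0..1} \<times> {0..1})"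
    have "compact K"
      unfolding K_def
      by (intro compact_continuous_image compact_Times compact_Icc)
         (auto simp: case_prod_unfold intro!: continuous_intros)
    moreover have "continuous_on K H"
      using \<open>H holomorphic_on UNIV\<close> holomorphic_on_imp_continuous_on continuous_on_subset by blast
    ultimately have "bounded (H ` K)"
      by (intro compact_imp_bounded compact_continuous_image)
    moreover have "H z \<in> H ` K" for z
    proof -
      define b where "b = Im z / Im \<tau>"
      define a where "a = Re z - b * Re \<tau>"
      have z: "z = of_real a + of_real b * \<tau>"
        using \<tau> by (simp add: a_def b_def complex_eq_iff)
      define w where "w = of_int \<lfloor>a\<rfloor> * 1 + of_int \<lfloor>b\<rfloor> * \<tau>"
      have "w \<in> ?L"
        unfolding w_def int_span_def by blast
      have "z = (of_real (frac a) + of_real (frac b) * \<tau>) + w"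
        unfolding z w_def frac_def by (simp add: algebra_simps)
      then have "H z = H (of_real (frac a) + of_real (frac b) * \<tau>)"
        using per[OF \<open>w \<in> ?L\<close>] by simp
      moreover have "of_real (frac a) + of_real (frac b) * \<tau> \<in> K"
        unfolding K_def by (rule image_eqI[of _ _ "(frac a, frac b)"]) (auto simp: frac_lt_1 less_imp_le)
      ultimately show ?thesis
        by (metis image_eqI)
    qed
    ultimately show ?thesis
      by (meson bounded_subset image_subsetI)
  qed
  ultimately have "H constant_on UNIV"
    by (rule Liouville_theorem)
  then obtain C where C: "\<And>z. H z = C"
    unfolding constant_on_def by blast
  have "weierstrass_p ?L z = wp_quotient \<tau> z + C" if "z \<notin> ?L" for z
    using C[of z] that by (simp add: H_def h_def algebra_simps)
  then show ?thesis
    using that by blast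
qed

lemma half_periods_not_in_lattice:
  assumes "Im \<tau> > 0"
  shows "1 / 2 \<notin> int_span 1 \<tau>" "\<tau> / 2 \<notin> int_span 1 \<tau>" "(1 + \<tau>) / 2 \<notin> int_span 1 \<tau>"
proof -
  have *: "a = of_int m \<and> b = of_int n" if eq: "of_real a + of_real b * \<tau> = of_int m * 1 + of_int n * \<tau>" for a b m n
  proof -
    have "b * Im \<tau> = of_int n * Im \<tau>"
      using arg_cong[OF eq, of Im] by simp
    then have b: "b = of_int n"
      using assms by simp
    moreover have "a = of_int m"
      using arg_cong[OF eq, of Re] b by simp
    ultimately show ?thesis by simp
  qed
  have half: "1 / 2 \<noteq> (of_int n :: real)" for n
  proof
    assume "1 / 2 = (of_int n :: real)"
    then have "of_int (2 * n) = (of_int 1 :: real)"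
      by simp
    then have "2 * n = 1"
      by (simp only: of_int_eq_iff)
    then show False
      by presburger
  qed
  have nL: "of_real a + of_real b * \<tau> \<notin> int_span 1 \<tau>" if ab: "a = 1 / 2 \<or> b = 1 / 2" for a b
  proof
    assume "of_real a + of_real b * \<tau> \<in> int_span 1 \<tau>"
    then obtain m n where "of_real a + of_real b * \<tau> = of_int m * 1 + of_int n * \<tau>"
      unfolding int_span_def by blast
    from *[OF this] show False
      using ab half by auto
  qed
  show "1 / 2 \<notin> int_span 1 \<tau>"
    using nL[of "1 / 2" 0] by simp
  show "\<tau> / 2 \<notin> int_span 1 \<tau>"
    using nL[of 0 "1 / 2"] by simp
  show "(1 + \<tau>) / 2 \<notin> int_span 1 \<tau>"
    using nL[of "1 / 2" "1 / 2"] by (simp add: add_divide_distrib)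
qed

text \<open>The unknown additive constant drops out of the differences. The third is the difference
  of the first two, simplified by Jacobi's quartic identity.\<close>

theorem weierstrass_p_half_period_differences:
  assumes \<tau>: "Im \<tau> > 0"
  defines "p \<equiv> weierstrass_p (int_span 1 \<tau>)"
  shows "p (1 / 2) - p (\<tau> / 2) = of_real pi ^ 2 * theta3 \<tau> ^ 4"
    and "p (1 / 2) - p ((1 + \<tau>) / 2) = of_real pi ^ 2 * theta4 \<tau> ^ 4"
    and "p ((1 + \<tau>) / 2) - p (\<tau> / 2) = of_real pi ^ 2 * theta2 \<tau> ^ 4"
proof -
  obtain C where C: "\<And>z. z \<notin> int_span 1 \<tau> \<Longrightarrow> p z = wp_quotient \<tau> z + C"
    unfolding p_def using weierstrass_p_eq_quotient[OF \<tau>] by blast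
  note n = half_periods_not_in_lattice[OF \<tau>] and v = wp_quotient_half_periods[OF \<tau>]
  show 1: "p (1 / 2) - p (\<tau> / 2) = of_real pi ^ 2 * theta3 \<tau> ^ 4"
    using C[OF n(1)] C[OF n(2)] v by simp
  show 2: "p (1 / 2) - p ((1 + \<tau>) / 2) = of_real pi ^ 2 * theta4 \<tau> ^ 4"
    using C[OF n(1)] C[OF n(3)] v by simp
  have "p ((1 + \<tau>) / 2) - p (\<tau> / 2) = of_real pi ^ 2 * (theta3 \<tau> ^ 4 - theta4 \<tau> ^ 4)"
    using 1 2 by (simp add: right_diff_distrib algebra_simps)
  then show "p ((1 + \<tau>) / 2) - p (\<tau> / 2) = of_real pi ^ 2 * theta2 \<tau> ^ 4"
    using jacobi_quartic[OF \<tau>] by simp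
qed

subsection \<open>The modular transformations\<close>

lemma Im_neg_inverse_pos:
  assumes "Im \<tau> > 0"
  shows "Im (- 1 / \<tau>) > 0"
proof -
  have "Im (- 1 / \<tau>) = Im \<tau> / ((Re \<tau>)\<^sup>2 + (Im \<tau>)\<^sup>2)"
    by (simp add: Im_divide)
  also have "\<dots> > 0"
    using assms by (intro divide_pos_pos add_nonneg_pos) auto
  finally show ?thesis .
qed

text \<open>Let sigma = -1/tau. Multiplication by tau maps Z + Z sigma to Z + Z tau and, up to sign
  and periods, the half periods 1/2, sigma/2, (1 + sigma)/2 to tau/2, 1/2, (1 + tau)/2. By
  homogeneity the differences acquire the factor tau^2, and the exchange of half periods accounts
  for the minus sign and for theta_4.\<close>

lemma theta_inversion_pow4:
  assumes \<tau>: "Im \<tau> > 0"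
  shows "theta3 (- 1 / \<tau>) ^ 4 = - (\<tau> ^ 2 * theta3 \<tau> ^ 4)"
    and "theta2 (- 1 / \<tau>) ^ 4 = - (\<tau> ^ 2 * theta4 \<tau> ^ 4)"
proof -
  define \<sigma> where "\<sigma> = - 1 / \<tau>"
  have \<sigma>: "Im \<sigma> > 0"
    unfolding \<sigma>_def by (rule Im_neg_inverse_pos[OF \<tau>])
  have \<tau>0: "\<tau> \<noteq> 0"
    using \<tau> by auto
  define p where "p = weierstrass_p (int_span 1 \<tau>)"
  define p' where "p' = weierstrass_p (int_span 1 \<sigma>)"
  have "int_span (\<tau> * 1) (\<tau> * \<sigma>) = int_span 1 \<tau>"
  proof -
    have "(\<exists>m n. w = of_int m * \<tau> + of_int n * (- 1)) \<longleftrightarrow> (\<exists>m n. w = of_int m * 1 + of_int n * \<tau>)" for w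
    proof (intro iffI; elim exE)
      fix m n assume "w = of_int m * \<tau> + of_int n * (- 1)"
      then have "w = of_int (- n) * 1 + of_int m * \<tau>" by simp
      then show "\<exists>m n. w = of_int m * 1 + of_int n * \<tau>" by blast
    next
      fix m n assume "w = of_int m * 1 + of_int n * \<tau>"
      then have "w = of_int n * \<tau> + of_int (- m) * (- 1)" by simp
      then show "\<exists>m n. w = of_int m * \<tau> + of_int n * (- 1)" by blast
    qed
    moreover have "\<tau> * \<sigma> = - 1"
      using \<tau>0 by (simp add: \<sigma>_def)
    ultimately show ?thesis
      by (simp add: int_span_def)
  qed
  then have scale: "p' z = \<tau> ^ 2 * p (\<tau> * z)" for z
    using weierstrass_p_scale[OF \<tau>0, of 1 \<sigma> z] \<tau>0 by (simp add: p_def p'_def)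
  have v1: "p' (1 / 2) = \<tau> ^ 2 * p (\<tau> / 2)"
    by (simp add: scale)
  have "\<tau> * (\<sigma> / 2) = - (1 / 2)"
    using \<tau>0 by (simp add: \<sigma>_def)
  then have v3: "p' (\<sigma> / 2) = \<tau> ^ 2 * p (1 / 2)"
    unfolding scale p_def by (metis weierstrass_p_even)
  have "\<tau> * ((1 + \<sigma>) / 2) = (1 + \<tau>) / 2 + (- 1)"
    using \<tau>0 by (simp add: \<sigma>_def field_simps)
  moreover have "p ((1 + \<tau>) / 2 + (- 1)) = p ((1 + \<tau>) / 2)"
    unfolding p_def by (rule weierstrass_p_periodic[OF \<tau> half_periods_not_in_lattice(3)[OF \<tau>]]) simp
  ultimately have v2: "p' ((1 + \<sigma>) / 2) = \<tau> ^ 2 * p ((1 + \<tau>) / 2)"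
    by (simp only: scale)
  note d = weierstrass_p_half_period_differences[OF \<tau>, folded p_def]
    and d' = weierstrass_p_half_period_differences[OF \<sigma>, folded p'_def]
  have pi: "(of_real pi ^ 2 :: complex) \<noteq> 0"
    by simp
  have "of_real pi ^ 2 * theta3 \<sigma> ^ 4 = - (\<tau> ^ 2 * (p (1 / 2) - p (\<tau> / 2)))"
    unfolding d'(1)[symmetric] v1 v3 by (simp add: right_diff_distrib)
  also have "\<dots> = of_real pi ^ 2 * (- (\<tau> ^ 2 * theta3 \<tau> ^ 4))"
    unfolding d(1) by simp
  finally show "theta3 (- 1 / \<tau>) ^ 4 = - (\<tau> ^ 2 * theta3 \<tau> ^ 4)"
    unfolding \<sigma>_def[symmetric] mult_left_cancel[OF pi] .
  have "of_real pi ^ 2 * theta2 \<sigma> ^ 4 = - (\<tau> ^ 2 * (p (1 / 2) - p ((1 + \<tau>) / 2)))"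
    unfolding d'(3)[symmetric] v2 v3 by (simp add: right_diff_distrib)
  also have "\<dots> = of_real pi ^ 2 * (- (\<tau> ^ 2 * theta4 \<tau> ^ 4))"
    unfolding d(2) by simp
  finally show "theta2 (- 1 / \<tau>) ^ 4 = - (\<tau> ^ 2 * theta4 \<tau> ^ 4)"
    unfolding \<sigma>_def[symmetric] mult_left_cancel[OF pi] .
qed

text \<open>
  The fourth powers determine \<open>theta3 (- 1 / \<tau>) ^ 2\<close> up to a sign, which is constant on the
  upper half-plane and is found at the fixed point \<open>\<i>\<close>.
\<close>

lemma theta3_inversion:
  assumes \<tau>: "Im \<tau> > 0"
  shows "theta3 (- 1 / \<tau>) ^ 2 = - (\<i> * \<tau> * theta3 \<tau> ^ 2)"
proof -
  define R where "R z = theta3 (- 1 / z) ^ 2 / (- (\<i> * z * theta3 z ^ 2))" for z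
  let ?H = upper_half_plane
  have H: "z \<in> ?H \<longleftrightarrow> Im z > 0" for z
    by (simp add: upper_half_plane_def)
  have "(\<lambda>z. theta3 (- 1 / z)) holomorphic_on ?H"
    by (rule holomorphic_on_compose_gen[OF _ holomorphic_on_theta(2), unfolded o_def])
       (auto simp: H Im_neg_inverse_pos[simplified] intro!: holomorphic_intros)
  then have "R holomorphic_on ?H"
    unfolding R_def by (intro holomorphic_intros) (auto simp: H theta_nonzero)
  then have cont: "continuous_on ?H R"
    by (rule holomorphic_on_imp_continuous_on)
  have R: "R z = 1 \<or> R z = - 1" if "z \<in> ?H" for z
  proof -
    have z: "Im z > 0" "z \<noteq> 0"
      using that by (auto simp: H)
    have "R z ^ 2 = theta3 (- 1 / z) ^ 4 / (- (z ^ 2 * theta3 z ^ 4))"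
      by (simp add: R_def power_divide power_mult_distrib)
    also have "\<dots> = 1"
      unfolding theta_inversion_pow4(1)[OF z(1)] using z theta_nonzero[OF z(1)] by simp
    finally show ?thesis
      by (simp add: power2_eq_1_iff)
  qed
  have "finite (R ` ?H)"
    by (rule finite_subset[of _ "{1, -1}"]) (use R in auto)
  then obtain a where a: "\<And>z. z \<in> ?H \<Longrightarrow> R z = a"
    using continuous_finite_range_constant[OF convex_connected[OF convex_upper_half_plane] cont]
    unfolding constant_on_def by blast
  have "theta3 \<i> \<noteq> 0"
    by (rule theta_nonzero) simp
  then have "R \<i> = 1"
    by (simp add: R_def)
  then have "R \<tau> = 1"
    using a[of \<tau>] a[of \<i>] \<tau> by (simp add: H)
  moreover have "- (\<i> * \<tau> * theta3 \<tau> ^ 2) \<noteq> 0"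
    using \<tau> theta_nonzero[OF \<tau>] by auto
  ultimately show ?thesis
    by (simp only: R_def divide_eq_1_iff)
qed

section \<open>The modular lambda function\<close>

lemma one_minus_modular_lambda:
  assumes "Im \<tau> > 0"
  shows "1 - modular_lambda \<tau> = theta4 \<tau> ^ 4 / theta3 \<tau> ^ 4"
proof -
  have "1 - modular_lambda \<tau> = (theta3 \<tau> ^ 4 - theta2 \<tau> ^ 4) / theta3 \<tau> ^ 4"
    using theta_nonzero[OF assms] by (simp add: modular_lambda_def diff_divide_distrib)
  then show ?thesis
    using jacobi_quartic[OF assms] by simp
qed

lemma modular_lambda_nonzero: "Im \<tau> > 0 \<Longrightarrow> modular_lambda \<tau> \<noteq> 0"
  by (simp add: modular_lambda_def theta_nonzero)

lemma modular_lambda_inversion: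
  assumes "Im \<tau> > 0"
  shows "modular_lambda (- 1 / \<tau>) = 1 - modular_lambda \<tau>"
proof -
  have "\<tau> \<noteq> 0"
    using assms by auto
  then have "modular_lambda (- 1 / \<tau>) = theta4 \<tau> ^ 4 / theta3 \<tau> ^ 4"
    unfolding modular_lambda_def theta_inversion_pow4[OF assms] by simp
  then show ?thesis
    by (simp only: one_minus_modular_lambda[OF assms])
qed

lemma modular_lambda_plus_1:
  assumes "Im \<tau> > 0"
  shows "modular_lambda (\<tau> + 1) = - (theta2 \<tau> ^ 4 / theta4 \<tau> ^ 4)"
    and "modular_lambda (\<tau> + 1) = modular_lambda \<tau> / (modular_lambda \<tau> - 1)"
proof -
  show *: "modular_lambda (\<tau> + 1) = - (theta2 \<tau> ^ 4 / theta4 \<tau> ^ 4)"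
    unfolding modular_lambda_def theta2_plus_1_pow4[OF assms] theta4_def[symmetric] by simp
  have "modular_lambda \<tau> - 1 = - (theta4 \<tau> ^ 4 / theta3 \<tau> ^ 4)"
    using one_minus_modular_lambda[OF assms] by (simp add: algebra_simps)
  then show "modular_lambda (\<tau> + 1) = modular_lambda \<tau> / (modular_lambda \<tau> - 1)"
    unfolding * using theta_nonzero[OF assms] by (simp add: modular_lambda_def)
qed

lemma modular_lambda_plus_2:
  assumes "Im \<tau> > 0"
  shows "modular_lambda (\<tau> + 2) = modular_lambda \<tau>"
proof -
  have "theta2 (\<tau> + 2) ^ 4 = theta2 \<tau> ^ 4"
    using theta2_plus_1_pow4[of "\<tau> + 1"] theta2_plus_1_pow4[of \<tau>] assms by (simp add: add.assoc)
  then show ?thesis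
    by (simp add: modular_lambda_def theta3_plus_2[OF assms])
qed

lemma holomorphic_on_modular_lambda [holomorphic_intros]:
  "modular_lambda holomorphic_on upper_half_plane"
  unfolding modular_lambda_def[abs_def]
  by (intro holomorphic_intros) (auto simp: theta_nonzero upper_half_plane_def)

text \<open>The nome is a real number between 0 and 1 here. Positivity singles out the branch of the
  sixth root, and it gives the sign of lambda on the lines Re tau = 1 and Re tau = -1.\<close>

lemma theta_imaginary_axis:
  assumes "t > 0"
  shows "\<exists>r>0. theta2 (\<i> * of_real t) = of_real r" "\<exists>r>0. theta3 (\<i> * of_real t) = of_real r"
    "\<exists>r>0. theta4 (\<i> * of_real t) = of_real r" "\<exists>r>0. dedekind_eta (\<i> * of_real t) = of_real r"
proof -
  let ?\<tau> = "\<i> * of_real t"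
  define q where "q = exp (- pi * t)"
  have q: "0 < q" "q < 1"
    using assms by (auto simp: q_def)
  have nome: "nome ?\<tau> = of_real q"
    by (simp add: nome_def q_def exp_of_real[symmetric] mult_ac)
  have Im: "Im ?\<tau> > 0"
    using assms by simp
  have q2: "0 \<le> q ^ 2" "q ^ 2 < 1"
    using q by (auto simp: power_less_one_iff)
  obtain P where P: "P > 0" "qpoch (nome ?\<tau> ^ 2) (nome ?\<tau> ^ 2) = of_real P"
    using qpoch_real_pos[OF q2, of "q ^ 2"] q2 by (auto simp: nome)
  obtain A where A: "A > 0" "qpoch (- (nome ?\<tau> ^ 2)) (nome ?\<tau> ^ 2) = of_real A"
    using qpoch_real_pos[OF q2, of "- (q ^ 2)"] q2 by (auto simp: nome)
  obtain B where B: "B > 0" "qpoch (nome ?\<tau>) (nome ?\<tau> ^ 2) = of_real B"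
    using qpoch_real_pos[OF q2, of q] q by (auto simp: nome)
  obtain C where C: "C > 0" "qpoch (- nome ?\<tau>) (nome ?\<tau> ^ 2) = of_real C"
    using qpoch_real_pos[OF q2, of "- q"] q by (auto simp: nome)
  have e: "exp (of_real pi * \<i> * ?\<tau> / 4) = of_real (exp (- pi * t / 4))"
    by (simp add: exp_of_real[symmetric] mult_ac)
  have e': "exp (2 * of_real pi * \<i> * ?\<tau> / 24) = of_real (exp (- pi * t / 12))"
    by (simp add: exp_of_real[symmetric] mult_ac)
  show "\<exists>r>0. theta2 ?\<tau> = of_real r"
    unfolding theta2_product[OF Im] P A e using P(1) A(1)
    by (intro exI[of _ "2 * exp (- pi * t / 4) * P * A ^ 2"]) simp
  show "\<exists>r>0. theta3 ?\<tau> = of_real r"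
    unfolding theta3_product[OF Im] P C using P(1) C(1)
    by (intro exI[of _ "P * C ^ 2"]) simp
  show "\<exists>r>0. theta4 ?\<tau> = of_real r"
    unfolding theta4_product[OF Im] P B using P(1) B(1)
    by (intro exI[of _ "P * B ^ 2"]) simp
  have "exp (2 * of_real pi * \<i> * ?\<tau>) = nome ?\<tau> ^ 2"
    using exp2pi_tau[of ?\<tau>] by (simp add: exp2pi_def)
  then have "dedekind_eta ?\<tau> = exp (2 * of_real pi * \<i> * ?\<tau> / 24) * qpoch (nome ?\<tau> ^ 2) (nome ?\<tau> ^ 2)"
    by (simp add: dedekind_eta_def qpoch_def)
  then show "\<exists>r>0. dedekind_eta ?\<tau> = of_real r"
    unfolding P e' using P(1)
    by (intro exI[of _ "exp (- pi * t / 12) * P"]) simp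
qed

subsection \<open>Behaviour at the cusps\<close>

text \<open>The imaginary part alone grows, with no bound on the real part: eventual statements hold
  on a whole half-plane.\<close>

abbreviation at_i_infinity :: "complex filter" where
  "at_i_infinity \<equiv> filtercomap Im at_top"

lemma eventually_at_i_infinity: "eventually P at_i_infinity \<longleftrightarrow> (\<exists>C. \<forall>z. Im z \<ge> C \<longrightarrow> P z)"
  by (simp add: eventually_filtercomap_at_top_linorder)

lemma eventually_at_i_infinity_Im_gt: "\<forall>\<^sub>F z in at_i_infinity. Im z > c"
  unfolding eventually_at_i_infinity by (rule exI[of _ "c + 1"]) auto

lemma tendsto_exp_at_i_infinity:
  assumes "c > 0"
  shows "((\<lambda>z. exp (of_real c * \<i> * z)) \<longlongrightarrow> 0) at_i_infinity"
proof (rule tendsto_norm_zero_cancel)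
  have "filterlim (\<lambda>z. c * Im z) at_top at_i_infinity"
    using assms by (intro filterlim_tendsto_pos_mult_at_top[OF tendsto_const] filterlim_filtercomap) auto
  then have "filterlim (\<lambda>z. - (c * Im z)) at_bot at_i_infinity"
    by (simp add: filterlim_uminus_at_top)
  then have "((\<lambda>z. exp (- (c * Im z))) \<longlongrightarrow> 0) at_i_infinity"
    by (rule filterlim_compose[OF exp_at_bot])
  then show "((\<lambda>z. norm (exp (of_real c * \<i> * z))) \<longlongrightarrow> 0) at_i_infinity"
    by (simp add: norm_exp_eq_Re)
qed

lemma nome_at_i_infinity: "(nome \<longlongrightarrow> 0) at_i_infinity"
  using tendsto_exp_at_i_infinity[of pi] by (simp add: nome_def[abs_def])

text \<open>The q-products are holomorphic functions of the nome on the unit disc, so their limits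
  are the values at nome 0.\<close>

lemma qpoch_nome_at_i_infinity:
  assumes f: "f holomorphic_on ball 0 1" and "f 0 = 0"
  shows "((\<lambda>\<tau>. qpoch (f (nome \<tau>)) (nome \<tau> ^ 2)) \<longlongrightarrow> 1) at_i_infinity"
proof -
  have "(\<lambda>q. qpoch (f q) (q ^ 2)) holomorphic_on ball 0 1"
    by (intro holomorphic_intros f) (auto intro: norm_square_less_1)
  then have "isCont (\<lambda>q. qpoch (f q) (q ^ 2)) 0"
    using holomorphic_on_imp_continuous_on continuous_on_eq_continuous_at[of "ball 0 1"] by force
  from isCont_tendsto_compose[OF this nome_at_i_infinity] show ?thesis
    by (simp add: assms(2))
qed

lemma theta3_at_i_infinity: "(theta3 \<longlongrightarrow> 1) at_i_infinity"
proof -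
  have "((\<lambda>\<tau>. qpoch (nome \<tau> ^ 2) (nome \<tau> ^ 2) * qpoch (- nome \<tau>) (nome \<tau> ^ 2) ^ 2) \<longlongrightarrow> 1 * 1 ^ 2) at_i_infinity"
    by (intro tendsto_mult tendsto_power qpoch_nome_at_i_infinity[of "\<lambda>q. q ^ 2"] qpoch_nome_at_i_infinity[of "\<lambda>q. - q"])
       (auto intro!: holomorphic_intros)
  then have "((\<lambda>\<tau>. qpoch (nome \<tau> ^ 2) (nome \<tau> ^ 2) * qpoch (- nome \<tau>) (nome \<tau> ^ 2) ^ 2) \<longlongrightarrow> 1) at_i_infinity"
    by simp
  then show ?thesis
    by (rule Lim_transform_eventually)
       (use eventually_at_i_infinity_Im_gt[of 0] in \<open>auto elim!: eventually_mono simp: theta3_product\<close>)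
qed

lemma theta2_at_i_infinity: "(theta2 \<longlongrightarrow> 0) at_i_infinity"
proof -
  have e: "((\<lambda>\<tau>. exp (of_real pi * \<i> * \<tau> / 4)) \<longlongrightarrow> 0) at_i_infinity"
    using tendsto_exp_at_i_infinity[of "pi / 4"] by (simp add: mult_ac)
  have "((\<lambda>\<tau>. 2 * exp (of_real pi * \<i> * \<tau> / 4) * qpoch (nome \<tau> ^ 2) (nome \<tau> ^ 2) *
      qpoch (- (nome \<tau> ^ 2)) (nome \<tau> ^ 2) ^ 2) \<longlongrightarrow> 2 * 0 * 1 * 1 ^ 2) at_i_infinity"
    by (intro tendsto_mult tendsto_power e tendsto_const
          qpoch_nome_at_i_infinity[of "\<lambda>q. q ^ 2"] qpoch_nome_at_i_infinity[of "\<lambda>q. - (q ^ 2)"])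
       (auto intro!: holomorphic_intros)
  then have "((\<lambda>\<tau>. 2 * exp (of_real pi * \<i> * \<tau> / 4) * qpoch (nome \<tau> ^ 2) (nome \<tau> ^ 2) *
      qpoch (- (nome \<tau> ^ 2)) (nome \<tau> ^ 2) ^ 2) \<longlongrightarrow> 0) at_i_infinity"
    by simp
  then show ?thesis
    by (rule Lim_transform_eventually)
       (use eventually_at_i_infinity_Im_gt[of 0] in \<open>auto elim!: eventually_mono simp: theta2_product\<close>)
qed

lemma modular_lambda_at_i_infinity: "(modular_lambda \<longlongrightarrow> 0) at_i_infinity"
proof -
  have "((\<lambda>\<tau>. theta2 \<tau> ^ 4 / theta3 \<tau> ^ 4) \<longlongrightarrow> 0 ^ 4 / 1 ^ 4) at_i_infinity"
    by (intro tendsto_intros theta2_at_i_infinity theta3_at_i_infinity) auto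
  then show ?thesis
    by (simp add: modular_lambda_def[abs_def])
qed

text \<open>Landen's transformation relates \<open>\<tau>\<close> to \<open>2 * \<tau>\<close>, and the ratio of the two sides tends to 1.\<close>

lemma theta3_eq_hypergeometric_at_i_infinity:
  "\<forall>\<^sub>F \<tau> in at_i_infinity. theta3 \<tau> ^ 2 = hyp2F1_half (modular_lambda \<tau>)"
proof -
  \<comment> \<open>The elliptic modulus, with k^2 = lambda. Duplication gives lambda(tau) = 4 k /
    (1 + k)^2 with k taken at 2 tau, which is the argument in Landen's transformation.\<close>
  define k where "k \<tau> = theta2 \<tau> ^ 2 / theta3 \<tau> ^ 2" for \<tau>
  define R where "R \<tau> = theta3 \<tau> ^ 2 / hyp2F1_half (modular_lambda \<tau>)" for \<tau>
  have "((\<lambda>\<tau>. theta2 \<tau> ^ 2 / theta3 \<tau> ^ 2) \<longlongrightarrow> 0 ^ 2 / 1 ^ 2) at_i_infinity"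
    by (intro tendsto_intros theta2_at_i_infinity theta3_at_i_infinity) auto
  then have k0: "(k \<longlongrightarrow> 0) at_i_infinity"
    by (simp add: k_def[abs_def])
  have double: "filterlim (\<lambda>z. 2 * z) at_i_infinity at_i_infinity"
    unfolding filterlim_filtercomap_iff o_def
    by (simp, intro filterlim_tendsto_pos_mult_at_top[OF tendsto_const] filterlim_filtercomap) auto
  have k2: "((\<lambda>\<tau>. k (2 * \<tau>)) \<longlongrightarrow> 0) at_i_infinity"
    by (rule filterlim_compose[OF k0 double])
  have cont: "isCont hyp2F1_half 0"
    using holomorphic_on_hyp2F1_half holomorphic_on_imp_continuous_on
      continuous_on_eq_continuous_at[of "ball 0 1"] by force
  have F1: "((\<lambda>\<tau>. hyp2F1_half (modular_lambda \<tau>)) \<longlongrightarrow> 1) at_i_infinity"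
    using isCont_tendsto_compose[OF cont modular_lambda_at_i_infinity] by simp
  have "\<forall>\<^sub>F \<tau> in at_i_infinity. hyp2F1_half (modular_lambda \<tau>) \<noteq> 0"
    using F1 by (rule tendsto_imp_eventually_ne) simp
  moreover have "\<forall>\<^sub>F \<tau> in at_i_infinity. hyp2F1_half (4 * k (2 * \<tau>) / (1 + k (2 * \<tau>)) ^ 2) =
      (1 + k (2 * \<tau>)) * hyp2F1_half (k (2 * \<tau>) ^ 2)"
    by (rule eventually_compose_filterlim[OF hyp2F1_half_landen k2])
  ultimately have "\<forall>\<^sub>F \<tau> in at_i_infinity. hyp2F1_half (modular_lambda \<tau>) \<noteq> 0 \<and>
     hyp2F1_half (4 * k (2 * \<tau>) / (1 + k (2 * \<tau>)) ^ 2) = (1 + k (2 * \<tau>)) * hyp2F1_half (k (2 * \<tau>) ^ 2) \<and> Im \<tau> > 0"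
    using eventually_at_i_infinity_Im_gt[of 0] by eventually_elim auto
  \<comment> \<open>One height \<open>C\<close> serves all conditions; as doubling raises the
    imaginary part, the step can be repeated indefinitely.\<close>
  then obtain C where C: "\<And>\<tau>. Im \<tau> \<ge> C \<Longrightarrow> hyp2F1_half (modular_lambda \<tau>) \<noteq> 0 \<and>
     hyp2F1_half (4 * k (2 * \<tau>) / (1 + k (2 * \<tau>)) ^ 2) = (1 + k (2 * \<tau>)) * hyp2F1_half (k (2 * \<tau>) ^ 2) \<and> Im \<tau> > 0"
    unfolding eventually_at_i_infinity by blast
  have step: "R (2 * \<tau>) = R \<tau>" if "Im \<tau> \<ge> C" for \<tau>
  proof -
    note C' = C[OF that]
    then have Im: "Im \<tau> > 0" "Im (2 * \<tau>) > 0"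
      by auto
    have nz: "theta3 (2 * \<tau>) \<noteq> 0" "theta3 \<tau> \<noteq> 0" "theta2 (2 * \<tau>) \<noteq> 0"
      using theta_nonzero Im by blast+
    have k1: "1 + k (2 * \<tau>) = theta3 \<tau> ^ 2 / theta3 (2 * \<tau>) ^ 2"
      unfolding theta3_duplication[OF Im(1)] k_def using nz by (simp add: field_simps)
    have "modular_lambda \<tau> = (theta2 \<tau> ^ 2 / theta3 \<tau> ^ 2) ^ 2"
      by (simp add: modular_lambda_def power_divide)
    also have "\<dots> = 4 * k (2 * \<tau>) / (1 + k (2 * \<tau>)) ^ 2"
    proof -
      have "(2 * a * b / c) ^ 2 = 4 * (a ^ 2 / b ^ 2) / (c / b ^ 2) ^ 2" if "b \<noteq> 0" "c \<noteq> 0" for a b c :: complex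
        using that by (simp add: field_simps power2_eq_square)
      from this[of "theta3 (2 * \<tau>)" "theta3 \<tau> ^ 2" "theta2 (2 * \<tau>)"] show ?thesis
        unfolding k1 theta2_duplication[OF Im(1)] unfolding k_def using nz by simp
    qed
    finally have lam: "modular_lambda \<tau> = 4 * k (2 * \<tau>) / (1 + k (2 * \<tau>)) ^ 2" .
    have lam2: "modular_lambda (2 * \<tau>) = k (2 * \<tau>) ^ 2"
      by (simp add: modular_lambda_def k_def power_divide)
    have eq: "hyp2F1_half (modular_lambda \<tau>) = theta3 \<tau> ^ 2 / theta3 (2 * \<tau>) ^ 2 * hyp2F1_half (modular_lambda (2 * \<tau>))"
      using C' unfolding lam2 k1[symmetric] lam by simp
    then have "hyp2F1_half (modular_lambda (2 * \<tau>)) \<noteq> 0"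
      using C' by auto
    then show ?thesis
      unfolding R_def eq using nz by simp
  qed
  have R_lim: "(R \<longlongrightarrow> 1) at_i_infinity"
    unfolding R_def[abs_def] using tendsto_divide[OF tendsto_power[OF theta3_at_i_infinity, of 2] F1] by simp
  have "theta3 \<tau> ^ 2 = hyp2F1_half (modular_lambda \<tau>)" if "Im \<tau> \<ge> C" for \<tau>
  proof -
    have pos: "Im \<tau> > 0"
      using C[OF that] by blast
    have Im_pow: "Im (2 ^ n * \<tau>) = 2 ^ n * Im \<tau>" for n
    proof -
      have "2 ^ n * \<tau> = of_real (2 ^ n) * \<tau>"
        by simp
      then show ?thesis
        by (simp only: Im_complex_of_real Re_complex_of_real times_complex.sel)
    qed
    have R_pow: "R (2 ^ n * \<tau>) = R \<tau>" for n
    proof (induction n)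
      case (Suc n)
      have "Im \<tau> \<le> 2 ^ n * Im \<tau>"
        using pos by simp
      then have "Im (2 ^ n * \<tau>) \<ge> C"
        using that Im_pow by simp
      from step[OF this] Suc show ?case
        by (simp add: mult.assoc)
    qed simp
    have "filterlim (\<lambda>n. 2 ^ n * \<tau>) at_i_infinity sequentially"
      unfolding filterlim_filtercomap_iff o_def
    proof -
      have "filterlim (\<lambda>n. 2 ^ n * Im \<tau>) at_top sequentially"
        using pos filterlim_realpow_sequentially_gt1[of "2 :: real"]
          filterlim_at_infinity_imp_norm_at_top[of "\<lambda>n. (2 :: real) ^ n" sequentially]
        by (intro filterlim_at_top_mult_tendsto_pos[OF tendsto_const]) auto
      then show "filterlim (\<lambda>n. Im (2 ^ n * \<tau>)) at_top sequentially"
        by (simp only: Im_pow)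
    qed
    from filterlim_compose[OF R_lim this] have "(\<lambda>n. R \<tau>) \<longlonglongrightarrow> 1"
      by (simp add: R_pow)
    then have "R \<tau> = 1"
      by (simp add: LIMSEQ_const_iff)
    then show ?thesis
      using C[OF that] by (simp add: R_def)
  qed
  then show ?thesis
    unfolding eventually_at_i_infinity by blast
qed

subsection \<open>Analytic continuation over the fundamental domain\<close>

text \<open>Squaring turns |2 tau - 1| >= 1 into Re tau <= |tau|^2, and |2 tau + 1| >= 1 into -Re
  tau <= |tau|^2. In this form inversion visibly exchanges the strip condition with the circle
  condition.\<close>

lemma Gamma2_domain_iff:
  "\<tau> \<in> Gamma2_domain \<longleftrightarrow> Im \<tau> > 0 \<and> \<bar>Re \<tau>\<bar> \<le> 1 \<and> \<bar>Re \<tau>\<bar> \<le> (Re \<tau>)\<^sup>2 + (Im \<tau>)\<^sup>2"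
proof -
  have 1: "1 \<le> norm z \<longleftrightarrow> 1 \<le> (Re z)\<^sup>2 + (Im z)\<^sup>2" for z
    unfolding cmod_power2[symmetric] using abs_le_square_iff[of 1 "norm z"] by simp
  show ?thesis
    unfolding Gamma2_domain_def upper_half_plane_def mem_Collect_eq 1
    by (auto simp: power2_eq_square algebra_simps abs_if)
qed

lemma Re_Im_neg_inverse:
  "Re (- 1 / z) = - Re z / ((Re z)\<^sup>2 + (Im z)\<^sup>2)" "Im (- 1 / z) = Im z / ((Re z)\<^sup>2 + (Im z)\<^sup>2)"
  by (simp_all add: Re_divide Im_divide)

lemma Gamma2_domain_neg_inverse:
  assumes "\<tau> \<in> Gamma2_domain"
  shows "- 1 / \<tau> \<in> Gamma2_domain"
proof -
  define n where "n = (Re \<tau>)\<^sup>2 + (Im \<tau>)\<^sup>2"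
  have \<tau>: "Im \<tau> > 0" "\<bar>Re \<tau>\<bar> \<le> 1" "\<bar>Re \<tau>\<bar> \<le> n"
    using assms by (auto simp: Gamma2_domain_iff n_def)
  have n: "n > 0"
    unfolding n_def using \<tau> by (intro add_nonneg_pos) auto
  have "(Re (- 1 / \<tau>))\<^sup>2 + (Im (- 1 / \<tau>))\<^sup>2 = n / n\<^sup>2"
    unfolding Re_Im_neg_inverse n_def[symmetric]
    by (simp add: power_divide add_divide_distrib[symmetric]) (simp add: n_def)
  also have "\<dots> = 1 / n"
    using n by (simp add: power2_eq_square)
  finally show ?thesis
    using \<tau> n Im_neg_inverse_pos[OF \<tau>(1)]
    unfolding Gamma2_domain_iff by (simp only: Re_Im_neg_inverse n_def[symmetric])
      (simp add: abs_divide divide_le_eq divide_right_mono)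
qed

text \<open>The modulus of 1/u tends to infinity while its real part stays bounded, so the imaginary
  part has to grow.\<close>

lemma neg_inverse_at_i_infinity:
  fixes u :: "nat \<Rightarrow> complex"
  assumes u: "u \<longlonglongrightarrow> 0" "\<And>n. Im (u n) > 0" and strip: "\<And>n. \<bar>Re (- 1 / u n)\<bar> \<le> 1"
  shows "filterlim (\<lambda>n. - 1 / u n) at_i_infinity sequentially"
  unfolding filterlim_filtercomap_iff o_def
proof (rule filterlim_at_top_mono)
  have u0: "u n \<noteq> 0" for n
    using u(2)[of n] by auto
  have "filterlim (\<lambda>n. norm (inverse (u n))) at_top sequentially"
    using u(1) u0
    by (intro filterlim_at_infinity_imp_norm_at_top filterlim_compose[OF filterlim_inverse_at_infinity] filterlim_atI) auto
  then show "filterlim (\<lambda>n. - 1 + norm (inverse (u n))) at_top sequentially"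
    by (rule filterlim_tendsto_add_at_top[OF tendsto_const])
  show "\<forall>\<^sub>F n in sequentially. - 1 + norm (inverse (u n)) \<le> Im (- 1 / u n)"
  proof (intro always_eventually allI)
    fix n
    have "norm (inverse (u n)) = norm (- 1 / u n)"
      by (simp add: norm_divide norm_inverse divide_inverse)
    also have "\<dots> \<le> \<bar>Re (- 1 / u n)\<bar> + \<bar>Im (- 1 / u n)\<bar>"
      by (rule cmod_le)
    also have "\<bar>Im (- 1 / u n)\<bar> = Im (- 1 / u n)"
      using Im_neg_inverse_pos[OF u(2)[of n]] by simp
    finally show "- 1 + norm (inverse (u n)) \<le> Im (- 1 / u n)"
      using strip[of n] by linarith
  qed
qed

text \<open>The bound on the real part confines the approach to the outside of the circles |2 tau -
  1| = 1 and |2 tau + 1| = 1, which inversion maps to the lines Re = -1 and Re = 1.\<close>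

lemma modular_lambda_cusp_0:
  fixes u :: "nat \<Rightarrow> complex"
  assumes u: "u \<longlonglongrightarrow> 0" "\<And>n. Im (u n) > 0" and strip: "\<And>n. \<bar>Re (- 1 / u n)\<bar> \<le> 1"
  shows "(\<lambda>n. modular_lambda (u n)) \<longlonglongrightarrow> 1"
proof -
  have "(\<lambda>n. 1 - modular_lambda (- 1 / u n)) \<longlonglongrightarrow> 1 - 0"
    by (intro tendsto_diff tendsto_const
          filterlim_compose[OF modular_lambda_at_i_infinity neg_inverse_at_i_infinity[OF assms]])
  moreover have "1 - modular_lambda (- 1 / u n) = modular_lambda (u n)" for n
    by (simp only: modular_lambda_inversion[OF u(2)]) simp
  ultimately show ?thesis
    by simp
qed

lemma abs_Re_neg_inverse_le_1:
  assumes "Im z > 0" "\<bar>Re z\<bar> \<le> (Re z)\<^sup>2 + (Im z)\<^sup>2"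
  shows "\<bar>Re (- 1 / z)\<bar> \<le> 1"
proof -
  have "(Re z)\<^sup>2 + (Im z)\<^sup>2 > 0"
    using assms(1) by (intro add_nonneg_pos) auto
  then show ?thesis
    unfolding Re_Im_neg_inverse using assms(2) by (simp add: abs_divide)
qed

text \<open>The formula lambda(u + 1) = lambda(u) / (lambda(u) - 1) has its pole at the value 1 that
  lambda(u) approaches. One value outside the unit disc is enough to contradict |lambda| <
  1.\<close>

lemma modular_lambda_cusp_1:
  fixes u :: "nat \<Rightarrow> complex"
  assumes u: "u \<longlonglongrightarrow> 0" "\<And>n. Im (u n) > 0" and strip: "\<And>n. \<bar>Re (- 1 / u n)\<bar> \<le> 1"
  shows "\<exists>n. norm (modular_lambda (u n + 1)) > 1"
proof -
  have "\<forall>\<^sub>F n in sequentially. dist (modular_lambda (u n)) 1 < 1 / 2"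
    by (rule tendstoD[OF modular_lambda_cusp_0[OF assms]]) simp
  then obtain n where n: "norm (modular_lambda (u n) - 1) < 1 / 2"
    unfolding eventually_sequentially dist_norm by blast
  define a where "a = modular_lambda (u n)"
  have "1 - a \<noteq> 0"
    unfolding a_def one_minus_modular_lambda[OF u(2)[of n]] using theta_nonzero[OF u(2)[of n]] by simp
  then have "a - 1 \<noteq> 0"
    by simp
  moreover have "norm (1 :: complex) \<le> norm a + norm (a - 1)"
    using norm_triangle_ineq4[of a "a - 1"] by simp
  ultimately have "norm (a / (a - 1)) > 1"
    using n unfolding a_def[symmetric] by (simp add: norm_divide less_divide_eq)
  then show ?thesis
    unfolding modular_lambda_plus_1(2)[OF u(2)] a_def by blast
qed

text \<open>Inversion maps the arcs to the lines Re = 1 and Re = -1, where lambda equals -theta_2^4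
  / theta_4^4 at a point of the imaginary axis and is therefore negative; inversion replaces lambda
  by 1 - lambda.\<close>

lemma modular_lambda_arc:
  assumes \<tau>: "Im \<tau> > 0" and arc: "\<bar>Re \<tau>\<bar> = (Re \<tau>)\<^sup>2 + (Im \<tau>)\<^sup>2"
  shows "norm (modular_lambda \<tau>) \<ge> 1"
proof -
  define y where "y = Im (- 1 / \<tau>)"
  have y: "y > 0"
    unfolding y_def by (rule Im_neg_inverse_pos[OF \<tau>])
  define v where "v = \<i> * of_real y"
  have v: "Im v > 0"
    using y by (simp add: v_def)
  have n: "(Re \<tau>)\<^sup>2 + (Im \<tau>)\<^sup>2 > 0"
    using \<tau> by (intro add_nonneg_pos) auto
  have "Re (- 1 / \<tau>) = - 1 \<or> Re (- 1 / \<tau>) = 1"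
    unfolding Re_Im_neg_inverse using arc n by (auto simp: abs_if field_simps split: if_splits)
  then have "- 1 / \<tau> = v + 1 \<or> - 1 / \<tau> + 2 = v + 1"
    by (auto simp: complex_eq_iff v_def y_def)
  then have "modular_lambda (- 1 / \<tau>) = modular_lambda (v + 1)"
    using modular_lambda_plus_2[OF Im_neg_inverse_pos[OF \<tau>]] by metis
  then have lam: "modular_lambda \<tau> = 1 + theta2 v ^ 4 / theta4 v ^ 4"
    using modular_lambda_inversion[OF \<tau>] unfolding modular_lambda_plus_1(1)[OF v] by (simp add: algebra_simps)
  obtain a b where ab: "a > 0" "b > 0" "theta2 v = of_real a" "theta4 v = of_real b"
    using theta_imaginary_axis[OF y] unfolding v_def by blast
  have "modular_lambda \<tau> = of_real (1 + a ^ 4 / b ^ 4)"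
    unfolding lam ab(3,4) by simp
  then have "norm (modular_lambda \<tau>) = \<bar>1 + a ^ 4 / b ^ 4\<bar>"
    by (simp only: norm_of_real)
  also have "\<dots> \<ge> 1"
    using ab by (intro order_trans[OF _ abs_ge_self]) simp
  finally show ?thesis .
qed

text \<open>A function without zeros that tends to 0 at infinity cannot be constant.\<close>

lemma not_constant_modular_lambda: "\<not> modular_lambda constant_on upper_half_plane"
proof
  assume "modular_lambda constant_on upper_half_plane"
  then obtain c where c: "\<And>z. Im z > 0 \<Longrightarrow> modular_lambda z = c"
    by (auto simp: constant_on_def upper_half_plane_def)
  have "c \<noteq> 0"
    using c[of \<i>] modular_lambda_nonzero[of \<i>] by auto
  have "\<forall>\<^sub>F z in at_i_infinity. dist (modular_lambda z) 0 < norm c"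
    using \<open>c \<noteq> 0\<close> by (intro tendstoD[OF modular_lambda_at_i_infinity]) auto
  then have "\<forall>\<^sub>F z in at_i_infinity. dist (modular_lambda z) 0 < norm c \<and> Im z > 0"
    using eventually_at_i_infinity_Im_gt by (rule eventually_conj)
  then obtain C where C: "\<And>z. Im z \<ge> C \<Longrightarrow> dist (modular_lambda z) 0 < norm c \<and> Im z > 0"
    unfolding eventually_at_i_infinity by blast
  have "dist (modular_lambda (Complex 0 C)) 0 < norm c" "Im (Complex 0 C) > 0"
    using C[of "Complex 0 C"] by simp_all
  then show False
    using c by simp
qed

text \<open>
  The set of points of the fundamental domain near which the identity fails is handled by the
  minimum modulus principle for \<open>\<lambda>\<close>: the infimum of \<open>\<bar>\<lambda>\<bar>\<close> over this set is less than 1, so it can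
  be approached neither at a cusp nor on the circular arcs, and it would be attained in the interior.
\<close>

theorem theta3_eq_hypergeometric:
  assumes \<tau>: "\<tau> \<in> Gamma2_domain" and "norm (modular_lambda \<tau>) < 1"
  shows "theta3 \<tau> ^ 2 = hyp2F1_half (modular_lambda \<tau>)"
proof (rule ccontr)
  assume neq: "theta3 \<tau> ^ 2 \<noteq> hyp2F1_half (modular_lambda \<tau>)"
  let ?H = upper_half_plane
  define \<Omega> where "\<Omega> = {z \<in> ?H. norm (modular_lambda z) < 1}"
  define h where "h z = theta3 z ^ 2 - hyp2F1_half (modular_lambda z)" for z
  \<comment> \<open>A whole neighbourhood is asked for because \<open>h\<close> may have isolated
    zeros. By the identity theorem (\<open>spread\<close>), \<open>good\<close> is either true or
    false throughout any ball on which |lambda| < 1.\<close>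
  define good where "good z \<longleftrightarrow> (\<exists>r>0. \<forall>w\<in>ball z r. h w = 0)" for z
  define B where "B = {z \<in> Gamma2_domain. norm (modular_lambda z) < 1 \<and> \<not> good z}"
  have H: "z \<in> ?H \<longleftrightarrow> Im z > 0" for z
    by (simp add: upper_half_plane_def)
  have cont: "continuous_on ?H modular_lambda"
    by (rule holomorphic_on_imp_continuous_on[OF holomorphic_on_modular_lambda])
  have "open (?H \<inter> modular_lambda -` ball 0 1)"
    by (rule continuous_open_preimage[OF cont open_upper_half_plane open_ball])
  moreover have "?H \<inter> modular_lambda -` ball 0 1 = \<Omega>"
    by (auto simp: \<Omega>_def)
  ultimately have open_\<Omega>: "open \<Omega>"
    by simp
  have h_hol: "h holomorphic_on \<Omega>"
  proof -
    have "modular_lambda holomorphic_on \<Omega>" "theta3 holomorphic_on \<Omega>"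
      by (auto intro: holomorphic_on_subset[of _ ?H] holomorphic_on_modular_lambda holomorphic_on_theta simp: \<Omega>_def)
    then show ?thesis
      unfolding h_def
      by (intro holomorphic_intros holomorphic_on_compose_gen[OF _ holomorphic_on_hyp2F1_half, unfolded o_def])
         (auto simp: \<Omega>_def)
  qed
  have h_per: "h (z + 2) = h z" if "Im z > 0" for z
    by (simp add: h_def theta3_plus_2[OF that] modular_lambda_plus_2[OF that])
  have spread: "good w" if z: "ball z r \<subseteq> \<Omega>" "u \<in> ball z r" "good u" "w \<in> ball z r" for z u w r
  proof -
    obtain e where e: "e > 0" "\<And>v. v \<in> ball u e \<Longrightarrow> h v = 0"
      using z(3) unfolding good_def by blast
    have hz: "h v = 0" if "v \<in> ball z r" for v
    proof (rule analytic_continuation_open[where s = "ball u e \<inter> ball z r" and s' = "ball z r" and f = h and g = "\<lambda>_. 0"])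
      show "h holomorphic_on ball z r"
        using h_hol z(1) by (rule holomorphic_on_subset)
      have "u \<in> ball u e \<inter> ball z r"
        using e(1) z(2) by auto
      then show "ball u e \<inter> ball z r \<noteq> {}"
        by blast
    qed (use e that in \<open>auto intro: holomorphic_on_const\<close>)
    obtain d where "d > 0" "ball w d \<subseteq> ball z r"
      using openE[OF open_ball z(4)] by blast
    then show "good w"
      unfolding good_def using hz by blast
  qed
  have good_eq: "h z = 0" if z: "good z" for z
  proof -
    obtain r where "r > 0" "\<forall>w\<in>ball z r. h w = 0"
      using z unfolding good_def by blast
    then show ?thesis
      by simp
  qed
  have good_per: "good z \<longleftrightarrow> good (z + 2)" if z: "Im z > 0" for z
  proof -
    obtain d where d: "d > 0" "ball z d \<subseteq> ?H"
      using openE[OF open_upper_half_plane iffD2[OF H z]] by blast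
    have *: "h (w + 2) = h w" if "w \<in> ball z d" for w
      using d(2) that H by (intro h_per) blast
    show ?thesis
    proof
      assume "good z"
      then obtain r where r: "r > 0" "\<And>w. w \<in> ball z r \<Longrightarrow> h w = 0"
        unfolding good_def by blast
      have "h w = 0" if "w \<in> ball (z + 2) (min r d)" for w
      proof -
        have "w - 2 \<in> ball z r" "w - 2 \<in> ball z d"
          using that by (auto simp: dist_norm algebra_simps)
        then show ?thesis
          using r(2)[of "w - 2"] *[of "w - 2"] by simp
      qed
      then show "good (z + 2)"
        unfolding good_def using r(1) d(1) by (intro exI[of _ "min r d"]) auto
    next
      assume "good (z + 2)"
      then obtain r where r: "r > 0" "\<And>w. w \<in> ball (z + 2) r \<Longrightarrow> h w = 0"
        unfolding good_def by blast
      have "h w = 0" if "w \<in> ball z (min r d)" for w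
      proof -
        have "w + 2 \<in> ball (z + 2) r" "w \<in> ball z d"
          using that by (auto simp: dist_norm algebra_simps)
        then show ?thesis
          using r(2)[of "w + 2"] *[of w] by simp
      qed
      then show "good z"
        unfolding good_def using r(1) d(1) by (intro exI[of _ "min r d"]) auto
    qed
  qed
  have \<tau>B: "\<tau> \<in> B"
    using assms good_eq neq unfolding B_def h_def by auto

  define m where "m = (INF z\<in>B. norm (modular_lambda z))"
  have bdd: "bdd_below ((\<lambda>z. norm (modular_lambda z)) ` B)"
    by (rule bdd_belowI[of _ 0]) auto
  have m_le: "m \<le> norm (modular_lambda z)" if "z \<in> B" for z
    unfolding m_def using bdd that by (rule cINF_lower)
  have "m < 1"
    using m_le[OF \<tau>B] assms(2) by simp
  have "\<exists>z\<in>B. norm (modular_lambda z) < m + 1 / real (Suc n)" for n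
  proof -
    have "(INF z\<in>B. norm (modular_lambda z)) < m + 1 / real (Suc n)"
      unfolding m_def by simp
    then show ?thesis
      using \<tau>B bdd by (subst (asm) cINF_less_iff) auto
  qed
  then obtain s where s: "\<And>n. s n \<in> B" "\<And>n. norm (modular_lambda (s n)) < m + 1 / real (Suc n)"
    by metis
  have "(\<lambda>n. m + 1 / real (Suc n)) \<longlonglongrightarrow> m + 0"
    by (intro tendsto_add tendsto_const LIMSEQ_Suc[OF lim_1_over_n])
  then have upper: "(\<lambda>n. m + 1 / real (Suc n)) \<longlonglongrightarrow> m"
    by simp
  have s_lim: "(\<lambda>n. norm (modular_lambda (s n))) \<longlonglongrightarrow> m"
  proof (rule tendsto_sandwich[OF _ _ tendsto_const upper])
    show "\<forall>\<^sub>F n in sequentially. m \<le> norm (modular_lambda (s n))"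
      using m_le s(1) by simp
    show "\<forall>\<^sub>F n in sequentially. norm (modular_lambda (s n)) \<le> m + 1 / real (Suc n)"
      using s(2) by (intro always_eventually allI less_imp_le)
  qed

  obtain C where C: "\<And>z. Im z \<ge> C \<Longrightarrow> theta3 z ^ 2 = hyp2F1_half (modular_lambda z)"
    using theta3_eq_hypergeometric_at_i_infinity unfolding eventually_at_i_infinity by blast
  \<comment> \<open>The extra 1 leaves room for a unit ball above height \<open>C\<close>. So
    \<open>B\<close> lies below a fixed height, and a minimising sequence stays in a compact
    box.\<close>
  have high_good: "good z" if "Im z \<ge> C + 1" for z
    unfolding good_def
  proof (intro exI[of _ 1] conjI ballI)
    fix w assume "w \<in> ball z 1"
    then have "\<bar>Im (z - w)\<bar> < 1"
      using abs_Im_le_cmod[of "z - w"] by (simp add: dist_norm)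
    then have "Im w \<ge> C"
      using that by auto
    then show "h w = 0"
      using C by (simp add: h_def)
  qed auto
  have B: "Im z > 0" "\<bar>Re z\<bar> \<le> 1" "\<bar>Re z\<bar> \<le> (Re z)\<^sup>2 + (Im z)\<^sup>2" "norm (modular_lambda z) < 1" "Im z < C + 1" "\<not> good z"
    if "z \<in> B" for z
    using that high_good[of z] not_le[of "C + 1" "Im z"] by (auto simp: B_def Gamma2_domain_iff)
  have "s n \<in> cbox (Complex (- 1) 0) (Complex 1 (C + 1))" for n
    using B(1,2,5)[OF s(1)[of n]] by (auto simp: in_cbox_complex_iff)
  then obtain p r where p: "p \<in> cbox (Complex (- 1) 0) (Complex 1 (C + 1))" "strict_mono r" "(s \<circ> r) \<longlonglongrightarrow> p"
    using compact_imp_seq_compact[OF compact_cbox] unfolding seq_compact_def by blast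
  define t where "t = s \<circ> r"
  have t: "t \<longlonglongrightarrow> p" "\<And>n. t n \<in> B"
    unfolding t_def using p(3) s(1) by simp_all
  have t_lim: "(\<lambda>n. norm (modular_lambda (t n))) \<longlonglongrightarrow> m"
    using LIMSEQ_subseq_LIMSEQ[OF s_lim p(2)] unfolding t_def o_def .
  have "(\<lambda>n. (Re (t n))\<^sup>2 + (Im (t n))\<^sup>2 - \<bar>Re (t n)\<bar>) \<longlonglongrightarrow> (Re p)\<^sup>2 + (Im p)\<^sup>2 - \<bar>Re p\<bar>"
    by (intro tendsto_intros t(1))
  then have "(Re p)\<^sup>2 + (Im p)\<^sup>2 - \<bar>Re p\<bar> \<ge> 0"
    by (rule LIMSEQ_le_const) (use B(3)[OF t(2)] in auto)
  then have p_out: "\<bar>Re p\<bar> \<le> (Re p)\<^sup>2 + (Im p)\<^sup>2"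
    by simp
  have p_strip: "\<bar>Re p\<bar> \<le> 1" "Im p \<ge> 0"
    using p(1) by (auto simp: in_cbox_complex_iff)
  show False
  proof (cases "Im p > 0")
    case True
    then have pD: "p \<in> Gamma2_domain"
      using p_out p_strip by (simp add: Gamma2_domain_iff)
    have "isCont modular_lambda p"
      using cont open_upper_half_plane True H by (simp add: continuous_on_eq_continuous_at)
    then have "(\<lambda>n. norm (modular_lambda (t n))) \<longlonglongrightarrow> norm (modular_lambda p)"
      using t(1) by (rule tendsto_norm[OF isCont_tendsto_compose])
    then have pm: "norm (modular_lambda p) = m"
      using t_lim LIMSEQ_unique by blast
    have p\<Omega>: "p \<in> \<Omega>"
      using True pm \<open>m < 1\<close> by (simp add: \<Omega>_def H)
    have inner: "\<bar>Re p\<bar> < (Re p)\<^sup>2 + (Im p)\<^sup>2"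
      using modular_lambda_arc[OF True] pm \<open>m < 1\<close> p_out by force
    \<comment> \<open>\<open>p\<close> may lie on a side Re = 1 or Re = -1 of the domain. In
      \<open>U\<close> a point beyond a side returns to the domain by a shift of 2, because the arcs
      and their translates by 2 and -2 are avoided; \<open>h\<close> and lambda do not change under
      that shift.\<close>
    define U where "U = \<Omega> \<inter> {z. \<bar>Re z\<bar> < (Re z)\<^sup>2 + (Im z)\<^sup>2} \<inter>
       {z. \<bar>Re (z - 2)\<bar> < (Re (z - 2))\<^sup>2 + (Im z)\<^sup>2} \<inter> {z. \<bar>Re (z + 2)\<bar> < (Re (z + 2))\<^sup>2 + (Im z)\<^sup>2} \<inter> {z. \<bar>Re z\<bar> < 2}"
    have "open U"
      unfolding U_def by (intro open_Int open_\<Omega> open_Collect_less continuous_intros)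
    moreover have "p \<in> U"
    proof -
      \<comment> \<open>As |Re p| <= 1, both translates of \<open>p\<close> have real part of
        modulus at least 1, where the strict circle condition is automatic.\<close>
      have "\<bar>x\<bar> < x\<^sup>2 + (Im p)\<^sup>2" if "\<bar>x\<bar> \<ge> 1" for x
      proof -
        have "\<bar>x\<bar> * 1 \<le> \<bar>x\<bar> * \<bar>x\<bar>"
          using that by (intro mult_left_mono) auto
        then show ?thesis
          using mult_pos_pos[OF True True] by (simp add: power2_eq_square)
      qed
      from this[of "Re (p - 2)"] this[of "Re (p + 2)"] show ?thesis
        using p\<Omega> inner p_strip by (auto simp: U_def)
    qed
    ultimately obtain e where e: "e > 0" "ball p e \<subseteq> U"
      by (rule openE)
    have not_good_p: "\<not> good p"
    proof
      assume "good p"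
      have "\<forall>\<^sub>F n in sequentially. t n \<in> ball p e"
        using t(1) e(1) by (intro topological_tendstoD) auto
      then obtain n where "t n \<in> ball p e"
        by (auto dest: eventually_happens)
      then have "good (t n)"
        using spread[of p e p "t n"] e \<open>good p\<close> by (auto simp: U_def)
      then show False
        using B(6)[OF t(2)] by blast
    qed
    \<comment> \<open>Failure spreads from \<open>p\<close> over the ball, so each of its points
      lies in \<open>B\<close> up to a period, and |lambda| has a local minimum at
      \<open>p\<close>.\<close>
    have le: "m \<le> norm (modular_lambda z)" if z: "z \<in> ball p e" for z
    proof -
      have zU: "z \<in> U" "Im z > 0" "norm (modular_lambda z) < 1"
        using e(2) z by (auto simp: U_def \<Omega>_def H)
      have ng: "\<not> good z"
        using spread[of p e z p] e z not_good_p by (auto simp: U_def)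
      consider "\<bar>Re z\<bar> \<le> 1" | "Re z > 1" | "Re z < - 1"
        by linarith
      then show ?thesis
      proof cases
        case 1
        then have "z \<in> B"
          using zU ng by (auto simp: B_def U_def Gamma2_domain_iff)
        then show ?thesis
          by (rule m_le)
      next
        case 2
        have "z - 2 \<in> B"
          using zU ng 2 good_per[of "z - 2"] modular_lambda_plus_2[of "z - 2"]
          by (auto simp: B_def U_def Gamma2_domain_iff)
        from m_le[OF this] show ?thesis
          using modular_lambda_plus_2[of "z - 2"] zU by simp
      next
        case 3
        have "z + 2 \<in> B"
          using zU ng 3 good_per[of z] modular_lambda_plus_2[of z]
          by (auto simp: B_def U_def Gamma2_domain_iff)
        from m_le[OF this] show ?thesis
          using modular_lambda_plus_2[of z] zU by simp
      qed
    qed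
    have "(\<lambda>z. inverse (modular_lambda z)) constant_on ?H"
    proof (rule maximum_modulus_principle)
      show "(\<lambda>z. inverse (modular_lambda z)) holomorphic_on ?H"
        by (intro holomorphic_intros) (auto simp: H modular_lambda_nonzero)
      show "connected ?H"
        by (rule convex_connected[OF convex_upper_half_plane])
      show "open (ball p e)" "p \<in> ball p e" "ball p e \<subseteq> ?H"
        using e by (auto simp: U_def \<Omega>_def)
      fix z assume "z \<in> ball p e"
      from le[OF this] show "norm (inverse (modular_lambda z)) \<le> norm (inverse (modular_lambda p))"
        unfolding norm_inverse pm[symmetric]
        using True by (intro le_imp_inverse_le) (auto simp: modular_lambda_nonzero)
    qed (rule open_upper_half_plane)
    then obtain c where "\<And>z. z \<in> ?H \<Longrightarrow> inverse (modular_lambda z) = c"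
      unfolding constant_on_def by blast
    then have "modular_lambda z = inverse c" if "z \<in> ?H" for z
      using that inverse_inverse_eq by metis
    then have "modular_lambda constant_on ?H"
      unfolding constant_on_def by blast
    then show False
      using not_constant_modular_lambda by blast
  next
    case False
    then have Imp: "Im p = 0"
      using p_strip by simp
    \<comment> \<open>With Im p = 0 the circle condition reads |Re p| <= (Re p)^2, and the strip |Re
      p| <= 1 then leaves only the cusps 0, 1 and -1.\<close>
    have le: "\<bar>Re p\<bar> * 1 \<le> \<bar>Re p\<bar> * \<bar>Re p\<bar>"
      using p_out Imp by (simp add: power2_eq_square)
    then have "\<bar>Re p\<bar> = 0 \<or> \<bar>Re p\<bar> = 1"
    proof (cases "Re p = 0")
      case False
      then have "\<bar>Re p\<bar> > 0"
        by simp
      then have "1 \<le> \<bar>Re p\<bar>"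
        using le by (simp only: mult_le_cancel_left_pos)
      then show ?thesis
        using p_strip by simp
    qed simp
    then have "p = 0 \<or> p = 1 \<or> p = - 1"
      using Imp by (auto simp: complex_eq_iff abs_if split: if_splits)
    then consider "p = 0" | "p = 1" | "p = - 1"
      by blast
    then show False
    proof cases
      case 1
      have "(\<lambda>n. modular_lambda (t n)) \<longlonglongrightarrow> 1"
      proof (rule modular_lambda_cusp_0)
        show "t \<longlonglongrightarrow> 0"
          using t(1) 1 by simp
        show "Im (t n) > 0" "\<bar>Re (- 1 / t n)\<bar> \<le> 1" for n
          using t(2)[of n] Gamma2_domain_neg_inverse[of "t n"] by (auto simp: B_def Gamma2_domain_iff)
      qed
      then have "(\<lambda>n. norm (modular_lambda (t n))) \<longlonglongrightarrow> 1"
        using tendsto_norm by fastforce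
      then show False
        using t_lim LIMSEQ_unique \<open>m < 1\<close> by fastforce
    next
      case 2
      \<comment> \<open>The circle condition survives the shift to 0: |u|^2 = |t|^2 - 2 Re t + 1 >=
        1 - Re t = |Re u|, because |t|^2 >= Re t and Re t <= 1.\<close>
      define u where "u n = t n - 1" for n
      have "u \<longlonglongrightarrow> 0"
        using tendsto_diff[OF t(1) tendsto_const[of 1]] 2 by (simp add: u_def[abs_def])
      moreover have u: "Im (u n) > 0" "\<bar>Re (- 1 / u n)\<bar> \<le> 1" for n
      proof -
        show "Im (u n) > 0"
          using B(1)[OF t(2)[of n]] by (simp add: u_def)
        then show "\<bar>Re (- 1 / u n)\<bar> \<le> 1"
          using B(2,3)[OF t(2)[of n]]
          by (intro abs_Re_neg_inverse_le_1) (auto simp: u_def power2_eq_square algebra_simps abs_if split: if_splits)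
      qed
      ultimately obtain n where "norm (modular_lambda (u n + 1)) > 1"
        using modular_lambda_cusp_1 by blast
      then show False
        using B(4)[OF t(2)[of n]] by (simp add: u_def)
    next
      case 3
      \<comment> \<open>Here u + 1 = t + 2, so the period 2 leads back to lambda(t).\<close>
      define u where "u n = t n + 1" for n
      have "u \<longlonglongrightarrow> 0"
        using tendsto_add[OF t(1) tendsto_const[of 1]] 3 by (simp add: u_def[abs_def])
      moreover have u: "Im (u n) > 0" "\<bar>Re (- 1 / u n)\<bar> \<le> 1" for n
      proof -
        show "Im (u n) > 0"
          using B(1)[OF t(2)[of n]] by (simp add: u_def)
        then show "\<bar>Re (- 1 / u n)\<bar> \<le> 1"
          using B(2,3)[OF t(2)[of n]]
          by (intro abs_Re_neg_inverse_le_1) (auto simp: u_def power2_eq_square algebra_simps abs_if split: if_splits)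
      qed
      ultimately obtain n where "norm (modular_lambda (u n + 1)) > 1"
        using modular_lambda_cusp_1 by blast
      then show False
        using B(4)[OF t(2)[of n]] modular_lambda_plus_2[OF B(1)[OF t(2)[of n]]] by (simp add: u_def add.assoc)
    qed
  qed
qed

subsection \<open>The discriminant and the period\<close>

text \<open>Subtracting the equations in pairs and dividing by the differences of the roots gives g2
  and a + b + c = 0; the rest is a polynomial identity in a and b. The factor 16 is due to the
  leading coefficient 4.\<close>

lemma cubic_discriminant:
  fixes a b c g2 g3 :: complex
  assumes roots: "0 = 4 * a ^ 3 - g2 * a - g3" "0 = 4 * b ^ 3 - g2 * b - g3" "0 = 4 * c ^ 3 - g2 * c - g3"
    and distinct: "a \<noteq> b" "a \<noteq> c" "b \<noteq> c"
  shows "curve_disc g2 g3 = 16 * ((a - b) * (a - c) * (b - c)) ^ 2"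
proof -
  have "(a - b) * (4 * (a ^ 2 + a * b + b ^ 2) - g2) = 0"
    using roots(1,2) by algebra
  then have 1: "g2 = 4 * (a ^ 2 + a * b + b ^ 2)"
    using distinct by simp
  have "(a - c) * (4 * (a ^ 2 + a * c + c ^ 2) - g2) = 0"
    using roots(1,3) by algebra
  then have 2: "g2 = 4 * (a ^ 2 + a * c + c ^ 2)"
    using distinct by simp
  have "(b - c) * (a + b + c) = 0"
    using 1 2 by algebra
  then have c: "c = - a - b"
  proof -
    have "a + b + c = 0"
      using \<open>(b - c) * (a + b + c) = 0\<close> distinct by simp
    then show ?thesis
      by algebra
  qed
  have g3: "g3 = 4 * a ^ 3 - g2 * a"
    using roots(1) by (simp add: algebra_simps)
  show ?thesis
    unfolding curve_disc_def g3 c unfolding 1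
    by (simp add: power2_eq_square power3_eq_cube algebra_simps)
qed

text \<open>Evenness and the period 2 z make the reflection in z a symmetry of the Weierstrass
  function. On the curve this says that half periods give points with y = 0.\<close>

lemma weierstrass_p_deriv_half_period:
  assumes \<tau>: "Im \<tau> > 0" and z: "2 * z \<in> int_span 1 \<tau>" "z \<notin> int_span 1 \<tau>" and w: "w \<noteq> 0"
  shows "deriv (weierstrass_p (int_span w (w * \<tau>))) (w * z) = 0"
proof -
  let ?p = "weierstrass_p (int_span 1 \<tau>)"
  have "deriv ?p z = 0"
  proof (rule deriv_zero_of_reflection)
    show "open (- int_span 1 \<tau>)" "z \<in> - int_span 1 \<tau>"
      using closed_lattice[OF \<tau>] z by (auto simp: open_closed)
    show "?p field_differentiable at z"
      by (rule weierstrass_p_near(2)[OF \<tau> z(2)])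
    fix x assume "x \<in> - int_span 1 \<tau>"
    then have "- x \<notin> int_span 1 \<tau>"
      by simp
    from weierstrass_p_periodic[OF \<tau> this z(1)] show "?p (2 * z - x) = ?p x"
      by (simp add: weierstrass_p_even)
  qed
  then have "(?p has_field_derivative 0) (at z)"
    using weierstrass_p_near(2)[OF \<tau> z(2)] by (metis DERIV_deriv_iff_field_differentiable)
  then have "(?p has_field_derivative 0) (at (w * z / w))"
    using w by simp
  from DERIV_chain2[where f = ?p and g = "\<lambda>x. x / w" and x = "w * z", OF this DERIV_cdivide[OF DERIV_ident]]
  have "((\<lambda>x. ?p (x / w)) has_field_derivative 0) (at (w * z))"
    by simp
  from DERIV_cdivide[OF this, of "w ^ 2"]
  have "((\<lambda>x. ?p (x / w) / w ^ 2) has_field_derivative 0) (at (w * z))"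
    by simp
  moreover have "weierstrass_p (int_span w (w * \<tau>)) = (\<lambda>x. ?p (x / w) / w ^ 2)"
  proof
    fix x
    show "weierstrass_p (int_span w (w * \<tau>)) x = ?p (x / w) / w ^ 2"
      using weierstrass_p_scale[OF w, of 1 \<tau> "x / w"] w by simp
  qed
  ultimately show ?thesis
    by (simp only: DERIV_imp_deriv)
qed

text \<open>The values at the half periods are the roots of the cubic, and their differences are
  pi^2 / w^2 times fourth powers of theta constants. With theta_2 theta_3 theta_4 = 2 eta^3 the
  discriminant becomes 16 pi^12 (2 eta^3)^8 / w^12, and 16 times 2^8 is 2^12.\<close>

lemma curve_disc_eq_eta:
  assumes \<tau>: "Im \<tau> > 0" and w: "w \<noteq> 0"
    and period: "is_period_lattice g2 g3 (int_span w (w * \<tau>))"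
  shows "curve_disc g2 g3 = (2 * of_real pi * dedekind_eta \<tau> ^ 2 / w) ^ 12"
proof -
  let ?p = "weierstrass_p (int_span 1 \<tau>)"
  let ?P = "weierstrass_p (int_span w (w * \<tau>))"
  note n = half_periods_not_in_lattice[OF \<tau>]
  have P: "?P (w * z) = ?p z / w ^ 2" for z
    using weierstrass_p_scale[OF w, of 1 \<tau> z] by simp
  have mem: "w * z \<in> int_span w (w * \<tau>) \<longleftrightarrow> z \<in> int_span 1 \<tau>" for z
  proof -
    have "w * z = of_int m * w + of_int n * (w * \<tau>) \<longleftrightarrow> z = of_int m * 1 + of_int n * \<tau>" for m n
    proof -
      have "of_int m * w + of_int n * (w * \<tau>) = w * (of_int m * 1 + of_int n * \<tau>)"
        by (simp add: algebra_simps)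
      then show ?thesis
        using w by simp
    qed
    then show ?thesis
      by (simp add: int_span_def)
  qed
  have root: "0 = 4 * (?p z / w ^ 2) ^ 3 - g2 * (?p z / w ^ 2) - g3"
    if "2 * z \<in> int_span 1 \<tau>" "z \<notin> int_span 1 \<tau>" for z
  proof -
    have "(?P (w * z), deriv ?P (w * z)) \<in> affine_curve g2 g3"
      using period that(2) mem unfolding is_period_lattice_def by blast
    then show ?thesis
      using weierstrass_p_deriv_half_period[OF \<tau> that w] unfolding P affine_curve_def by simp
  qed
  define a b c where "a = ?p (1 / 2) / w ^ 2" and "b = ?p ((1 + \<tau>) / 2) / w ^ 2" and "c = ?p (\<tau> / 2) / w ^ 2"
  have diffs: "a - b = of_real pi ^ 2 * theta4 \<tau> ^ 4 / w ^ 2" "a - c = of_real pi ^ 2 * theta3 \<tau> ^ 4 / w ^ 2"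
    "b - c = of_real pi ^ 2 * theta2 \<tau> ^ 4 / w ^ 2"
    unfolding a_def b_def c_def diff_divide_distrib[symmetric] weierstrass_p_half_period_differences[OF \<tau>] by simp_all
  have "a - b \<noteq> 0" "a - c \<noteq> 0" "b - c \<noteq> 0"
    unfolding diffs using theta_nonzero[OF \<tau>] w by simp_all
  then have distinct: "a \<noteq> b" "a \<noteq> c" "b \<noteq> c"
    by auto
  have "curve_disc g2 g3 = 16 * ((a - b) * (a - c) * (b - c)) ^ 2"
  proof (rule cubic_discriminant[OF _ _ _ distinct])
    have "2 * (x / 2) = x" for x :: complex
      by simp
    then have h: "2 * ((1 + \<tau>) / 2) \<in> int_span 1 \<tau>" "2 * (\<tau> / 2) \<in> int_span 1 \<tau>" "2 * (1 / 2) \<in> int_span 1 \<tau>"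
      using int_span_add[of 1 1 \<tau> \<tau>] by (simp_all only: int_span_gens)
    show "0 = 4 * a ^ 3 - g2 * a - g3"
      unfolding a_def by (rule root[OF h(3) n(1)])
    show "0 = 4 * b ^ 3 - g2 * b - g3"
      unfolding b_def by (rule root[OF h(1) n(3)])
    show "0 = 4 * c ^ 3 - g2 * c - g3"
      unfolding c_def by (rule root[OF h(2) n(2)])
  qed
  also have "\<dots> = 16 * (of_real pi ^ 6 * (theta2 \<tau> * theta3 \<tau> * theta4 \<tau>) ^ 4 / w ^ 6) ^ 2"
    unfolding diffs by (simp add: power_mult_distrib power_divide field_simps)
  also have "\<dots> = (2 * of_real pi * dedekind_eta \<tau> ^ 2 / w) ^ 12"
    unfolding theta_product[OF \<tau>] by (simp add: power_mult_distrib power_divide)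
  finally show ?thesis .
qed

text \<open>The constant 2^(2/3) is the sixth root of 16, which enters through the fourth power of 2
  eta^3.\<close>

lemma is_lambda_root6_eta_theta3:
  "is_lambda_root6 (\<lambda>\<tau>. of_real (2 powr (2 / 3)) * dedekind_eta \<tau> ^ 2 / theta3 \<tau> ^ 2)"
  unfolding is_lambda_root6_def
proof (intro conjI ballI allI impI)
  show "(\<lambda>\<tau>. of_real (2 powr (2 / 3)) * dedekind_eta \<tau> ^ 2 / theta3 \<tau> ^ 2) holomorphic_on upper_half_plane"
    by (intro holomorphic_intros) (auto simp: theta_nonzero upper_half_plane_def)
next
  fix \<tau> assume "\<tau> \<in> upper_half_plane"
  then have \<tau>: "Im \<tau> > 0"
    by (simp add: upper_half_plane_def)
  have "(2 powr (2 / 3) :: real) ^ 6 = 16"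
    by (simp add: powr_power)
  then have two: "(of_real (2 powr (2 / 3)) :: complex) ^ 6 = 16"
    by (metis of_real_numeral of_real_power)
  have "(of_real (2 powr (2 / 3)) * dedekind_eta \<tau> ^ 2 / theta3 \<tau> ^ 2) ^ 6 =
      (2 * dedekind_eta \<tau> ^ 3) ^ 4 / theta3 \<tau> ^ 12"
    by (simp add: power_mult_distrib power_divide two)
  also have "\<dots> = theta2 \<tau> ^ 4 / theta3 \<tau> ^ 4 * (theta4 \<tau> ^ 4 / theta3 \<tau> ^ 4)"
    unfolding theta_product[OF \<tau>, symmetric] using theta_nonzero[OF \<tau>]
    by (simp add: power_mult_distrib divide_simps power_add[symmetric])
  finally show "(of_real (2 powr (2 / 3)) * dedekind_eta \<tau> ^ 2 / theta3 \<tau> ^ 2) ^ 6 =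
      modular_lambda \<tau> * (1 - modular_lambda \<tau>)"
    unfolding one_minus_modular_lambda[OF \<tau>] by (simp add: modular_lambda_def)
next
  fix t :: real assume t: "t > 0"
  obtain r s where "r > 0" "s > 0" "theta3 (\<i> * of_real t) = of_real r" "dedekind_eta (\<i> * of_real t) = of_real s"
    using theta_imaginary_axis[OF t] by blast
  then show "\<exists>r>0. of_real (2 powr (2 / 3)) * dedekind_eta (\<i> * of_real t) ^ 2 / theta3 (\<i> * of_real t) ^ 2 = of_real r"
    by (intro exI[of _ "2 powr (2 / 3) * s ^ 2 / r ^ 2"]) simp
qed

theorem theorem2:
  fixes g2 g3 \<omega>1 \<omega>2 \<tau> :: complex
  assumes "curve_disc g2 g3 \<noteq> 0"
    and "is_period_lattice g2 g3 (int_span \<omega>1 \<omega>2)"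
    and "\<tau> = \<omega>2 / \<omega>1"
    and "\<tau> \<in> upper_half_plane"
    and "\<tau> \<in> Gamma2_domain"
    and "norm (1 - modular_lambda \<tau>) < 1"
  shows "\<exists>L D. is_lambda_root6 L \<and> is_disc_root12 g2 g3 \<omega>1 \<tau> D \<and>
           \<omega>1 = of_real (2 powr (1 / 3)) * (of_real pi * \<i> / \<tau>) * L \<tau> * inverse D *
                hyp2F1 (1 / 2) (1 / 2) 1 (1 - modular_lambda \<tau>)"
proof -
  define L where "L = (\<lambda>\<tau>. of_real (2 powr (2 / 3)) * dedekind_eta \<tau> ^ 2 / theta3 \<tau> ^ 2)"
  define D where "D = 2 * of_real pi * dedekind_eta \<tau> ^ 2 / \<omega>1"
  have \<tau>: "Im \<tau> > 0"
    using assms(4) by (simp add: upper_half_plane_def)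
  have nz: "\<omega>1 \<noteq> 0" "\<tau> \<noteq> 0"
    using \<tau> assms(3) by auto
  have \<omega>2: "\<omega>2 = \<omega>1 * \<tau>"
    using nz assms(3) by simp
  have eta: "dedekind_eta \<tau> \<noteq> 0"
    using theta_product[OF \<tau>] theta_nonzero[OF \<tau>] by auto
  have "theta3 (- 1 / \<tau>) ^ 2 = hyp2F1_half (modular_lambda (- 1 / \<tau>))"
    by (rule theta3_eq_hypergeometric[OF Gamma2_domain_neg_inverse[OF assms(5)]])
       (simp only: modular_lambda_inversion[OF \<tau>] assms(6))
  then have F: "hyp2F1 (1 / 2) (1 / 2) 1 (1 - modular_lambda \<tau>) = - (\<i> * \<tau> * theta3 \<tau> ^ 2)"
    by (simp only: modular_lambda_inversion[OF \<tau>] theta3_inversion[OF \<tau>])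
  \<comment> \<open>The two powers of 2 combine to cancel the 2 in \<open>D\<close>, and the factor
    -i tau from the inversion of theta_3 cancels i / tau.\<close>
  have "of_real (2 powr (1 / 3)) * of_real (2 powr (2 / 3)) = (2 :: complex)"
    unfolding of_real_mult[symmetric] powr_add[symmetric] by simp
  moreover have "of_real (2 powr (1 / 3)) * (of_real pi * \<i> / \<tau>) * L \<tau> * inverse D *
      hyp2F1 (1 / 2) (1 / 2) 1 (1 - modular_lambda \<tau>) =
      (of_real (2 powr (1 / 3)) * of_real (2 powr (2 / 3))) * (\<omega>1 / 2)"
    unfolding F L_def D_def using nz eta theta_nonzero[OF \<tau>] by (simp add: field_simps)
  ultimately have "\<omega>1 = of_real (2 powr (1 / 3)) * (of_real pi * \<i> / \<tau>) * L \<tau> * inverse D *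
      hyp2F1 (1 / 2) (1 / 2) 1 (1 - modular_lambda \<tau>)"
    by simp
  moreover have "is_disc_root12 g2 g3 \<omega>1 \<tau> D"
    unfolding is_disc_root12_def
    using curve_disc_eq_eta[OF \<tau> nz(1) assms(2)[unfolded \<omega>2]] nz by (simp add: D_def)
  ultimately show ?thesis
    using is_lambda_root6_eta_theta3 unfolding L_def by blast
qed

end
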